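(* There exists, over $\mathbb{C}$, a codimension $11$ family of plane autonomous systems of degree $3$ with a focus for which nevertheless the first $11$ focal values vanish, $s_1=\dots=s_{11}=0$, but the $12$th focal value $s_{12}$ does not.
   Context: A plane autonomous system here is a system $\dot x = y+q(x,y)=Q(x,y)$, $\dot y=-x-p(x,y)=-P(x,y)$, where $p,q$ start with quadratic terms. For degree $3$, $P$ and $Q$ are polynomials of degree at most three, so that $p,q$ together have $14$ coefficients; codimension is taken in the space of all possible $(P,Q)$ of degree at most three. Focal values: Poincaré showed that one can iteratively find a formal power series $F=x^2+y^2+f_3(x,y)+f_4(x,y)+\cdots$ (with $f_k$ homogeneous of degree $k$) such that $$\det\begin{pmatrix}F_x&F_y\\P&Q\end{pmatrix}=\sum_{j=1}^\infty s_j\,(x^{2j+2}+y^{2j+2}),$$ with $s_j$ polynomials in the coefficients of $P$ and $Q$. The $s_j$ are called the focal values of $P\,dx+Q\,dy$. Focus: for a real system, the origin is a center if all solutions near $(0,0)$ are closed curves around $(0,0)$, which holds if and only if all focal values vanish; otherwise it is a focus. For complex coefficients, "focus" is used in the corresponding sense that not all focal values vanish. *)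

theory Defs
  imports "HOL-Computational_Algebra.Computational_Algebra" "HOL-Library.Extended_Nat"
begin

text \<open>
  Bivariate polynomials and power series are nested, with \<open>x\<close> the inner and \<open>y\<close> the outer
  variable: the coefficient of \<open>x^i y^j\<close> in a power series \<open>F\<close> is \<open>F $ j $ i\<close>.
\<close>

definition bcoeff :: "'a::zero poly poly \<Rightarrow> nat \<Rightarrow> nat \<Rightarrow> 'a" where
  "bcoeff P i j = coeff (coeff P j) i"

definition bfps_of_poly :: "complex poly poly \<Rightarrow> complex fps fps" where
  "bfps_of_poly P = fps_of_poly (map_poly fps_of_poly P)"

definition fps_x :: "complex fps fps" where "fps_x = fps_const fps_X"

definition fps_y :: "complex fps fps" where "fps_y = fps_X"

definition deriv_x :: "complex fps fps \<Rightarrow> complex fps fps" where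
  "deriv_x F = Abs_fps (\<lambda>j. fps_deriv (F $ j))"

definition deriv_y :: "complex fps fps \<Rightarrow> complex fps fps" where
  "deriv_y F = fps_deriv F"


text \<open>The pair \<open>(P, Q)\<close> stands for the system \<open>x' = Q(x,y)\<close>, \<open>y' = - P(x,y)\<close>.\<close>

type_synonym system = "complex poly poly \<times> complex poly poly"

definition cubic_systems :: "system set" where
  "cubic_systems = {([:[:0, 1:]:] + p, [:0, 1:] + q) | p q.
     \<forall>i j. i + j \<notin> {2, 3} \<longrightarrow> bcoeff p i j = 0 \<and> bcoeff q i j = 0}"

text \<open>
  \<open>focal_values P Q s\<close>: the sequence \<open>s 1, s 2, \<dots>\<close> arises from some series
  \<open>F = x^2 + y^2 + f_3 + f_4 + \<dots>\<close> as in Poincare's construction (\<open>s 0\<close> is irrelevant).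
  The identity of power series is stated coefficientwise; in the coefficient of \<open>x^i y^j\<close>
  the terms with \<open>k > i + j\<close> do not contribute.

  \<open>F\<close>, and hence \<open>s\<close>, is not unique, since multiples of \<open>(x^2 + y^2)^k\<close>, \<open>k \<ge> 2\<close>, may be added
  to \<open>f_2k\<close>; only the position and the value of the first nonzero \<open>s k\<close> do not depend on \<open>F\<close>.
\<close>

definition focal_values :: "complex poly poly \<Rightarrow> complex poly poly \<Rightarrow> (nat \<Rightarrow> complex) \<Rightarrow> bool" where
  "focal_values P Q s \<longleftrightarrow> (\<exists>F :: complex fps fps.
     (\<forall>i j. i + j \<le> 2 \<longrightarrow> F $ j $ i = (fps_x ^ 2 + fps_y ^ 2) $ j $ i) \<and>
     (\<forall>i j. (deriv_x F * bfps_of_poly Q - deriv_y F * bfps_of_poly P) $ j $ i =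
        (\<Sum>k=1..i+j. fps_const (fps_const (s k)) *
           (fps_x ^ (2 * k + 2) + fps_y ^ (2 * k + 2))) $ j $ i))"

definition has_focus :: "complex poly poly \<Rightarrow> complex poly poly \<Rightarrow> bool" where
  "has_focus P Q \<longleftrightarrow> (\<exists>s. focal_values P Q s \<and> (\<exists>k\<ge>1. s k \<noteq> 0))"


text \<open>
  The Zariski topology of \<open>cubic_systems\<close>, an affine space of dimension 14 with the
  coefficients of degree 2 and 3 as coordinates.
\<close>

inductive_set coeff_polynomials :: "(system \<Rightarrow> complex) set" where
  const: "(\<lambda>_. c) \<in> coeff_polynomials"
| coeff_P: "(\<lambda>(P, Q). bcoeff P i j) \<in> coeff_polynomials"
| coeff_Q: "(\<lambda>(P, Q). bcoeff Q i j) \<in> coeff_polynomials"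
| add: "f \<in> coeff_polynomials \<Longrightarrow> g \<in> coeff_polynomials \<Longrightarrow> (\<lambda>S. f S + g S) \<in> coeff_polynomials"
| mult: "f \<in> coeff_polynomials \<Longrightarrow> g \<in> coeff_polynomials \<Longrightarrow> (\<lambda>S. f S * g S) \<in> coeff_polynomials"

definition zariski_closed :: "system set \<Rightarrow> bool" where
  "zariski_closed Z \<longleftrightarrow>
     (\<exists>A \<subseteq> coeff_polynomials. Z = {S \<in> cubic_systems. \<forall>f\<in>A. f S = 0})"

definition zariski_closure :: "system set \<Rightarrow> system set" where
  "zariski_closure W = \<Inter>{Z. zariski_closed Z \<and> W \<subseteq> Z}"

definition zariski_locally_closed :: "system set \<Rightarrow> bool" where
  "zariski_locally_closed W \<longleftrightarrow> (\<exists>A B. zariski_closed A \<and> zariski_closed B \<and> W = A - B)"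

definition zariski_irreducible :: "system set \<Rightarrow> bool" where
  "zariski_irreducible W \<longleftrightarrow> W \<noteq> {} \<and>
     (\<forall>A B. zariski_closed A \<longrightarrow> zariski_closed B \<longrightarrow> W \<subseteq> A \<union> B \<longrightarrow> W \<subseteq> A \<or> W \<subseteq> B)"

text \<open>Krull codimension in \<open>cubic_systems\<close>; meaningful for irreducible \<open>W\<close>.\<close>

definition zariski_codim :: "system set \<Rightarrow> enat" where
  "zariski_codim W = Sup {enat n | n. \<exists>Z :: nat \<Rightarrow> system set.
     Z 0 = zariski_closure W \<and>
     (\<forall>i\<le>n. zariski_closed (Z i) \<and> zariski_irreducible (Z i)) \<and>
     (\<forall>i<n. Z i \<subset> Z (Suc i))}"

end

theory Submission
  imports Defs "HOL-Analysis.Continuum_Not_Denumerable" "HOL-Number_Theory.Cong"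
begin

text \<open>
  In the coordinates \<open>z = x + i y\<close>, \<open>w = x - i y\<close> the monomials are eigenvectors of the linear
  part, so that the formal series \<open>F\<close> is given by an explicit recursion; after scaling it gives
  integer polynomials \<open>\<sigma>\<^sub>1, \<dots>, \<sigma>\<^sub>1\<^sub>2\<close> in the 14 coefficients, and if \<open>\<sigma>\<^sub>1, \<dots>, \<sigma>\<^sub>1\<^sub>1\<close> vanish but
  \<open>\<sigma>\<^sub>1\<^sub>2\<close> does not, then the same holds for the focal values.

  For a certain sparse integer system, \<open>\<sigma>\<^sub>1 = \<dots> = \<sigma>\<^sub>1\<^sub>1 = 0\<close> and \<open>\<sigma>\<^sub>1\<^sub>2 \<noteq> 0\<close> mod 37, and the
  differentials of \<open>\<sigma>\<^sub>1, \<dots>, \<sigma>\<^sub>1\<^sub>1\<close> are independent mod 37.  By Hensel lifting, all integer values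
  of three remaining coordinates \<open>B\<close> in fixed residue classes extend to solutions of
  \<open>\<sigma>\<^sub>1 = \<dots> = \<sigma>\<^sub>1\<^sub>1 = 0\<close> mod \<open>37\<^sup>k\<close> with \<open>\<sigma>\<^sub>1\<^sub>2\<close> a unit.

  Hence no identity \<open>\<sigma>\<^sub>1\<^sub>2\<^sup>n q = \<Sum>m. h\<^sub>m \<sigma>\<^sub>m\<close> holds over the complex numbers with a polynomial \<open>q \<noteq> 0\<close> in
  the coordinates \<open>B\<close>: composing with a rational-linear functional on the complex numbers turns it
  into one with rational values of bounded denominator, and \<open>k \<rightarrow> \<infinity>\<close> gives \<open>q = 0\<close> at integer
  points.  An ideal containing \<open>\<sigma>\<^sub>1, \<dots>, \<sigma>\<^sub>1\<^sub>1\<close> and maximal among those avoiding all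
  \<open>\<sigma>\<^sub>1\<^sub>2\<^sup>n q\<close> is prime, and \<open>B\<close> is a transcendence basis modulo it, because the complex numbers
  are uncountable.  The codimension of its zero set is thus \<open>14 - 3 = 11\<close>, and removing the
  zeros of \<open>\<sigma>\<^sub>1\<^sub>2\<close> leaves the required family.
\<close>


section \<open>Polynomial functions and their ideals\<close>

text \<open>No exact solution of the eleven equations is computed: the explicit data are values
  modulo \<open>37^2\<close> at twelve integer systems, and complex points come from the
  Nullstellensatz. Shifting one coordinate by 37 changes an integer polynomial, modulo
  \<open>37^2\<close>, by 37 times its partial derivative, so the same evaluations also yield the
  Jacobian modulo 37. The cofactors \<open>h\<close> of a hypothetical identity are complex and have
  no residue modulo 37, hence the rational functional.

  Sparsity helps through two gradings. Give quadratic coefficients weight 1 and cubic ones weight 2;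
  then the m-th polynomial has weight 2m and is invariant under \<open>z -> c z\<close>,
  \<open>w -> w / c\<close>. On systems supported in the coordinates 3, 6, 8, 12 both conditions
  hold together only if 3 divides m. So only the equations 3, 6, 9 have to be met at the centre, and
  the Jacobian splits into blocks by m modulo 3.

  Avoiding all products with nonzero \<open>q\<close> in the coordinates \<open>B\<close>, and not
  just powers of the twelfth polynomial, controls the dimension from both sides: \<open>B\<close>
  stays independent, and maximality makes every other coordinate algebraic over
  \<open>B\<close>.\<close>

type_synonym cfun = "(nat \<Rightarrow> complex) \<Rightarrow> complex"

text \<open>Polynomials are represented by the functions they induce, which is faithful over the
  infinite field of complex numbers. Indexing by the set \<open>B\<close> of admissible variables
  makes the passage to fewer variables an inclusion of sets.\<close>

inductive_set pf :: "nat set \<Rightarrow> cfun set" for B :: "nat set" where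
  pf_const: "(\<lambda>_. c) \<in> pf B"
| pf_var: "i \<in> B \<Longrightarrow> (\<lambda>z. z i) \<in> pf B"
| pf_add: "f \<in> pf B \<Longrightarrow> g \<in> pf B \<Longrightarrow> (\<lambda>z. f z + g z) \<in> pf B"
| pf_mult: "f \<in> pf B \<Longrightarrow> g \<in> pf B \<Longrightarrow> (\<lambda>z. f z * g z) \<in> pf B"

lemma pf_mono: "f \<in> pf B \<Longrightarrow> B \<subseteq> B' \<Longrightarrow> f \<in> pf B'"
  by (induction rule: pf.induct) (auto intro: pf.intros)

lemma pf_uminus: "f \<in> pf B \<Longrightarrow> (\<lambda>z. - f z) \<in> pf B"
  using pf_mult[OF pf_const[of "-1"], of f] by simp

lemma pf_diff: "f \<in> pf B \<Longrightarrow> g \<in> pf B \<Longrightarrow> (\<lambda>z. f z - g z) \<in> pf B"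
  using pf_add[OF _ pf_uminus, of f B g] by simp

lemma pf_power: "f \<in> pf B \<Longrightarrow> (\<lambda>z. f z ^ n) \<in> pf B"
  by (induction n) (auto intro: pf_const pf_mult)

lemma pf_sum: "(\<And>i. i \<in> A \<Longrightarrow> f i \<in> pf B) \<Longrightarrow> (\<lambda>z. \<Sum>i\<in>A. f i z) \<in> pf B"
  by (induction A rule: infinite_finite_induct) (auto intro: pf_const pf_add)

lemma pf_prod: "(\<And>i. i \<in> A \<Longrightarrow> f i \<in> pf B) \<Longrightarrow> (\<lambda>z. \<Prod>i\<in>A. f i z) \<in> pf B"
  by (induction A rule: infinite_finite_induct) (auto intro: pf_const pf_mult)

lemma pf_depends: "f \<in> pf B \<Longrightarrow> (\<And>i. i \<in> B \<Longrightarrow> z i = z' i) \<Longrightarrow> f z = f z'"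
  by (induction rule: pf.induct) auto

lemma pf_empty_const: "f \<in> pf {} \<Longrightarrow> f = (\<lambda>_. f z)"
  using pf_depends[of f "{}"] by blast

lemma pf_line: "f \<in> pf B \<Longrightarrow> \<exists>p. \<forall>t. f (\<lambda>i. a i + t * b i) = poly p t"
proof (induction rule: pf.induct)
  case (pf_const c) show ?case by (rule exI[of _ "[:c:]"]) simp
next
  case (pf_var i) show ?case by (rule exI[of _ "[:a i, b i:]"]) simp
next
  case (pf_add f g)
  then obtain p q where "\<forall>t. f (\<lambda>i. a i + t * b i) = poly p t" "\<forall>t. g (\<lambda>i. a i + t * b i) = poly q t" by blast
  then show ?case by (intro exI[of _ "p + q"]) simp
next
  case (pf_mult f g)
  then obtain p q where "\<forall>t. f (\<lambda>i. a i + t * b i) = poly p t" "\<forall>t. g (\<lambda>i. a i + t * b i) = poly q t" by blast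
  then show ?case by (intro exI[of _ "p * q"]) simp
qed

text \<open>On the line through \<open>p\<close> and \<open>q\<close> both functions become
  univariate polynomials, nonzero because of their values at \<open>t = 0\<close> and
  \<open>t = 1\<close>, so their product has a non-root. This excludes zero divisors and later gives
  the irreducibility of cylinders.\<close>

lemma pf_line_common_nonzero:
  assumes "f \<in> pf B" "g \<in> pf B'" "f p \<noteq> 0" "g q \<noteq> 0"
  obtains t where "f (\<lambda>i. p i + t * (q i - p i)) \<noteq> 0" "g (\<lambda>i. p i + t * (q i - p i)) \<noteq> 0"
proof -
  obtain u v where u: "\<And>t. f (\<lambda>i. p i + t * (q i - p i)) = poly u t"
    and v: "\<And>t. g (\<lambda>i. p i + t * (q i - p i)) = poly v t"
    using pf_line[OF assms(1), of p "\<lambda>i. q i - p i"] pf_line[OF assms(2), of p "\<lambda>i. q i - p i"] by blast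
  have "u \<noteq> 0" using u[of 0] assms(3) by auto
  moreover have "v \<noteq> 0" using v[of 1] assms(4) by auto
  ultimately have "u * v \<noteq> 0" by simp
  then have "\<not> (\<forall>t. poly (u * v) t = 0)" by (subst poly_all_0_iff_0)
  then obtain t where "poly (u * v) t \<noteq> 0" by blast
  then show ?thesis using that[of t] u v by simp
qed

lemma pf_no_zero_divisors:
  assumes "f \<in> pf B" "g \<in> pf B'" "f \<noteq> (\<lambda>_. 0)" "g \<noteq> (\<lambda>_. 0)"
  shows "(\<lambda>z. f z * g z) \<noteq> (\<lambda>_. 0)"
proof -
  obtain p q where "f p \<noteq> 0" "g q \<noteq> 0" using assms(3,4) by blast
  from pf_line_common_nonzero[OF assms(1,2) this] obtain r where "f r \<noteq> 0" "g r \<noteq> 0" by blast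
  then have "f r * g r \<noteq> 0" by simp
  then show ?thesis by (auto dest: fun_cong)
qed

section \<open>Substitution, expansion into monomials, elimination\<close>

lemma pf_subst:
  "f \<in> pf B \<Longrightarrow> (\<lambda>z. f (\<lambda>i. if i \<in> J then c i else z i)) \<in> pf (B - J)"
proof (induction rule: pf.induct)
  case (pf_var i) then show ?case by (cases "i \<in> J") (auto intro: pf.intros)
qed (auto intro: pf.intros)

lemma pf_insert_expand:
  assumes "f \<in> pf (insert j B)"
  obtains M c where "\<And>i. c i \<in> pf B" "f = (\<lambda>z. \<Sum>i\<le>(M::nat). c i z * z j ^ i)"
proof -
  \<comment> \<open>The induction also carries that the coefficients vanish beyond \<open>M\<close>,
    so that two expansions can be brought to a common length and multiplied by
    \<open>polynomial_product\<close>.\<close>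
  have "\<exists>M c. (\<forall>i. c i \<in> pf B) \<and> (\<forall>i>M. c i = (\<lambda>_. 0)) \<and> f = (\<lambda>z. \<Sum>i\<le>(M::nat). c i z * z j ^ i)"
    using assms
  proof (induction rule: pf.induct)
    case (pf_const a)
    show ?case
      by (rule exI[of _ 0], rule exI[of _ "\<lambda>i. if i = 0 then (\<lambda>_. a) else (\<lambda>_. 0)"])
        (auto intro: pf.intros)
  next
    case (pf_var i)
    show ?case
    proof (cases "i = j")
      case True
      show ?thesis
        by (rule exI[of _ 1], rule exI[of _ "\<lambda>i. if i = 1 then (\<lambda>_. 1) else (\<lambda>_. 0)"])
          (auto intro: pf.intros simp: True)
    next
      case False
      then show ?thesis using pf_var
        by (intro exI[of _ 0] exI[of _ "\<lambda>k. if k = 0 then (\<lambda>z. z i) else (\<lambda>_. 0)"])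
          (auto intro: pf.intros)
    qed
  next
    case (pf_add f g)
    then obtain M c M' c' where c: "\<forall>i. c i \<in> pf B" "\<forall>i>M. c i = (\<lambda>_. 0)"
      "f = (\<lambda>z. \<Sum>i\<le>M. c i z * z j ^ i)"
      and c': "\<forall>i. c' i \<in> pf B" "\<forall>i>M'. c' i = (\<lambda>_. 0)" "g = (\<lambda>z. \<Sum>i\<le>M'. c' i z * z j ^ i)" by blast
    let ?K = "max M M'"
    have "f = (\<lambda>z. \<Sum>i\<le>?K. c i z * z j ^ i)"
      unfolding c(3) by (intro ext sum.mono_neutral_left) (auto simp: c(2))
    moreover have "g = (\<lambda>z. \<Sum>i\<le>?K. c' i z * z j ^ i)"
      unfolding c'(3) by (intro ext sum.mono_neutral_left) (auto simp: c'(2))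
    ultimately have "(\<lambda>z. f z + g z) = (\<lambda>z. \<Sum>i\<le>?K. (c i z + c' i z) * z j ^ i)"
      by (simp add: sum.distrib ring_distribs)
    then show ?case
      by (intro exI[of _ ?K] exI[of _ "\<lambda>i z. c i z + c' i z"]) (use c c' in \<open>auto intro: pf.intros\<close>)
  next
    case (pf_mult f g)
    then obtain M c M' c' where c: "\<forall>i. c i \<in> pf B" "\<forall>i>M. c i = (\<lambda>_. 0)"
      "f = (\<lambda>z. \<Sum>i\<le>M. c i z * z j ^ i)"
      and c': "\<forall>i. c' i \<in> pf B" "\<forall>i>M'. c' i = (\<lambda>_. 0)" "g = (\<lambda>z. \<Sum>i\<le>M'. c' i z * z j ^ i)" by blast
    define d where "d k = (\<lambda>z. \<Sum>i\<le>k. c i z * c' (k - i) z)" for k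
    have "f z * g z = (\<Sum>k\<le>M + M'. d k z * z j ^ k)" for z
      unfolding c(3) c'(3) d_def
      by (rule polynomial_product) (use c c' in auto)
    moreover have "d k = (\<lambda>_. 0)" if "k > M + M'" for k
    proof -
      have "c i z * c' (k - i) z = 0" if "i \<le> k" for i z
      proof (cases "i > M")
        case True then show ?thesis using c(2) by simp
      next
        case False then have "k - i > M'" using \<open>k > M + M'\<close> by linarith
        then show ?thesis using c'(2) by simp
      qed
      then show ?thesis unfolding d_def by (intro ext sum.neutral) simp
    qed
    moreover have "d k \<in> pf B" for k
      unfolding d_def by (intro pf_sum pf.pf_mult) (use c c' in auto)
    ultimately show ?case by blast
  qed
  then show ?thesis using that by blast
qed

text \<open>Monomials are products along lists of variables, and lists are enumerated by
  \<open>from_nat\<close>. Countability of this spanning set drives the cardinality argument;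
  finiteness of each expansion later bounds denominators.\<close>

lemma pf_countable_span:
  assumes "f \<in> pf B"
  shows "\<exists>d c. f = (\<lambda>z. \<Sum>i<d. c i * prod_list (map z (from_nat i :: nat list)))"
proof -
  define m where "m i = (\<lambda>z::nat\<Rightarrow>complex. prod_list (map z (from_nat i :: nat list)))" for i
  have single: "\<exists>d c. (\<forall>i\<ge>d. c i = 0) \<and> (\<lambda>z. a * prod_list (map z l)) = (\<lambda>z. \<Sum>i<d. c i * m i z)" for a l
    by (rule exI[of _ "Suc (to_nat l)"], rule exI[of _ "\<lambda>i. if i = to_nat l then a else 0"])
      (auto simp: m_def)
  have plus: "\<exists>d c. (\<forall>i\<ge>d. c i = 0) \<and> (\<lambda>z. f z + g z) = (\<lambda>z. \<Sum>i<d. c i * m i z)"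
    if "\<exists>d c. (\<forall>i\<ge>d. c i = 0) \<and> f = (\<lambda>z. \<Sum>i<d. c i * m i z)"
      "\<exists>d c. (\<forall>i\<ge>d. c i = 0) \<and> g = (\<lambda>z. \<Sum>i<d. c i * m i z)" for f g
  proof -
    from that obtain d c d' c' where c: "\<forall>i\<ge>d. c i = 0" "f = (\<lambda>z. \<Sum>i<d. c i * m i z)"
      and c': "\<forall>i\<ge>d'. c' i = 0" "g = (\<lambda>z. \<Sum>i<d'. c' i * m i z)" by blast
    have "f = (\<lambda>z. \<Sum>i<max d d'. c i * m i z)"
      unfolding c(2) by (intro ext sum.mono_neutral_left) (auto simp: c(1))
    moreover have "g = (\<lambda>z. \<Sum>i<max d d'. c' i * m i z)"
      unfolding c'(2) by (intro ext sum.mono_neutral_left) (auto simp: c'(1))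
    ultimately have "(\<lambda>z. f z + g z) = (\<lambda>z. \<Sum>i<max d d'. (c i + c' i) * m i z)"
      by (simp add: sum.distrib ring_distribs)
    then show ?thesis
      by (intro exI[of _ "max d d'"] exI[of _ "\<lambda>i. c i + c' i"]) (use c c' in auto)
  qed
  have sums: "\<exists>d c. (\<forall>i\<ge>d. c i = 0) \<and> (\<lambda>z. \<Sum>i\<in>A. f i z) = (\<lambda>z. \<Sum>i<d. c i * m i z)"
    if "finite A" "\<And>i. i \<in> A \<Longrightarrow> \<exists>d c. (\<forall>i\<ge>d. c i = 0) \<and> f i = (\<lambda>z. \<Sum>i<d. c i * m i z)" for A :: "'b set" and f
    using that
  proof (induction A rule: finite_induct)
    case empty show ?case by (rule exI[of _ 0], rule exI[of _ "\<lambda>_. 0"]) auto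
  next
    case (insert x A)
    have "\<exists>d c. (\<forall>i\<ge>d. c i = 0) \<and> (\<lambda>z. \<Sum>i\<in>A. f i z) = (\<lambda>z. \<Sum>i<d. c i * m i z)"
      by (rule insert.IH) (use insert.prems in auto)
    then have "\<exists>d c. (\<forall>i\<ge>d. c i = 0) \<and> (\<lambda>z. f x z + (\<Sum>i\<in>A. f i z)) = (\<lambda>z. \<Sum>i<d. c i * m i z)"
      using insert.prems by (intro plus) auto
    then show ?case using insert.hyps by simp
  qed
  have "\<exists>d c. (\<forall>i\<ge>d. c i = 0) \<and> f = (\<lambda>z. \<Sum>i<d. c i * m i z)" using assms
  proof (induction rule: pf.induct)
    case (pf_const c) then show ?case using single[of c "[]"] by simp
  next
    case (pf_var i) then show ?case using single[of 1 "[i]"] by simp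
  next
    case (pf_add f g) then show ?case by (intro plus)
  next
    case (pf_mult f g)
    then obtain d c d' c' where c: "f = (\<lambda>z. \<Sum>i<d. c i * m i z)"
      and c': "g = (\<lambda>z. \<Sum>i<d'. c' i * m i z)" by blast
    have "(\<lambda>z. f z * g z) = (\<lambda>z. \<Sum>p\<in>{..<d}\<times>{..<d'}. c (fst p) * c' (snd p) *
       prod_list (map z (from_nat (fst p) @ (from_nat (snd p)))))"
      unfolding c c' sum_product sum.cartesian_product
      by (intro ext sum.cong) (auto simp: m_def)
    moreover have "\<exists>d0 c0. (\<forall>i\<ge>d0. c0 i = 0) \<and> (\<lambda>z. \<Sum>p\<in>{..<d}\<times>{..<d'}. c (fst p) * c' (snd p) *
       prod_list (map z (from_nat (fst p) @ (from_nat (snd p))))) = (\<lambda>z. \<Sum>i<d0. c0 i * m i z)"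
      by (rule sums) (auto simp only: single finite_SigmaI finite_lessThan)
    ultimately show ?case by simp
  qed
  then show ?thesis unfolding m_def by blast
qed

text \<open>Fraction-free Gaussian elimination over an integral domain: more rows than columns are
  dependent. With \<open>B\<close> empty it is linear algebra over the complex numbers.\<close>

lemma pf_linear_dependence:
  assumes "\<And>k i. k \<in> K \<Longrightarrow> i < M \<Longrightarrow> f k i \<in> pf B" "finite K" "card K > M"
  shows "\<exists>c. (\<forall>k. c k \<in> pf B) \<and> (\<exists>k\<in>K. c k \<noteq> (\<lambda>_. 0)) \<and> (\<forall>i<M. \<forall>z. (\<Sum>k\<in>K. c k z * f k i z) = 0)"
  using assms
proof (induction M arbitrary: K f)
  case 0
  then have "K \<noteq> {}" by auto
  then show ?case
    by (intro exI[of _ "\<lambda>_ _. 1"]) (auto intro: pf_const dest: fun_cong)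
next
  case (Suc M)
  show ?case
  proof (cases "\<forall>k\<in>K. f k M = (\<lambda>_. 0)")
    case True
    obtain c where c: "\<forall>k. c k \<in> pf B" "\<exists>k\<in>K. c k \<noteq> (\<lambda>_. 0)"
      "\<forall>i<M. \<forall>z. (\<Sum>k\<in>K. c k z * f k i z) = 0"
      using Suc.IH[of K f] Suc.prems by auto
    moreover have "\<forall>z. (\<Sum>k\<in>K. c k z * f k M z) = 0" using True by simp
    ultimately show ?thesis by (metis less_antisym)
  next
    case False
    then obtain t where t: "t \<in> K" "f t M \<noteq> (\<lambda>_. 0)" by blast
    \<comment> \<open>Column \<open>M\<close> is eliminated with the pivot row \<open>t\<close>; the
      new entries in that column vanish identically.\<close>
    define g where "g k i = (\<lambda>z. f t M z * f k i z - f k M z * f t i z)" for k i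
    have "\<And>k i. k \<in> K - {t} \<Longrightarrow> i < M \<Longrightarrow> g k i \<in> pf B"
      unfolding g_def by (intro pf_diff pf_mult) (use Suc.prems t in auto)
    moreover have "card (K - {t}) > M" using Suc.prems t by simp
    ultimately obtain c where c: "\<forall>k. c k \<in> pf B" "\<exists>k\<in>K - {t}. c k \<noteq> (\<lambda>_. 0)"
      "\<forall>i<M. \<forall>z. (\<Sum>k\<in>K - {t}. c k z * g k i z) = 0"
      using Suc.IH[of "K - {t}" g] Suc.prems(2) by auto
    \<comment> \<open>The other rows are rescaled by the pivot, and the coefficient of row
      \<open>t\<close> collects what the elimination subtracted.\<close>
    define e where "e k = (if k = t then (\<lambda>z. - (\<Sum>k\<in>K - {t}. c k z * f k M z)) else (\<lambda>z. c k z * f t M z))" for k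
    have e_sum: "(\<Sum>k\<in>K. e k z * f k i z) = (\<Sum>k\<in>K - {t}. c k z * g k i z)" for i z
    proof -
      have "(\<Sum>k\<in>K. e k z * f k i z) = e t z * f t i z + (\<Sum>k\<in>K - {t}. e k z * f k i z)"
        using t Suc.prems(2) by (simp add: sum.remove)
      also have "\<dots> = (\<Sum>k\<in>K - {t}. c k z * f t M z * f k i z - c k z * f k M z * f t i z)"
        by (simp add: e_def sum_subtractf sum_distrib_right)
      finally show ?thesis by (simp add: g_def algebra_simps)
    qed
    have "e k \<in> pf B" if "k \<in> K" for k
      using that c(1) t Suc.prems(1)[of _ M] unfolding e_def
      by (auto intro!: pf_uminus pf_sum pf_mult)
    moreover have "\<exists>k\<in>K. e k \<noteq> (\<lambda>_. 0)"
    proof -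
      obtain k where k: "k \<in> K" "k \<noteq> t" "c k \<noteq> (\<lambda>_. 0)" using c(2) by blast
      have "(\<lambda>z. c k z * f t M z) \<noteq> (\<lambda>_. 0)"
        by (rule pf_no_zero_divisors[OF _ _ k(3) t(2), of B B]) (use c(1) Suc.prems(1) t(1) in auto)
      then show ?thesis using k by (intro bexI[of _ k]) (simp_all add: e_def)
    qed
    moreover have "(\<Sum>k\<in>K. e k z * f k i z) = 0" if "i < Suc M" for i z
    proof (cases "i < M")
      case True then show ?thesis using c(3) e_sum by simp
    next
      case False
      then have "i = M" using that by simp
      then show ?thesis unfolding e_sum by (simp add: g_def mult.commute)
    qed
    ultimately show ?thesis
      by (intro exI[of _ "\<lambda>k. if k \<in> K then e k else (\<lambda>_. 0)"]) (auto intro: pf_const)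
  qed
qed

section \<open>Ideals, primes, and ideals maximal among those avoiding a set\<close>

definition pf_ideal :: "nat set \<Rightarrow> cfun set \<Rightarrow> bool" where
  "pf_ideal V I \<longleftrightarrow> I \<subseteq> pf V \<and> (\<lambda>_. 0) \<in> I \<and>
     (\<forall>f\<in>I. \<forall>g\<in>I. (\<lambda>z. f z + g z) \<in> I) \<and> (\<forall>r\<in>pf V. \<forall>f\<in>I. (\<lambda>z. r z * f z) \<in> I)"

definition pf_prime :: "nat set \<Rightarrow> cfun set \<Rightarrow> bool" where
  "pf_prime V I \<longleftrightarrow> pf_ideal V I \<and> (\<lambda>_. 1) \<notin> I \<and>
     (\<forall>f\<in>pf V. \<forall>g\<in>pf V. (\<lambda>z. f z * g z) \<in> I \<longrightarrow> f \<in> I \<or> g \<in> I)"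

lemma pf_idealD:
  assumes "pf_ideal V I"
  shows "f \<in> I \<Longrightarrow> f \<in> pf V" "(\<lambda>_. 0) \<in> I"
    "f \<in> I \<Longrightarrow> g \<in> I \<Longrightarrow> (\<lambda>z. f z + g z) \<in> I"
    "r \<in> pf V \<Longrightarrow> f \<in> I \<Longrightarrow> (\<lambda>z. r z * f z) \<in> I"
  using assms by (auto simp: pf_ideal_def)

lemma pf_ideal_diff:
  assumes "pf_ideal V I" "f \<in> I" "g \<in> I" shows "(\<lambda>z. f z - g z) \<in> I"
  using pf_idealD(3)[OF assms(1,2) pf_idealD(4)[OF assms(1) pf_const[of "-1"] assms(3)]] by simp

lemma pf_ideal_sum:
  assumes "pf_ideal V I" "\<And>i. i \<in> A \<Longrightarrow> f i \<in> I" shows "(\<lambda>z. \<Sum>i\<in>A. f i z) \<in> I"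
  using assms(2)
  by (induction A rule: infinite_finite_induct) (auto intro: pf_idealD[OF assms(1)])

lemma pf_primeD:
  assumes "pf_prime V I"
  shows "pf_ideal V I" "(\<lambda>_. 1) \<notin> I"
    "(\<lambda>z. f z * g z) \<in> I \<Longrightarrow> f \<in> pf V \<Longrightarrow> g \<in> pf V \<Longrightarrow> f \<in> I \<or> g \<in> I"
  using assms by (auto simp: pf_prime_def)

lemma pf_prime_power:
  assumes "pf_prime V I" "f \<in> pf V" "(\<lambda>z. f z ^ n) \<in> I" shows "f \<in> I"
  using assms(3)
proof (induction n)
  case 0 then show ?case using pf_primeD(2)[OF assms(1)] by simp
next
  case (Suc n) then show ?case using pf_primeD(3)[OF assms(1), of f "\<lambda>z. f z ^ n"] assms(2)
    by (auto intro: pf_power)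
qed

lemma pf_ideal_adjoin:
  assumes "pf_ideal V I" "r \<in> pf V"
  shows "pf_ideal V {(\<lambda>z. i z + u z * r z) | i u. i \<in> I \<and> u \<in> pf V}" (is "pf_ideal V ?J")
  unfolding pf_ideal_def
proof (intro conjI ballI)
  show "?J \<subseteq> pf V" using assms by (auto intro!: pf_add pf_mult dest: pf_idealD(1))
  show "(\<lambda>_. 0) \<in> ?J"
    by (intro CollectI exI[of _ "\<lambda>_. 0"]) (auto intro: pf_const pf_idealD(2)[OF assms(1)])
next
  fix f g assume "f \<in> ?J" "g \<in> ?J"
  then obtain i u j v where *: "f = (\<lambda>z. i z + u z * r z)" "i \<in> I" "u \<in> pf V"
    "g = (\<lambda>z. j z + v z * r z)" "j \<in> I" "v \<in> pf V" by blast
  show "(\<lambda>z. f z + g z) \<in> ?J"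
    by (intro CollectI exI[of _ "\<lambda>z. i z + j z"] exI[of _ "\<lambda>z. u z + v z"])
      (use * in \<open>auto simp: algebra_simps intro: pf_add pf_idealD(3)[OF assms(1)]\<close>)
next
  fix s f assume "s \<in> pf V" "f \<in> ?J"
  then obtain i u where *: "f = (\<lambda>z. i z + u z * r z)" "i \<in> I" "u \<in> pf V" by blast
  show "(\<lambda>z. s z * f z) \<in> ?J"
    by (intro CollectI exI[of _ "\<lambda>z. s z * i z"] exI[of _ "\<lambda>z. s z * u z"])
      (use * \<open>s \<in> pf V\<close> in \<open>auto simp: distrib_left mult.assoc intro: pf_mult pf_idealD(4)[OF assms(1)]\<close>)
qed

text \<open>Zorn's lemma for ideals disjoint from a multiplicative set. Maximality is kept in the
  conclusion in the form that every \<open>r\<close> outside \<open>I\<close> divides an element of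
  \<open>S\<close> modulo \<open>I\<close>; both primality and the later algebraic dependence rest
  on it.\<close>

lemma pf_prime_avoiding:
  assumes I0: "pf_ideal V I0" "I0 \<inter> S = {}" and S: "S \<subseteq> pf V" "(\<lambda>_. 1) \<in> S"
    "\<And>s t. s \<in> S \<Longrightarrow> t \<in> S \<Longrightarrow> (\<lambda>z. s z * t z) \<in> S"
  obtains I where "I0 \<subseteq> I" "pf_prime V I" "I \<inter> S = {}"
    "\<And>r. r \<in> pf V \<Longrightarrow> r \<notin> I \<Longrightarrow> \<exists>u\<in>pf V. \<exists>s\<in>S. (\<lambda>z. s z - u z * r z) \<in> I"
proof -
  define \<A> where "\<A> = {I. pf_ideal V I \<and> I0 \<subseteq> I \<and> I \<inter> S = {}}"
  have "\<exists>M\<in>\<A>. \<forall>X\<in>\<A>. M \<subseteq> X \<longrightarrow> X = M"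
  proof (rule subset_Zorn_nonempty)
    show "\<A> \<noteq> {}" using I0 by (auto simp: \<A>_def)
  next
    fix \<C> assume C: "\<C> \<noteq> {}" "subset.chain \<A> \<C>"
    then have CA: "\<And>I. I \<in> \<C> \<Longrightarrow> pf_ideal V I \<and> I0 \<subseteq> I \<and> I \<inter> S = {}"
      by (auto simp: subset.chain_def \<A>_def)
    have tot: "I \<subseteq> J \<or> J \<subseteq> I" if "I \<in> \<C>" "J \<in> \<C>" for I J
      using C(2) that by (auto simp: subset.chain_def)
    have "pf_ideal V (\<Union>\<C>)"
      unfolding pf_ideal_def
    proof (intro conjI ballI)
      show "\<Union>\<C> \<subseteq> pf V" using CA by (auto dest: pf_idealD(1))
      show "(\<lambda>_. 0) \<in> \<Union>\<C>" using CA C(1) pf_idealD(2) by blast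
    next
      fix f g assume "f \<in> \<Union>\<C>" "g \<in> \<Union>\<C>"
      then obtain I J where "f \<in> I" "I \<in> \<C>" "g \<in> J" "J \<in> \<C>" by blast
      with tot[of I J] obtain K where "K \<in> \<C>" "f \<in> K" "g \<in> K" by blast
      then show "(\<lambda>z. f z + g z) \<in> \<Union>\<C>" using CA[of K] pf_idealD(3) by blast
    next
      fix r f assume "r \<in> pf V" "f \<in> \<Union>\<C>"
      then show "(\<lambda>z. r z * f z) \<in> \<Union>\<C>" using CA pf_idealD(4) by blast
    qed
    then show "\<Union>\<C> \<in> \<A>" using CA C(1) by (auto simp: \<A>_def)
  qed
  then obtain M where M: "M \<in> \<A>" "\<And>X. X \<in> \<A> \<Longrightarrow> M \<subseteq> X \<Longrightarrow> X = M" by blast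
  have id: "pf_ideal V M" and dis: "M \<inter> S = {}" and sub: "I0 \<subseteq> M" using M(1) by (auto simp: \<A>_def)
  have maxi: "\<exists>u\<in>pf V. \<exists>s\<in>S. (\<lambda>z. s z - u z * r z) \<in> M" if r: "r \<in> pf V" "r \<notin> M" for r
  proof -
    define J where "J = {(\<lambda>z. i z + u z * r z) | i u. i \<in> M \<and> u \<in> pf V}"
    have J: "pf_ideal V J" unfolding J_def by (rule pf_ideal_adjoin[OF id r(1)])
    have MJ: "M \<subseteq> J"
    proof
      fix i assume "i \<in> M"
      then show "i \<in> J" unfolding J_def
        by (intro CollectI exI[of _ i] exI[of _ "\<lambda>_. 0"]) (auto intro: pf_const)
    qed
    have "r \<in> J" unfolding J_def
      by (intro CollectI exI[of _ "\<lambda>_. 0"] exI[of _ "\<lambda>_. 1"]) (auto intro: pf_const pf_idealD(2)[OF id])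
    then have "J \<noteq> M" using r by blast
    then have "J \<notin> \<A>" using M(2)[OF _ MJ] by blast
    then obtain s where "s \<in> J" "s \<in> S" using J MJ sub by (auto simp: \<A>_def)
    then obtain i u where *: "s = (\<lambda>z. i z + u z * r z)" "i \<in> M" "u \<in> pf V" by (auto simp: J_def)
    then have "(\<lambda>z. s z - u z * r z) = i" by auto
    then show ?thesis using * \<open>s \<in> S\<close> by blast
  qed
  have "pf_prime V M"
    unfolding pf_prime_def
  proof (intro conjI ballI impI)
    show "pf_ideal V M" by (rule id)
    show "(\<lambda>_. 1) \<notin> M" using dis S(2) by blast
    fix f g assume f: "f \<in> pf V" and g: "g \<in> pf V" and fg: "(\<lambda>z. f z * g z) \<in> M"
    show "f \<in> M \<or> g \<in> M"
    proof (rule ccontr)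
      assume "\<not> ?thesis"
      then obtain u s v t where u: "u \<in> pf V" "s \<in> S" "(\<lambda>z. s z - u z * f z) \<in> M"
        and v: "v \<in> pf V" "t \<in> S" "(\<lambda>z. t z - v z * g z) \<in> M" using maxi f g by meson
      have "(\<lambda>z. t z * (s z - u z * f z)) \<in> M"
        by (rule pf_idealD(4)[OF id _ u(3)]) (use S(1) v in auto)
      moreover have "(\<lambda>z. (u z * f z) * (t z - v z * g z)) \<in> M"
        by (rule pf_idealD(4)[OF id _ v(3)]) (use u f in \<open>auto intro: pf_mult\<close>)
      moreover have "(\<lambda>z. (u z * v z) * (f z * g z)) \<in> M"
        by (rule pf_idealD(4)[OF id _ fg]) (use u v in \<open>auto intro: pf_mult\<close>)
      \<comment> \<open>The mixed terms cancel and the three summands add up to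
        \<open>s z * t z\<close>.\<close>
      ultimately have "(\<lambda>z. (t z * (s z - u z * f z) + (u z * f z) * (t z - v z * g z)) + (u z * v z) * (f z * g z)) \<in> M"
        by (intro pf_idealD(3)[OF id]) auto
      then have "(\<lambda>z. s z * t z) \<in> M" by (simp add: algebra_simps)
      then show False using S(3)[OF u(2) v(2)] dis by blast
    qed
  qed
  then show ?thesis using that[OF sub _ dis] maxi by blast
qed

text \<open>Inverting this multiplicative set turns the polynomial ring in \<open>V\<close> into an
  algebra over the rational functions in \<open>B\<close>, with \<open>g\<close> invertible. Ideals
  maximal among those avoiding the set correspond to the maximal ideals of this algebra.\<close>

definition pf_avoid :: "cfun \<Rightarrow> nat set \<Rightarrow> cfun set" where
  "pf_avoid g B = {(\<lambda>z. g z ^ n * q z) | n q. q \<in> pf B \<and> q \<noteq> (\<lambda>_. 0)}"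

text \<open>Algebraic independence of the coordinates in \<open>B\<close> modulo
  \<open>I\<close>.\<close>

definition pf_indep :: "cfun set \<Rightarrow> nat set \<Rightarrow> bool" where
  "pf_indep I B \<longleftrightarrow> (\<forall>q\<in>pf B. q \<in> I \<longrightarrow> q = (\<lambda>_. 0))"

lemma pf_avoidI: "q \<in> pf B \<Longrightarrow> q \<noteq> (\<lambda>_. 0) \<Longrightarrow> (\<lambda>z. g z ^ n * q z) \<in> pf_avoid g B"
  by (auto simp: pf_avoid_def)

lemma pf_avoid_props:
  assumes "g \<in> pf V" "B \<subseteq> V"
  shows "pf_avoid g B \<subseteq> pf V" "(\<lambda>_. 1) \<in> pf_avoid g B"
    "s \<in> pf_avoid g B \<Longrightarrow> t \<in> pf_avoid g B \<Longrightarrow> (\<lambda>z. s z * t z) \<in> pf_avoid g B"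
    "g \<in> pf_avoid g B" "q \<in> pf B \<Longrightarrow> q \<noteq> (\<lambda>_. 0) \<Longrightarrow> q \<in> pf_avoid g B"
proof -
  show "pf_avoid g B \<subseteq> pf V"
    using assms by (auto simp: pf_avoid_def intro!: pf_mult pf_power intro: pf_mono)
  have one: "(\<lambda>_. 1) \<noteq> (\<lambda>_::nat\<Rightarrow>complex. 0::complex)" by (auto dest: fun_cong)
  show "(\<lambda>_. 1) \<in> pf_avoid g B"
    using pf_avoidI[OF pf_const one, of g 0] by simp
  show "g \<in> pf_avoid g B"
    using pf_avoidI[OF pf_const one, of g 1] by simp
  show "q \<in> pf B \<Longrightarrow> q \<noteq> (\<lambda>_. 0) \<Longrightarrow> q \<in> pf_avoid g B"
    using pf_avoidI[of q B g 0] by simp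
  assume "s \<in> pf_avoid g B" "t \<in> pf_avoid g B"
  then obtain n q m p where *: "s = (\<lambda>z. g z ^ n * q z)" "q \<in> pf B" "q \<noteq> (\<lambda>_. 0)"
    "t = (\<lambda>z. g z ^ m * p z)" "p \<in> pf B" "p \<noteq> (\<lambda>_. 0)" by (auto simp: pf_avoid_def)
  then have "(\<lambda>z. s z * t z) = (\<lambda>z. g z ^ (n + m) * (q z * p z))"
    by (simp add: power_add algebra_simps)
  then show "(\<lambda>z. s z * t z) \<in> pf_avoid g B"
    using * by (auto intro!: pf_avoidI pf_mult intro: pf_no_zero_divisors[THEN notE])
qed

text \<open>
  Among the uncountably many \<open>c\<close>, infinitely many relations \<open>s = u (x j - c)\<close> have the \<open>u\<close>
  in a common finite-dimensional space; a linear dependence between these \<open>u\<close> is, after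
  clearing denominators, an algebraic equation for \<open>x j\<close>.
\<close>

lemma pf_maximal_dependent:
  assumes I: "pf_prime V I" "I \<inter> pf_avoid g B = {}" and g: "g \<in> pf V" "B \<subseteq> V" and j: "j \<in> V" "j \<notin> B"
    and maxi: "\<And>r. r \<in> pf V \<Longrightarrow> r \<notin> I \<Longrightarrow> \<exists>u\<in>pf V. \<exists>s\<in>pf_avoid g B. (\<lambda>z. s z - u z * r z) \<in> I"
  shows "\<not> pf_indep I (insert j B)"
proof
  assume ind: "pf_indep I (insert j B)"
  have id: "pf_ideal V I" by (rule pf_primeD(1)[OF I(1)])
  define m where "m i = (\<lambda>z::nat\<Rightarrow>complex. prod_list (map z (from_nat i :: nat list)))" for i
  define R where "R c u n q d a \<longleftrightarrow> u \<in> pf V \<and> q \<in> pf B \<and> q \<noteq> (\<lambda>_. 0) \<and>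
    (\<lambda>z. g z ^ n * q z - u z * (z j - c)) \<in> I \<and> u = (\<lambda>z. \<Sum>i<d. a i * m i z)" for c u n q d a
  have "\<exists>u n q d a. R c u n q d a" for c
  proof -
    have r: "(\<lambda>z. z j - c) \<in> pf (insert j B)" by (intro pf_diff pf_var pf_const) auto
    have "(\<lambda>z. z j - c) \<noteq> (\<lambda>_. 0)" by (auto dest!: fun_cong[of _ _ "\<lambda>_. c + 1"])
    then have "(\<lambda>z. z j - c) \<notin> I" using ind r by (auto simp: pf_indep_def)
    moreover have "(\<lambda>z. z j - c) \<in> pf V" using r j(1) g(2) by (auto intro: pf_mono)
    ultimately obtain u s where "u \<in> pf V" "s \<in> pf_avoid g B" "(\<lambda>z. s z - u z * (z j - c)) \<in> I"
      using maxi by blast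
    moreover obtain d a where "u = (\<lambda>z. \<Sum>i<d::nat. a i * m i z)"
      using pf_countable_span[OF \<open>u \<in> pf V\<close>] unfolding m_def by blast
    ultimately show ?thesis unfolding pf_avoid_def R_def by blast
  qed
  then obtain u n q d a where "\<And>c. R c (u c) (n c) (q c) (d c) (a c)" by metis
  then have
    u: "\<And>c. u c \<in> pf V" and q: "\<And>c. q c \<in> pf B" "\<And>c. q c \<noteq> (\<lambda>_. 0)"
    and rel: "\<And>c. (\<lambda>z. g z ^ n c * q c z - u c z * (z j - c)) \<in> I"
    and ue: "\<And>c. u c = (\<lambda>z. \<Sum>i<d c. a c i * m i z)"
    unfolding R_def by blast+
  \<comment> \<open>The countably many pairs \<open>(n c, d c)\<close> partition an uncountable
    field, so some pair belongs to infinitely many \<open>c\<close>.\<close>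
  obtain n0 d0 where inf: "infinite {c. n c = n0 \<and> d c = d0}"
  proof -
    have "uncountable (UNIV :: complex set)"
      using uncountable_UNIV_complex .
    moreover have "(UNIV :: complex set) = (\<Union>p. {c. n c = fst p \<and> d c = snd p})" by auto
    ultimately have "\<exists>p. uncountable {c. n c = fst p \<and> d c = snd p}"
      using countable_UN[OF countableI_type[of UNIV], of "\<lambda>p. {c. n c = fst p \<and> d c = snd p}"] by auto
    then show ?thesis using that countable_finite by blast
  qed
  \<comment> \<open>The \<open>u c\<close> with \<open>d c = d0\<close> lie in the span of
    \<open>d0\<close> monomials, so \<open>d0 + 1\<close> of them are linearly dependent.\<close>
  obtain K where K: "K \<subseteq> {c. n c = n0 \<and> d c = d0}" "finite K" "card K = Suc d0"
    using infinite_arbitrarily_large[OF inf] by blast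
  obtain l where l: "\<forall>k. l k \<in> pf {}" "\<exists>k\<in>K. l k \<noteq> (\<lambda>_. 0)"
    "\<forall>i<d0. \<forall>z. (\<Sum>k\<in>K. l k z * a k i) = 0"
  proof -
    have "\<exists>l. (\<forall>k. l k \<in> pf {}) \<and> (\<exists>k\<in>K. l k \<noteq> (\<lambda>_. 0)) \<and>
       (\<forall>i<d0. \<forall>z. (\<Sum>k\<in>K. l k z * (\<lambda>k i _. a k i) k i z) = 0)"
      by (rule pf_linear_dependence) (use K in \<open>auto intro: pf_const\<close>)
    then show ?thesis using that by blast
  qed
  define lam where "lam k = l k (\<lambda>_. 0)" for k
  have l': "l k = (\<lambda>_. lam k)" for k using pf_empty_const l(1) by (auto simp: lam_def)
  have zero: "(\<Sum>k\<in>K. lam k * u k z) = 0" for z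
  proof -
    have "(\<Sum>k\<in>K. lam k * u k z) = (\<Sum>k\<in>K. \<Sum>i<d0. lam k * a k i * m i z)"
    proof (rule sum.cong)
      fix k assume "k \<in> K"
      then have "d k = d0" using K(1) by auto
      then show "lam k * u k z = (\<Sum>i<d0. lam k * a k i * m i z)"
        by (subst ue) (simp add: sum_distrib_left mult.assoc)
    qed simp
    also have "\<dots> = (\<Sum>i<d0. (\<Sum>k\<in>K. lam k * a k i) * m i z)"
      by (subst sum.swap) (simp add: sum_distrib_right)
    finally show ?thesis using l(3) l' by simp
  qed
  \<comment> \<open>The numerator of the sum of the fractions
    \<open>lam k * q k z / (z j - k)\<close>. Modulo \<open>I\<close> each fraction times
    \<open>g z ^ n0\<close> is \<open>lam k * u k z\<close>, and these add up to zero.\<close>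
  define \<phi> where "\<phi> = (\<lambda>z. \<Sum>k\<in>K. lam k * q k z * (\<Prod>c\<in>K - {k}. z j - c))"
  have \<phi>_pf: "\<phi> \<in> pf (insert j B)"
    unfolding \<phi>_def by (intro pf_sum pf_mult pf_const pf_prod pf_diff pf_var pf_mono[OF q(1)]) auto
  have "(\<lambda>z. \<Sum>k\<in>K. (lam k * (\<Prod>c\<in>K - {k}. z j - c)) * (g z ^ n k * q k z - u k z * (z j - k))) \<in> I"
    by (intro pf_ideal_sum[OF id] pf_idealD(4)[OF id _ rel] pf_mult pf_const pf_prod pf_diff pf_var j(1))
  moreover have "(\<Sum>k\<in>K. (lam k * (\<Prod>c\<in>K - {k}. z j - c)) * (g z ^ n k * q k z - u k z * (z j - k)))
      = g z ^ n0 * \<phi> z" for z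
  proof -
    have "(\<Sum>k\<in>K. (lam k * (\<Prod>c\<in>K - {k}. z j - c)) * (g z ^ n k * q k z - u k z * (z j - k)))
      = (\<Sum>k\<in>K. g z ^ n0 * (lam k * q k z * (\<Prod>c\<in>K - {k}. z j - c)) - (\<Prod>c\<in>K. z j - c) * (lam k * u k z))"
    proof (rule sum.cong)
      fix k assume k: "k \<in> K"
      have pr: "(\<Prod>c\<in>K. z j - c) = (z j - k) * (\<Prod>c\<in>K - {k}. z j - c)"
        by (rule prod.remove[OF K(2) k])
      have nk: "n k = n0" using K(1) k by auto
      then show "lam k * (\<Prod>c\<in>K - {k}. z j - c) * (g z ^ n k * q k z - u k z * (z j - k)) =
         g z ^ n0 * (lam k * q k z * (\<Prod>c\<in>K - {k}. z j - c)) - (\<Prod>c\<in>K. z j - c) * (lam k * u k z)"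
        unfolding pr nk by (simp add: algebra_simps)
    qed simp
    then show ?thesis
      using zero[of z] by (simp add: sum_subtractf sum_distrib_left[symmetric] \<phi>_def)
  qed
  ultimately have "(\<lambda>z. g z ^ n0 * \<phi> z) \<in> I" by simp
  moreover have "g \<notin> I" using I(2) pf_avoid_props(4)[OF g] by blast
  ultimately have "\<phi> \<in> I"
    using pf_primeD(3)[OF I(1) _ pf_power[OF g(1)] pf_mono[OF \<phi>_pf]] pf_prime_power[OF I(1) g(1)] g(2) j(1)
    by blast
  then have \<phi>0: "\<phi> = (\<lambda>_. 0)" using ind \<phi>_pf by (auto simp: pf_indep_def)
  obtain k where k: "k \<in> K" "lam k \<noteq> 0" using l(2) l' by auto
  obtain z where z: "q k z \<noteq> 0" using q(2)[of k] by blast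
  \<comment> \<open>At \<open>z j = k\<close> every summand of \<phi> except the one for
    \<open>k\<close> contains a zero factor. Changing the coordinate \<open>j\<close> does not
    affect \<open>q k\<close>, because \<open>j\<close> is not in \<open>B\<close>.\<close>
  define z' where "z' = z(j := k)"
  have "q k z' = q k z" by (rule pf_depends[OF q(1)]) (use j(2) in \<open>auto simp: z'_def\<close>)
  then have "q k z' \<noteq> 0" using z by simp
  moreover have "\<phi> z' = lam k * q k z' * (\<Prod>c\<in>K - {k}. k - c)"
  proof -
    have "\<phi> z' = (\<Sum>k'\<in>K. if k' = k then lam k * q k z' * (\<Prod>c\<in>K - {k}. k - c) else 0)"
      unfolding \<phi>_def
    proof (rule sum.cong)
      fix k' assume "k' \<in> K"
      then show "lam k' * q k' z' * (\<Prod>c\<in>K - {k'}. z' j - c) =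
        (if k' = k then lam k * q k z' * (\<Prod>c\<in>K - {k}. k - c) else 0)"
        using k(1) K(2) by (auto simp: z'_def intro!: prod_zero)
    qed simp
    then show ?thesis using k(1) K(2) by simp
  qed
  moreover have "(\<Prod>c\<in>K - {k}. k - c) \<noteq> 0" using K(2) by auto
  ultimately show False using k(2) \<phi>0 by auto
qed

section \<open>Nullstellensatz over an uncountable field\<close>

lemma pf_prime_poly_root:
  assumes "pf_prime V I" "\<And>c. c \<noteq> 0 \<Longrightarrow> (\<lambda>_. c) \<notin> I" "j \<in> V"
    and "p \<noteq> 0" "(\<lambda>z. poly p (z j)) \<in> I"
  shows "\<exists>c. (\<lambda>z. z j - c) \<in> I"
  using assms(4,5)
proof (induction "degree p" arbitrary: p)
  case 0
  then obtain a where "p = [:a:]" using degree_eq_zeroE by metis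
  then show ?case using 0 assms(2)[of a] by simp
next
  case (Suc d)
  then have "\<not> constant (poly p)" by (simp add: constant_degree)
  then obtain c where "poly p c = 0" using fundamental_theorem_of_algebra by blast
  then obtain q where q: "p = [:-c, 1:] * q" by (auto simp: poly_eq_0_iff_dvd dvd_def)
  then have "q \<noteq> 0" using Suc.prems by auto
  then have "degree q = d" using Suc.hyps(2) degree_mult_eq[of "[:-c, 1:]" q] q by auto
  have pq: "(\<lambda>z. poly q (z j)) \<in> pf V"
    unfolding poly_altdef by (intro pf_sum pf_mult pf_const pf_power pf_var assms(3))
  have "(\<lambda>z. (z j - c) * poly q (z j)) \<in> I"
    using Suc.prems(2) unfolding q by (simp add: algebra_simps)
  then have "(\<lambda>z. z j - c) \<in> I \<or> (\<lambda>z. poly q (z j)) \<in> I"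
    using pf_primeD(3)[OF assms(1) _ pf_diff[OF pf_var[OF assms(3)] pf_const] pq] by blast
  then show ?case using Suc.hyps(1)[of q] \<open>degree q = d\<close> \<open>q \<noteq> 0\<close> by auto
qed

definition zeros :: "cfun set \<Rightarrow> (nat \<Rightarrow> complex) set" where
  "zeros I = {z. \<forall>f\<in>I. f z = 0}"

text \<open>The maximal avoidance is applied with no free coordinates. Each coordinate then
  satisfies a nonzero polynomial modulo \<open>I\<close>; as the complex numbers are algebraically
  closed and \<open>I\<close> is prime, it is congruent to a constant, and these constants form the
  desired zero.\<close>

theorem pf_nullstellensatz:
  assumes P: "pf_ideal V P" and h: "h \<in> pf V" "\<And>n. (\<lambda>z. h z ^ n) \<notin> P"
  obtains \<zeta> where "\<zeta> \<in> zeros P" "h \<zeta> \<noteq> 0"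
proof -
  \<comment> \<open>Elements of \<open>pf {}\<close> are constants, so avoiding
    \<open>pf_avoid h {}\<close> means containing no power of \<open>h\<close>.\<close>
  have dis: "P \<inter> pf_avoid h {} = {}"
  proof (rule ccontr)
    assume "P \<inter> pf_avoid h {} \<noteq> {}"
    then obtain n q where q: "q \<in> pf {}" "q \<noteq> (\<lambda>_. 0)" "(\<lambda>z. h z ^ n * q z) \<in> P"
      by (auto simp: pf_avoid_def)
    define c where "c = q (\<lambda>_. 0)"
    have qc: "q = (\<lambda>_. c)" using pf_empty_const[OF q(1)] by (simp add: c_def)
    then have "c \<noteq> 0" using q(2) by auto
    have "(\<lambda>z. inverse c * (h z ^ n * q z)) \<in> P"
      by (rule pf_idealD(4)[OF P pf_const q(3)])
    moreover have "(\<lambda>z. inverse c * (h z ^ n * q z)) = (\<lambda>z. h z ^ n)"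
      using \<open>c \<noteq> 0\<close> by (auto simp: qc)
    ultimately show False using h(2)[of n] by simp
  qed
  obtain I where I: "P \<subseteq> I" "pf_prime V I" "I \<inter> pf_avoid h {} = {}"
    and maxi: "\<And>r. r \<in> pf V \<Longrightarrow> r \<notin> I \<Longrightarrow> \<exists>u\<in>pf V. \<exists>s\<in>pf_avoid h {}. (\<lambda>z. s z - u z * r z) \<in> I"
    using pf_prime_avoiding[OF P dis] pf_avoid_props(1-3)[OF h(1), of "{}"] by blast
  have id: "pf_ideal V I" by (rule pf_primeD(1)[OF I(2)])
  have nc: "(\<lambda>_. c) \<notin> I" if "c \<noteq> 0" for c
  proof -
    have "(\<lambda>_. c) \<noteq> (\<lambda>_::nat\<Rightarrow>complex. 0)" using that by (auto dest: fun_cong)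
    then have "(\<lambda>_. c) \<in> pf_avoid h {}" using pf_avoid_props(5)[OF h(1), of "{}" "\<lambda>_. c"] by (auto intro: pf_const)
    then show ?thesis using I(3) by blast
  qed
  have "\<exists>c. (\<lambda>z. z j - c) \<in> I" if "j \<in> V" for j
  proof -
    have "\<not> pf_indep I (insert j {})"
      by (rule pf_maximal_dependent[OF I(2,3) h(1) _ that _ maxi]) auto
    then obtain \<phi> where \<phi>: "\<phi> \<in> pf (insert j {})" "\<phi> \<in> I" "\<phi> \<noteq> (\<lambda>_. 0)" by (auto simp: pf_indep_def)
    obtain M c where c: "\<And>i. c i \<in> pf {}" "\<phi> = (\<lambda>z. \<Sum>i\<le>(M::nat). c i z * z j ^ i)"
      using pf_insert_expand[OF \<phi>(1)] by blast
    define p where "p = (\<Sum>i\<le>M. monom (c i (\<lambda>_. 0)) i)"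
    have "\<phi> = (\<lambda>z. poly p (z j))"
    proof
      fix z
      have "c i z = c i (\<lambda>_. 0)" for i using pf_depends[OF c(1)] by blast
      then show "\<phi> z = poly p (z j)" by (simp add: c(2) p_def poly_sum poly_monom)
    qed
    moreover from this have "p \<noteq> 0" using \<phi>(3) by auto
    ultimately show ?thesis using pf_prime_poly_root[OF I(2) nc that, of p] \<phi>(2) by auto
  qed
  then obtain \<zeta>0 where \<zeta>0: "\<And>j. j \<in> V \<Longrightarrow> (\<lambda>z. z j - \<zeta>0 j) \<in> I" by metis
  have val: "(\<lambda>z. f z - f \<zeta>0) \<in> I" if "f \<in> pf V" for f
    using that
  proof (induction rule: pf.induct)
    case (pf_const c) then show ?case using pf_idealD(2)[OF id] by simp
  next
    case (pf_var i) then show ?case using \<zeta>0 by simp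
  next
    case (pf_add f g)
    then show ?case using pf_idealD(3)[OF id pf_add.IH] by (simp add: algebra_simps)
  next
    case (pf_mult f g)
    have "(\<lambda>z. g z * (f z - f \<zeta>0)) \<in> I" "(\<lambda>z. f \<zeta>0 * (g z - g \<zeta>0)) \<in> I"
      using pf_idealD(4)[OF id] pf_mult pf.pf_const by blast+
    then show ?case using pf_idealD(3)[OF id] by (fastforce simp: algebra_simps)
  qed
  have "\<zeta>0 \<in> zeros P"
    unfolding zeros_def
  proof (intro CollectI ballI)
    fix f assume f: "f \<in> P"
    then have "f \<in> I" "f \<in> pf V" using I(1) pf_idealD(1)[OF P] by auto
    \<comment> \<open>This member of \<open>I\<close> is the constant \<open>f \<zeta>0\<close>, and
      \<open>I\<close> contains no nonzero constant.\<close>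
    then have "(\<lambda>z. f z - (f z - f \<zeta>0)) \<in> I" using pf_ideal_diff[OF id] val by blast
    then show "f \<zeta>0 = 0" using nc by auto
  qed
  moreover have "h \<zeta>0 \<noteq> 0"
  proof
    assume "h \<zeta>0 = 0"
    then have "h \<in> I" using val[OF h(1)] by simp
    then show False using I(3) pf_avoid_props(4)[OF h(1), of "{}"] by auto
  qed
  ultimately show ?thesis using that by blast
qed

corollary pf_prime_nullstellensatz:
  assumes P: "pf_prime V P" and h: "h \<in> pf V" "h \<notin> P"
  obtains \<zeta> where "\<zeta> \<in> zeros P" "h \<zeta> \<noteq> 0"
  using pf_nullstellensatz[OF pf_primeD(1)[OF P] h(1)] pf_prime_power[OF P h(1)] h(2) by metis

section \<open>Algebraic dependence over the coordinates in B\<close>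

text \<open>
  The module generated by \<open>F\<close> over the polynomial functions in \<open>B\<close>, modulo \<open>P\<close>
  and up to denominators.
\<close>

inductive_set frac_span :: "nat set \<Rightarrow> cfun set \<Rightarrow> nat set \<Rightarrow> cfun set \<Rightarrow> cfun set"
  for V P B F where
  base: "m \<in> F \<Longrightarrow> m \<in> frac_span V P B F"
| ideal: "f \<in> P \<Longrightarrow> f \<in> frac_span V P B F"
| add: "f \<in> frac_span V P B F \<Longrightarrow> g \<in> frac_span V P B F \<Longrightarrow> (\<lambda>z. f z + g z) \<in> frac_span V P B F"
| scale: "q \<in> pf B \<Longrightarrow> f \<in> frac_span V P B F \<Longrightarrow> (\<lambda>z. q z * f z) \<in> frac_span V P B F"
| cancel: "q \<in> pf B \<Longrightarrow> q \<noteq> (\<lambda>_. 0) \<Longrightarrow> f \<in> pf V \<Longrightarrow> (\<lambda>z. q z * f z) \<in> frac_span V P B F \<Longrightarrow>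
    f \<in> frac_span V P B F"

lemma frac_span_carrier:
  assumes "pf_ideal V P" "B \<subseteq> V" "F \<subseteq> pf V"
  shows "f \<in> frac_span V P B F \<Longrightarrow> f \<in> pf V"
  by (induction rule: frac_span.induct)
    (use assms in \<open>auto intro: pf_idealD(1) pf_add pf_mult pf_mono\<close>)

lemma frac_span_sum:
  assumes "pf_ideal V P" "\<And>i. i \<in> A \<Longrightarrow> f i \<in> frac_span V P B F"
  shows "(\<lambda>z. \<Sum>i\<in>A. f i z) \<in> frac_span V P B F"
  using assms(2)
  by (induction A rule: infinite_finite_induct)
    (auto intro: frac_span.add frac_span.ideal pf_idealD(2)[OF assms(1)])

text \<open>Induction on each factor in turn, as in the tower law: products of generators generate
  the products.\<close>

lemma frac_span_mult:
  assumes P: "pf_ideal V P" and B: "B \<subseteq> V" and F: "F \<subseteq> pf V" "F' \<subseteq> pf V"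
    and f: "f \<in> frac_span V P B F" and g: "g \<in> frac_span V P B F'"
  shows "(\<lambda>z. f z * g z) \<in> frac_span V P B {(\<lambda>z. m z * m' z) | m m'. m \<in> F \<and> m' \<in> F'}"
    (is "_ \<in> frac_span V P B ?G")
  using f
proof (induction rule: frac_span.induct)
  case (base m)
  show ?case using g
  proof (induction rule: frac_span.induct)
    case (base m') then show ?case using \<open>m \<in> F\<close> by (intro frac_span.base) blast
  next
    case (ideal f) then show ?case using \<open>m \<in> F\<close> F by (intro frac_span.ideal pf_idealD(4)[OF P]) auto
  next
    case (add f g) then show ?case using frac_span.add[OF add.IH] by (simp add: distrib_left)
  next
    case (scale q f) then show ?case
      using frac_span.scale[OF scale(1) scale.IH] by (simp add: mult.left_commute)
  next
    case (cancel q f) then show ?case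
      using frac_span.cancel[OF cancel(1,2) pf_mult[of m V f]] \<open>m \<in> F\<close> F
      by (auto simp: mult.left_commute)
  qed
next
  case (ideal f)
  show ?case
    using pf_idealD(4)[OF P frac_span_carrier[OF P B F(2) g] ideal]
    by (intro frac_span.ideal) (simp add: mult.commute)
next
  case (add f g) then show ?case using frac_span.add[OF add.IH] by (simp add: distrib_right)
next
  case (scale q f) then show ?case
    using frac_span.scale[OF scale(1) scale.IH] by (simp add: mult.assoc)
next
  case (cancel q f) then show ?case
    using frac_span.cancel[OF cancel(1,2) pf_mult[OF cancel(3) frac_span_carrier[OF P B F(2) g]]]
    by (simp add: mult.assoc)
qed

text \<open>The rule \<open>cancel\<close> divides silently; here the denominators introduced along
  the way are collected into a single nonzero \<open>s\<close>.\<close>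

lemma frac_span_normal_form:
  assumes P: "pf_ideal V P" and B: "B \<subseteq> V"
    and f: "f \<in> frac_span V P B (m ` {..<M::nat})"
  shows "\<exists>s c. s \<in> pf B \<and> s \<noteq> (\<lambda>_. 0) \<and> (\<forall>i. c i \<in> pf B) \<and>
    (\<lambda>z. s z * f z - (\<Sum>i<M. c i z * m i z)) \<in> P"
proof -
  have one: "(\<lambda>_. 1) \<noteq> (\<lambda>_::nat\<Rightarrow>complex. 0::complex)" by (auto dest: fun_cong)
  have BV: "q \<in> pf V" if "q \<in> pf B" for q using that B by (rule pf_mono)
  show ?thesis using f
  proof (induction rule: frac_span.induct)
    case (base f)
    then obtain k where k: "k < M" "f = m k" by blast
    have "(\<Sum>i<M. (if i = k then 1 else 0) * m i z) = m k z" for z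
      using k(1) by (simp add: if_distrib[of "\<lambda>x. x * _"] cong: if_cong)
    then show ?case using one k pf_idealD(2)[OF P]
      by (intro exI[of _ "\<lambda>_. 1"] exI[of _ "\<lambda>i _. if i = k then 1 else 0"]) (auto intro: pf_const)
  next
    case (ideal f)
    then show ?case using one
      by (intro exI[of _ "\<lambda>_. 1"] exI[of _ "\<lambda>i _. 0"]) (auto intro: pf_const)
  next
    case (add f g)
    from add.IH obtain s c t d where s: "s \<in> pf B" "s \<noteq> (\<lambda>_. 0)" "\<forall>i. c i \<in> pf B"
      "(\<lambda>z. s z * f z - (\<Sum>i<M. c i z * m i z)) \<in> P"
      and t: "t \<in> pf B" "t \<noteq> (\<lambda>_. 0)" "\<forall>i. d i \<in> pf B"
      "(\<lambda>z. t z * g z - (\<Sum>i<M. d i z * m i z)) \<in> P" by blast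
    have "(\<lambda>z. t z * (s z * f z - (\<Sum>i<M. c i z * m i z)) + s z * (t z * g z - (\<Sum>i<M. d i z * m i z))) \<in> P"
      by (intro pf_idealD(3)[OF P] pf_idealD(4)[OF P] BV s t)
    then have "(\<lambda>z. (s z * t z) * (f z + g z) - (\<Sum>i<M. (t z * c i z + s z * d i z) * m i z)) \<in> P"
      by (simp add: algebra_simps sum.distrib sum_distrib_left)
    then show ?case using s t pf_no_zero_divisors[OF s(1) t(1) s(2) t(2)]
      by (intro exI[of _ "\<lambda>z. s z * t z"] exI[of _ "\<lambda>i z. t z * c i z + s z * d i z"])
        (auto intro!: pf_mult pf_add)
  next
    case (scale q f)
    from scale.IH obtain s c where s: "s \<in> pf B" "s \<noteq> (\<lambda>_. 0)" "\<forall>i. c i \<in> pf B"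
      "(\<lambda>z. s z * f z - (\<Sum>i<M. c i z * m i z)) \<in> P" by blast
    have "(\<lambda>z. q z * (s z * f z - (\<Sum>i<M. c i z * m i z))) \<in> P"
      by (intro pf_idealD(4)[OF P] BV s scale)
    then have "(\<lambda>z. s z * (q z * f z) - (\<Sum>i<M. (q z * c i z) * m i z)) \<in> P"
      by (simp add: algebra_simps sum_distrib_left)
    then show ?case using s scale
      by (intro exI[of _ s] exI[of _ "\<lambda>i z. q z * c i z"]) (auto intro!: pf_mult)
  next
    case (cancel q f)
    from cancel.IH obtain s c where s: "s \<in> pf B" "s \<noteq> (\<lambda>_. 0)" "\<forall>i. c i \<in> pf B"
      "(\<lambda>z. s z * (q z * f z) - (\<Sum>i<M. c i z * m i z)) \<in> P" by blast
    then show ?case using pf_no_zero_divisors[OF s(1) cancel(1) s(2) cancel(2)] cancel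
      by (intro exI[of _ "\<lambda>z. s z * q z"] exI[of _ c]) (auto simp: mult.assoc intro!: pf_mult)
  qed
qed

text \<open>The leading coefficient \<open>c D\<close> is nonzero and hence may be cancelled, so the
  relation reduces each power from \<open>D\<close> on to lower ones.\<close>

lemma frac_span_powers:
  assumes P: "pf_ideal V P" and B: "B \<subseteq> V" and j: "j \<in> V" and c: "\<And>i. c i \<in> pf B" "c D \<noteq> (\<lambda>_. 0)"
    and rel: "(\<lambda>z. \<Sum>i\<le>D. c i z * z j ^ i) \<in> P"
  shows "(\<lambda>z. z j ^ k) \<in> frac_span V P B ((\<lambda>i z. z j ^ i) ` {..<D::nat})"
proof (induction k rule: less_induct)
  case (less k)
  have xk: "(\<lambda>z. z j ^ i) \<in> pf V" for i by (intro pf_power pf_var j)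
  show ?case
  proof (cases "k < D")
    case True then show ?thesis by (intro frac_span.base) blast
  next
    case False
    then have kD: "D \<le> k" by simp
    have *: "c D z * z j ^ k = z j ^ (k - D) * (\<Sum>i\<le>D. c i z * z j ^ i) + (\<Sum>i<D. (- c i z) * z j ^ (k - D + i))" for z
    proof -
      have "z j ^ (k - D) * (\<Sum>i\<le>D. c i z * z j ^ i) = (\<Sum>i\<le>D. c i z * z j ^ (k - D + i))"
        by (simp add: sum_distrib_left power_add mult_ac)
      also have "\<dots> = (\<Sum>i<D. c i z * z j ^ (k - D + i)) + c D z * z j ^ k"
        using kD by (simp add: lessThan_Suc_atMost[symmetric])
      finally show ?thesis by (simp add: sum_negf)
    qed
    have "(\<lambda>z. z j ^ (k - D) * (\<Sum>i\<le>D. c i z * z j ^ i)) \<in> frac_span V P B ((\<lambda>i z. z j ^ i) ` {..<D})"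
      by (intro frac_span.ideal pf_idealD(4)[OF P xk rel])
    moreover have "(\<lambda>z. \<Sum>i<D. (- c i z) * z j ^ (k - D + i)) \<in> frac_span V P B ((\<lambda>i z. z j ^ i) ` {..<D})"
      by (intro frac_span_sum[OF P] frac_span.scale pf_uminus c less.IH) (use kD in auto)
    ultimately have "(\<lambda>z. c D z * z j ^ k) \<in> frac_span V P B ((\<lambda>i z. z j ^ i) ` {..<D})"
      unfolding * by (rule frac_span.add)
    then show ?thesis by (rule frac_span.cancel[OF c(1) c(2) xk])
  qed
qed

text \<open>Algebraic coordinates are adjoined one at a time; finite generation survives each step
  because only finitely many powers of the new coordinate are required.\<close>

lemma frac_span_finite:
  assumes P: "pf_ideal V P" and B: "B \<subseteq> V"
    and dep: "\<And>j. j \<in> A \<Longrightarrow> \<not> pf_indep P (insert j B)" and A: "finite A" "A \<subseteq> V"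
  shows "\<exists>F. finite F \<and> F \<subseteq> pf V \<and> pf (B \<union> A) \<subseteq> frac_span V P B F"
  using A dep
proof (induction A rule: finite_induct)
  case empty
  have "f \<in> frac_span V P B {\<lambda>_. 1}" if "f \<in> pf B" for f
    using frac_span.scale[OF that frac_span.base[of "\<lambda>_. 1" "{\<lambda>_. 1}"]] by simp
  then show ?case by (intro exI[of _ "{\<lambda>_. 1}"]) (auto intro: pf_const)
next
  case (insert j A)
  then obtain F where F: "finite F" "F \<subseteq> pf V" "pf (B \<union> A) \<subseteq> frac_span V P B F" by auto
  obtain \<phi> where \<phi>: "\<phi> \<in> pf (insert j B)" "\<phi> \<in> P" "\<phi> \<noteq> (\<lambda>_. 0)"
    using insert.prems(2)[of j] by (auto simp: pf_indep_def)
  obtain M c where c: "\<And>i. c i \<in> pf B" "\<phi> = (\<lambda>z. \<Sum>i\<le>(M::nat). c i z * z j ^ i)"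
    using pf_insert_expand[OF \<phi>(1)] by blast
  \<comment> \<open>The listed top coefficient may be zero, so the degree has to be taken as the
    largest index of a nonzero coefficient.\<close>
  define S where "S = {i. i \<le> M \<and> c i \<noteq> (\<lambda>_. 0)}"
  have "S \<noteq> {}"
  proof
    assume "S = {}"
    then have "c i = (\<lambda>_. 0)" if "i \<le> M" for i using that by (auto simp: S_def)
    then have "\<phi> = (\<lambda>_. 0)" unfolding c(2) by (intro ext sum.neutral) auto
    then show False using \<phi>(3) by blast
  qed
  have finS: "finite S" by (simp add: S_def)
  define D where "D = Max S"
  have D: "D \<in> S" using Max_in[OF finS \<open>S \<noteq> {}\<close>] by (simp add: D_def)
  have large: "c i = (\<lambda>_. 0)" if "i \<le> M" "D < i" for i
  proof (rule ccontr)
    assume "c i \<noteq> (\<lambda>_. 0)"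
    then have "i \<in> S" using that(1) by (simp add: S_def)
    then show False using Max_ge[OF finS, of i] that(2) by (simp add: D_def)
  qed
  have "\<phi> = (\<lambda>z. \<Sum>i\<le>D. c i z * z j ^ i)"
    unfolding c(2)
  proof (intro ext sum.mono_neutral_right ballI)
    fix z i assume "i \<in> {..M} - {..D}"
    then show "c i z * z j ^ i = 0" using large[of i] by auto
  qed (use D in \<open>auto simp: S_def\<close>)
  then have pw: "(\<lambda>z. z j ^ k) \<in> frac_span V P B ((\<lambda>i z. z j ^ i) ` {..<D})" for k
    using frac_span_powers[where j = j and D = D and k = k and c = c, OF P B _ c(1)] D \<phi>(2) insert.prems
    by (auto simp: S_def)
  define F' :: "cfun set" where "F' = (\<lambda>i z. z j ^ i) ` {..<D}"
  define G where "G = {(\<lambda>z. m z * m' z) | m m'. m \<in> F \<and> m' \<in> F'}"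
  have F': "finite F'" "F' \<subseteq> pf V"
    unfolding F'_def using insert.prems(1) by (auto intro!: pf_power pf_var)
  have "G = (\<lambda>(m, m') z. m z * m' z) ` (F \<times> F')" by (auto simp: G_def)
  then have "finite G" using F F' by simp
  moreover have "G \<subseteq> pf V" using F(2) F'(2) by (auto simp: G_def intro!: pf_mult)
  moreover have "f \<in> frac_span V P B G" if f: "f \<in> pf (B \<union> insert j A)" for f
  proof -
    have "f \<in> pf (insert j (B \<union> A))" using f by simp
    then obtain a and M :: nat where a: "\<And>i. a i \<in> pf (B \<union> A)" "f = (\<lambda>z. \<Sum>i\<le>M. a i z * z j ^ i)"
      by (rule pf_insert_expand) blast
    show ?thesis unfolding a(2) G_def
      by (intro frac_span_sum[OF P] frac_span_mult[OF P B F(2) F'(2)]) (use a F(3) pw F'_def in auto)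
  qed
  ultimately show ?case by blast
qed

text \<open>The \<open>M + 1\<close> powers of \<open>h\<close> up to exponent \<open>M\<close> lie
  in a module with \<open>M\<close> generators, so a linear dependence between them is an algebraic
  equation.\<close>

lemma pf_algebraic:
  assumes P: "pf_ideal V P" and B: "B \<subseteq> V" and V: "finite V" and h: "h \<in> pf V"
    and dep: "\<And>j. j \<in> V - B \<Longrightarrow> \<not> pf_indep P (insert j B)"
  shows "\<exists>M c. (\<forall>i. c i \<in> pf B) \<and> (\<exists>i\<le>M. c i \<noteq> (\<lambda>_. 0)) \<and> (\<lambda>z. \<Sum>i\<le>(M::nat). c i z * h z ^ i) \<in> P"
proof -
  obtain F where F: "finite F" "F \<subseteq> pf V" "pf (B \<union> (V - B)) \<subseteq> frac_span V P B F"
    using frac_span_finite[OF P B dep, of "V - B"] V by blast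
  obtain m where m: "F = m ` {..<card F}"
    using ex_bij_betw_nat_finite[OF F(1)] by (metis bij_betw_imp_surj_on atLeast0LessThan)
  define M where "M = card F"
  have "(\<lambda>z. h z ^ k) \<in> frac_span V P B (m ` {..<M})" for k
    using F(3) B pf_power[OF h, of k] m by (metis M_def Un_Diff_cancel subsetD sup.absorb2)
  define R where "R k s c \<longleftrightarrow> s \<in> pf B \<and> s \<noteq> (\<lambda>_. 0) \<and> (\<forall>i. c i \<in> pf B) \<and>
    (\<lambda>z. s z * h z ^ k - (\<Sum>i<M. c i z * m i z)) \<in> P" for k s c
  have "\<exists>s c. R k s c" for k
    unfolding R_def by (rule frac_span_normal_form[OF P B]) fact
  then obtain s c where "\<And>k. R k (s k) (c k)" by metis
  then have s: "\<And>k. s k \<in> pf B" "\<And>k. s k \<noteq> (\<lambda>_. 0)" and c: "\<And>k i. c k i \<in> pf B"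
    and rel: "\<And>k. (\<lambda>z. s k z * h z ^ k - (\<Sum>i<M. c k i z * m i z)) \<in> P" unfolding R_def by auto
  have "\<exists>l. (\<forall>k. l k \<in> pf B) \<and> (\<exists>k\<in>{..M}. l k \<noteq> (\<lambda>_. 0)) \<and>
    (\<forall>i<M. \<forall>z. (\<Sum>k\<in>{..M}. l k z * c k i z) = 0)"
    by (rule pf_linear_dependence) (auto intro: c)
  then obtain l where l: "\<And>k. l k \<in> pf B" "\<exists>k\<in>{..M}. l k \<noteq> (\<lambda>_. 0)"
    "\<And>i z. i < M \<Longrightarrow> (\<Sum>k\<le>M. l k z * c k i z) = 0" by blast
  have "(\<lambda>z. \<Sum>k\<le>M. l k z * (s k z * h z ^ k - (\<Sum>i<M. c k i z * m i z))) \<in> P"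
    by (intro pf_ideal_sum[OF P] pf_idealD(4)[OF P _ rel] pf_mono[OF l(1) B])
  moreover have "(\<Sum>k\<le>M. l k z * (s k z * h z ^ k - (\<Sum>i<M. c k i z * m i z)))
     = (\<Sum>k\<le>M. (l k z * s k z) * h z ^ k)" for z
  proof -
    have "(\<Sum>k\<le>M. l k z * (\<Sum>i<M. c k i z * m i z)) = (\<Sum>i<M. (\<Sum>k\<le>M. l k z * c k i z) * m i z)"
      unfolding sum_distrib_left sum_distrib_right by (subst sum.swap) (simp add: mult.assoc)
    also have "\<dots> = 0" using l(3) by simp
    finally show ?thesis by (simp add: right_diff_distrib sum_subtractf mult.assoc)
  qed
  ultimately have "(\<lambda>z. \<Sum>k\<le>M. (l k z * s k z) * h z ^ k) \<in> P" by simp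
  moreover obtain k where "k \<le> M" "l k \<noteq> (\<lambda>_. 0)" using l(2) by auto
  ultimately show ?thesis
    using pf_no_zero_divisors[OF l(1) s(1) _ s(2)]
    by (intro exI[of _ M] exI[of _ "\<lambda>k z. l k z * s k z"]) (auto intro!: pf_mult l(1) s(1))
qed

text \<open>A strictly smaller prime has larger transcendence degree. Otherwise some
  \<open>h\<close> in \<open>P\<close> but not in \<open>P'\<close> would be algebraic over
  \<open>B\<close> modulo \<open>P'\<close>. Dividing by a power of \<open>h\<close>, possible as
  \<open>P'\<close> is prime, makes the constant coefficient nonzero; it then lies in
  \<open>P\<close>, against the independence of \<open>B\<close>.\<close>

lemma pf_indep_extend:
  assumes P': "pf_prime V P'" and P: "pf_prime V P" and less: "P' \<subset> P"
    and V: "finite V" "B \<subseteq> V" and ind: "pf_indep P B"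
  shows "\<exists>j\<in>V - B. pf_indep P' (insert j B)"
proof (rule ccontr)
  assume "\<not> ?thesis"
  then have dep: "\<And>j. j \<in> V - B \<Longrightarrow> \<not> pf_indep P' (insert j B)" by blast
  obtain h where h: "h \<in> P" "h \<notin> P'" using less by blast
  note id = pf_primeD(1)[OF P] and id' = pf_primeD(1)[OF P']
  have hV: "h \<in> pf V" using pf_idealD(1)[OF id h(1)] .
  obtain M c where c: "\<And>i. c i \<in> pf B" "\<exists>i\<le>M. c i \<noteq> (\<lambda>_. 0)" "(\<lambda>z. \<Sum>i\<le>(M::nat). c i z * h z ^ i) \<in> P'"
    using pf_algebraic[OF id' V(2,1) hV dep] by blast
  define i0 where "i0 = (LEAST i. i \<le> M \<and> c i \<noteq> (\<lambda>_. 0))"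
  have i0: "i0 \<le> M" "c i0 \<noteq> (\<lambda>_. 0)" using LeastI_ex[OF c(2)] by (auto simp: i0_def)
  have small: "c i = (\<lambda>_. 0)" if "i < i0" for i
    using not_less_Least[of i] that i0(1) by (fastforce simp: i0_def)
  have cV: "c i \<in> pf V" for i using c(1) V(2) by (rule pf_mono)
  have "(\<Sum>i\<le>M. c i z * h z ^ i) = h z ^ i0 * (\<Sum>i\<le>M - i0. c (i0 + i) z * h z ^ i)" for z
  proof -
    have "(\<Sum>i\<le>M. c i z * h z ^ i) = (\<Sum>i\<in>{i0..M}. c i z * h z ^ i)"
      by (rule sum.mono_neutral_right) (use small in auto)
    also have "\<dots> = (\<Sum>i\<le>M - i0. c (i + i0) z * h z ^ (i + i0))"
      using sum.shift_bounds_cl_nat_ivl[of "\<lambda>i. c i z * h z ^ i" 0 i0 "M - i0"] i0(1)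
      by (simp add: atMost_atLeast0)
    finally show ?thesis by (simp add: power_add sum_distrib_left mult_ac add.commute)
  qed
  then have prod: "(\<lambda>z. h z ^ i0 * (\<Sum>i\<le>M - i0. c (i0 + i) z * h z ^ i)) \<in> P'" using c(3) by simp
  have "(\<lambda>z. \<Sum>i\<le>M - i0. c (i0 + i) z * h z ^ i) \<in> pf V"
    by (intro pf_sum pf_mult cV pf_power hV)
  then have "(\<lambda>z. \<Sum>i\<le>M - i0. c (i0 + i) z * h z ^ i) \<in> P'"
    using pf_primeD(3)[OF P' prod pf_power[OF hV]] pf_prime_power[OF P' hV, of i0] h(2) by blast
  then have "(\<lambda>z. \<Sum>i\<le>M - i0. c (i0 + i) z * h z ^ i) \<in> P" using less by blast
  moreover have "(\<lambda>z. \<Sum>i\<in>{1..M - i0}. (c (i0 + i) z * h z ^ (i - 1)) * h z) \<in> P"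
    by (intro pf_ideal_sum[OF id] pf_idealD(4)[OF id _ h(1)] pf_mult cV pf_power hV)
  ultimately have "(\<lambda>z. (\<Sum>i\<le>M - i0. c (i0 + i) z * h z ^ i) -
     (\<Sum>i\<in>{1..M - i0}. (c (i0 + i) z * h z ^ (i - 1)) * h z)) \<in> P" by (rule pf_ideal_diff[OF id])
  moreover have "(\<Sum>i\<le>M - i0. c (i0 + i) z * h z ^ i) -
     (\<Sum>i\<in>{1..M - i0}. (c (i0 + i) z * h z ^ (i - 1)) * h z) = c i0 z" for z
  proof -
    have "(\<Sum>i\<in>{1..M - i0}. (c (i0 + i) z * h z ^ (i - 1)) * h z) = (\<Sum>i\<in>{1..M - i0}. c (i0 + i) z * h z ^ i)"
      by (rule sum.cong) (auto simp: mult.assoc power_eq_if)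
    moreover have "{..M - i0} = insert 0 {1..M - i0}" by auto
    ultimately show ?thesis by simp
  qed
  ultimately have "c i0 \<in> P" by simp
  then show False using ind c(1) i0(2) by (auto simp: pf_indep_def)
qed

section \<open>Algebraic sets\<close>

definition alg_closed :: "nat set \<Rightarrow> (nat \<Rightarrow> complex) set \<Rightarrow> bool" where
  "alg_closed V Z \<longleftrightarrow> (\<exists>A \<subseteq> pf V. Z = zeros A)"

definition alg_irreducible :: "nat set \<Rightarrow> (nat \<Rightarrow> complex) set \<Rightarrow> bool" where
  "alg_irreducible V Z \<longleftrightarrow> Z \<noteq> {} \<and>
     (\<forall>A B. alg_closed V A \<longrightarrow> alg_closed V B \<longrightarrow> Z \<subseteq> A \<union> B \<longrightarrow> Z \<subseteq> A \<or> Z \<subseteq> B)"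

definition vanishing :: "nat set \<Rightarrow> (nat \<Rightarrow> complex) set \<Rightarrow> cfun set" where
  "vanishing V Z = {f \<in> pf V. \<forall>z\<in>Z. f z = 0}"

lemma pf_ideal_vanishing: "pf_ideal V (vanishing V Z)"
  by (auto simp: pf_ideal_def vanishing_def intro: pf_const pf_add pf_mult)

lemma zeros_vanishing: "alg_closed V Z \<Longrightarrow> zeros (vanishing V Z) = Z"
  by (auto simp: alg_closed_def vanishing_def zeros_def)

lemma vanishing_antimono: "Z \<subseteq> Z' \<Longrightarrow> vanishing V Z' \<subseteq> vanishing V Z"
  by (auto simp: vanishing_def)

lemma vanishing_strict_antimono:
  assumes "alg_closed V Z" "alg_closed V Z'" "Z \<subset> Z'"
  shows "vanishing V Z' \<subset> vanishing V Z"
  using assms vanishing_antimono[of Z Z' V] zeros_vanishing[OF assms(1)] zeros_vanishing[OF assms(2)]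
  by (metis less_le)

lemma alg_closed_zeros: "A \<subseteq> pf V \<Longrightarrow> alg_closed V (zeros A)"
  by (auto simp: alg_closed_def)

lemma pf_prime_vanishing:
  assumes "alg_irreducible V Z" shows "pf_prime V (vanishing V Z)"
  unfolding pf_prime_def
proof (intro conjI ballI impI)
  show "pf_ideal V (vanishing V Z)" by (rule pf_ideal_vanishing)
  show "(\<lambda>_. 1) \<notin> vanishing V Z" using assms by (auto simp: alg_irreducible_def vanishing_def)
  fix f g assume *: "f \<in> pf V" "g \<in> pf V" "(\<lambda>z. f z * g z) \<in> vanishing V Z"
  then have "Z \<subseteq> zeros {f} \<union> zeros {g}" by (auto simp: vanishing_def zeros_def)
  then have "Z \<subseteq> zeros {f} \<or> Z \<subseteq> zeros {g}"
    using assms alg_closed_zeros[of "{f}" V] alg_closed_zeros[of "{g}" V] *(1,2)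
    unfolding alg_irreducible_def by blast
  then show "f \<in> vanishing V Z \<or> g \<in> vanishing V Z" using * by (auto simp: vanishing_def zeros_def)
qed

lemma alg_irreducibleI:
  assumes "Z \<noteq> {}" "\<And>f g. f \<in> pf V \<Longrightarrow> g \<in> pf V \<Longrightarrow> \<exists>z\<in>Z. f z \<noteq> 0 \<Longrightarrow> \<exists>z\<in>Z. g z \<noteq> 0 \<Longrightarrow>
    \<exists>z\<in>Z. f z \<noteq> 0 \<and> g z \<noteq> 0"
  shows "alg_irreducible V Z"
  unfolding alg_irreducible_def
proof (intro conjI allI impI assms(1))
  fix A B assume AB: "alg_closed V A" "alg_closed V B" "Z \<subseteq> A \<union> B"
  then obtain FA FB where F: "FA \<subseteq> pf V" "A = zeros FA" "FB \<subseteq> pf V" "B = zeros FB"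
    by (auto simp: alg_closed_def)
  show "Z \<subseteq> A \<or> Z \<subseteq> B"
  proof (rule ccontr)
    assume "\<not> ?thesis"
    then obtain f g where f: "f \<in> FA" "\<exists>z\<in>Z. f z \<noteq> 0" and g: "g \<in> FB" "\<exists>z\<in>Z. g z \<noteq> 0"
      using F by (auto simp: zeros_def)
    then obtain z where z: "z \<in> Z" "f z \<noteq> 0" "g z \<noteq> 0" using assms(2)[of f g] F by blast
    then show False using AB(3) F f g by (auto simp: zeros_def)
  qed
qed

text \<open>If \<open>f\<close> vanishes wherever \<open>g\<close> does not, then
  \<open>f z * g z\<close> vanishes on all of \<open>zeros P\<close>, and the Nullstellensatz puts
  the product into the prime \<open>P\<close>. Removing the zeros of \<open>g\<close> thus leaves
  the closure unchanged.\<close>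

lemma vanishing_prime_open:
  assumes P: "pf_prime V P" and g: "g \<in> pf V" "g \<notin> P"
  shows "vanishing V (zeros P - zeros {g}) = P"
proof
  show "P \<subseteq> vanishing V (zeros P - zeros {g})"
    using pf_idealD(1)[OF pf_primeD(1)[OF P]] by (auto simp: vanishing_def zeros_def)
  show "vanishing V (zeros P - zeros {g}) \<subseteq> P"
  proof
    fix f assume f: "f \<in> vanishing V (zeros P - zeros {g})"
    show "f \<in> P"
    proof (rule ccontr)
      assume "f \<notin> P"
      moreover have fV: "f \<in> pf V" using f by (simp add: vanishing_def)
      ultimately have "(\<lambda>z. f z * g z) \<notin> P" using pf_primeD(3)[OF P] g by blast
      then obtain z where "z \<in> zeros P" "f z * g z \<noteq> 0"
        using pf_prime_nullstellensatz[OF P pf_mult[OF fV g(1)]] by blast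
      then show False using f by (auto simp: vanishing_def zeros_def)
    qed
  qed
qed

lemma pf_prime_mem_iff:
  assumes "pf_prime V P" "g \<in> pf V" "g \<notin> P" "f \<in> pf V"
  shows "f \<in> P \<longleftrightarrow> (\<forall>z\<in>zeros P - zeros {g}. f z = 0)"
  using vanishing_prime_open[OF assms(1-3)] assms(4) by (auto simp: vanishing_def)

lemma alg_irreducible_prime_open:
  assumes P: "pf_prime V P" and g: "g \<in> pf V" "g \<notin> P"
  shows "alg_irreducible V (zeros P - zeros {g})"
proof (rule alg_irreducibleI)
  obtain z where "z \<in> zeros P" "g z \<noteq> 0" using pf_prime_nullstellensatz[OF P g] .
  then show "zeros P - zeros {g} \<noteq> {}" by (auto simp: zeros_def)
next
  fix f h assume fh: "f \<in> pf V" "h \<in> pf V"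
    "\<exists>z\<in>zeros P - zeros {g}. f z \<noteq> 0" "\<exists>z\<in>zeros P - zeros {g}. h z \<noteq> 0"
  then have "f \<notin> P" "h \<notin> P" using pf_prime_mem_iff[OF P g] by blast+
  then have "(\<lambda>z. f z * h z) \<notin> P" using pf_primeD(3)[OF P] fh by blast
  then show "\<exists>z\<in>zeros P - zeros {g}. f z \<noteq> 0 \<and> h z \<noteq> 0"
    using pf_prime_mem_iff[OF P g pf_mult[OF fh(1,2)]] by auto
qed

lemma vanishing_zeros_prime:
  assumes P: "pf_prime V P" shows "vanishing V (zeros P) = P"
proof -
  have "zeros {\<lambda>_. 1} = {}" by (auto simp: zeros_def)
  then show ?thesis using vanishing_prime_open[OF P pf_const pf_primeD(2)[OF P]] by simp
qed

text \<open>Going up the chain the vanishing ideals shrink strictly, and each step admits one more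
  independent coordinate from \<open>V\<close>.\<close>

lemma alg_chain_length:
  assumes V: "finite V" and B: "B \<subseteq> V" "pf_indep (vanishing V (Z 0)) B"
    and Z: "\<And>i. i \<le> n \<Longrightarrow> alg_closed V (Z i) \<and> alg_irreducible V (Z i)" "\<And>i. i < n \<Longrightarrow> Z i \<subset> Z (Suc i)"
  shows "card B + n \<le> card V"
proof -
  have "\<exists>B'\<subseteq>V. card B' = card B + i \<and> pf_indep (vanishing V (Z i)) B'" if "i \<le> n" for i
    using that
  proof (induction i)
    case 0 then show ?case using B by auto
  next
    case (Suc i)
    then obtain B' where B': "B' \<subseteq> V" "card B' = card B + i" "pf_indep (vanishing V (Z i)) B'" by auto
    have "pf_prime V (vanishing V (Z (Suc i)))" "pf_prime V (vanishing V (Z i))"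
      using Z(1) Suc.prems by (simp_all add: pf_prime_vanishing)
    moreover have "vanishing V (Z (Suc i)) \<subset> vanishing V (Z i)"
      using Z Suc.prems by (intro vanishing_strict_antimono) simp_all
    ultimately have "\<exists>j\<in>V - B'. pf_indep (vanishing V (Z (Suc i))) (insert j B')"
      using pf_indep_extend V B'(1,3) by blast
    then obtain j where j: "j \<in> V - B'" "pf_indep (vanishing V (Z (Suc i))) (insert j B')" by blast
    moreover have "card (insert j B') = card B + Suc i"
      using j(1) B' finite_subset[OF B'(1) V] by simp
    ultimately show ?case using B'(1) by (intro exI[of _ "insert j B'"]) auto
  qed
  then obtain B' where "B' \<subseteq> V" "card B' = card B + n" by blast
  then show ?thesis using card_mono[OF V] by metis
qed

text \<open>
  The chain consists of cylinders over projections: the polynomials in \<open>P\<close> not involving the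
  first \<open>k\<close> of the dependent coordinates.
\<close>

lemma alg_cylinder_irreducible:
  assumes P: "pf_prime V P"
  shows "alg_irreducible V (zeros (P \<inter> pf (V - J)))" (is "alg_irreducible V ?Z")
proof (rule alg_irreducibleI)
  have "(\<lambda>_. 1) \<in> pf V" by (rule pf_const)
  then obtain z where "z \<in> zeros P" using pf_prime_nullstellensatz[OF P _ pf_primeD(2)[OF P]] by blast
  then show "?Z \<noteq> {}" by (auto simp: zeros_def)
next
  fix f g assume f: "f \<in> pf V" and g: "g \<in> pf V" and "\<exists>z\<in>?Z. f z \<noteq> 0" "\<exists>z\<in>?Z. g z \<noteq> 0"
  then obtain a b where a: "a \<in> ?Z" "f a \<noteq> 0" and b: "b \<in> ?Z" "g b \<noteq> 0" by blast
  \<comment> \<open>Functions in \<open>P\<close> that survive in the cylinder ignore the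
    coordinates in \<open>J\<close>, so these may be prescribed: \<open>put c w\<close> takes them
    from \<open>c\<close> and the rest from \<open>w\<close>.\<close>
  define put where "put c w = (\<lambda>i. if i \<in> J then c i else w i)" for c w :: "nat \<Rightarrow> complex"
  have notP: "(\<lambda>w. h (put c w)) \<notin> P" if "h \<in> pf V" "c \<in> ?Z" "h c \<noteq> 0" for h c
  proof
    assume "(\<lambda>w. h (put c w)) \<in> P"
    moreover have "(\<lambda>w. h (put c w)) \<in> pf (V - J)" unfolding put_def by (rule pf_subst[OF that(1)])
    ultimately have "h (put c c) = 0" using that(2) by (auto simp: zeros_def)
    then show False using that(3) by (simp add: put_def)
  qed
  have pfput: "(\<lambda>w. h (put c w)) \<in> pf V" if "h \<in> pf V" for h c
    unfolding put_def using pf_mono[OF pf_subst[OF that]] by blast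
  have "(\<lambda>w. f (put a w) * g (put b w)) \<notin> P"
    using pf_primeD(3)[OF P _ pfput[OF f] pfput[OF g]] notP[OF f a] notP[OF g b] by blast
  then obtain w where w: "w \<in> zeros P" "f (put a w) * g (put b w) \<noteq> 0"
    using pf_prime_nullstellensatz[OF P pf_mult[OF pfput[OF f] pfput[OF g]]] by blast
  then obtain t where t: "f (\<lambda>i. put a w i + t * (put b w i - put a w i)) \<noteq> 0"
    "g (\<lambda>i. put a w i + t * (put b w i - put a w i)) \<noteq> 0"
    using pf_line_common_nonzero[OF f g, of "put a w" "put b w"] by auto
  \<comment> \<open>Outside \<open>J\<close> both end points agree with \<open>w\<close>, so the
    whole line stays in the cylinder.\<close>
  have "(\<lambda>i. put a w i + t * (put b w i - put a w i)) \<in> ?Z"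
    unfolding zeros_def
  proof (intro CollectI ballI)
    fix q assume q: "q \<in> P \<inter> pf (V - J)"
    then have "q (\<lambda>i. put a w i + t * (put b w i - put a w i)) = q w"
      by (intro pf_depends[of q "V - J"]) (auto simp: put_def)
    then show "q (\<lambda>i. put a w i + t * (put b w i - put a w i)) = 0" using w(1) q by (auto simp: zeros_def)
  qed
  then show "\<exists>z\<in>?Z. f z \<noteq> 0 \<and> g z \<noteq> 0" using t by blast
qed

lemma alg_chain_exists:
  assumes V: "finite V" and B: "B \<subseteq> V" and P: "pf_prime V P" and ind: "pf_indep P B"
    and dep: "\<And>j. j \<in> V - B \<Longrightarrow> \<not> pf_indep P (insert j B)"
  obtains Z where "Z 0 = zeros P"
    "\<And>i. i \<le> card (V - B) \<Longrightarrow> alg_closed V (Z i) \<and> alg_irreducible V (Z i)"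
    "\<And>i. i < card (V - B) \<Longrightarrow> Z i \<subset> Z (Suc i)"
proof -
  obtain e where e: "bij_betw e {0..<card (V - B)} (V - B)"
    using ex_bij_betw_nat_finite[of "V - B"] V by blast
  define J where "J k = e ` {0..<k}" for k :: nat
  define Z where "Z k = zeros (P \<inter> pf (V - J k))" for k
  show ?thesis
  proof (rule that[of Z])
    have "P \<inter> pf V = P" using pf_idealD(1)[OF pf_primeD(1)[OF P]] by blast
    then show "Z 0 = zeros P" by (simp add: Z_def J_def)
    show "alg_closed V (Z i) \<and> alg_irreducible V (Z i)" for i
      unfolding Z_def using alg_cylinder_irreducible[OF P]
      by (auto intro!: alg_closed_zeros intro: pf_mono)
    fix k assume k: "k < card (V - B)"
    define j where "j = e k"
    have J: "J (Suc k) = insert j (J k)" by (auto simp: J_def j_def atLeast0_lessThan_Suc)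
    have jVB: "j \<in> V - B" using e k by (auto simp: j_def bij_betw_def)
    have jJ: "j \<notin> J k"
      using e k inj_onD[of e "{0..<card (V - B)}" k] by (fastforce simp: j_def J_def bij_betw_def)
    have BJ: "i \<notin> B" if "i \<in> J k" for i
      using that e k by (auto simp: J_def bij_betw_def)
    obtain \<phi> where \<phi>: "\<phi> \<in> pf (insert j B)" "\<phi> \<in> P" "\<phi> \<noteq> (\<lambda>_. 0)" using dep[OF jVB] by (auto simp: pf_indep_def)
    have \<phi>Z: "\<phi> z = 0" if "z \<in> Z k" for z
    proof -
      have "\<phi> \<in> pf (V - J k)" by (rule pf_mono[OF \<phi>(1)]) (use BJ jJ jVB B in auto)
      then show ?thesis using that \<phi>(2) by (auto simp: Z_def zeros_def)
    qed
    have "Z k \<subseteq> Z (Suc k)" by (auto simp: Z_def J zeros_def intro: pf_mono)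
    moreover have "Z k \<noteq> Z (Suc k)"
    proof
      \<comment> \<open>Points of \<open>zeros P\<close> with coordinate \<open>j\<close> altered
        lie in \<open>Z (Suc k)\<close>. If that set were \<open>Z k\<close>, the relation \<phi>
        would hold there for every value of \<open>j\<close>; freezing \<open>j\<close> gives
        polynomials in \<open>B\<close> that vanish on \<open>zeros P\<close>, hence are
        zero.\<close>
      assume eq: "Z k = Z (Suc k)"
      have "\<phi> w = 0" for w
      proof -
        define c where "c = w j"
        define \<psi> where "\<psi> = (\<lambda>z. \<phi> (\<lambda>i. if i \<in> {j} then c else z i))"
        have "\<psi> \<in> pf (insert j B - {j})" unfolding \<psi>_def by (rule pf_subst[OF \<phi>(1)])
        then have \<psi>: "\<psi> \<in> pf B" by (rule pf_mono) auto
        have "\<psi> z = 0" if z: "z \<in> zeros P" for z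
        proof -
          have "(\<lambda>i. if i \<in> {j} then c else z i) \<in> Z (Suc k)"
            unfolding Z_def zeros_def
          proof (intro CollectI ballI)
            fix q assume q: "q \<in> P \<inter> pf (V - J (Suc k))"
            then have "q (\<lambda>i. if i \<in> {j} then c else z i) = q z"
              by (intro pf_depends[of q "V - J (Suc k)"]) (auto simp: J)
            then show "q (\<lambda>i. if i \<in> {j} then c else z i) = 0" using q z by (auto simp: zeros_def)
          qed
          then show ?thesis unfolding \<psi>_def eq[symmetric] by (rule \<phi>Z)
        qed
        then have "\<psi> \<in> vanishing V (zeros P)" using pf_mono[OF \<psi> B] by (auto simp: vanishing_def)
        then have "\<psi> = (\<lambda>_. 0)" using \<psi> ind by (simp add: vanishing_zeros_prime[OF P] pf_indep_def)
        then have "\<psi> w = 0" by simp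
        moreover have "(\<lambda>i. if i \<in> {j} then c else w i) = w" by (auto simp: c_def)
        ultimately show ?thesis by (simp add: \<psi>_def)
      qed
      then show False using \<phi>(3) by auto
    qed
    ultimately show "Z k \<subset> Z (Suc k)" by blast
  qed
qed

section \<open>Integral focal values and Hensel lifting\<close>

text \<open>
  The least common multiple of \<open>1, \<dots>, 25\<close>.  Scaling the terms of degree \<open>d\<close> of the system by its
  power \<open>d - 1\<close> clears the denominators \<open>k - j\<close> in the recursion for the coefficient of \<open>z\<^sup>j w\<^sup>k\<close>.
\<close>

definition NN :: int where "NN = 26771144400"

text \<open>The coefficient of \<open>z^j w^k\<close> in \<open>(A g_z - B g_w) / NN\<close>. After
  scaling, \<open>X 0\<close> to \<open>X 6\<close> are the coefficients of \<open>A\<close> at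
  \<open>z^2, zw, w^2, z^3, z^2w, zw^2, w^3\<close>, and \<open>X 7\<close> to \<open>X 13\<close>
  those of \<open>B\<close> in the same order with \<open>z\<close> and \<open>w\<close>
  exchanged.\<close>

definition focT :: "(nat \<Rightarrow> 'a::comm_ring_1) \<Rightarrow> (int \<Rightarrow> int \<Rightarrow> 'a) \<Rightarrow> int \<Rightarrow> int \<Rightarrow> 'a" where
  "focT X g j k =
     (X 0 * of_int (j - 1) - X 8 * of_int k) * g (j - 1) k
   + (X 1 * of_int j - X 7 * of_int (k - 1)) * g j (k - 1)
   + X 2 * of_int (j + 1) * g (j + 1) (k - 2) - X 9 * of_int (k + 1) * g (j - 2) (k + 1)
   + of_int NN *
    ((X 3 * of_int (j - 2) - X 12 * of_int k) * g (j - 2) k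
   + (X 4 * of_int (j - 1) - X 11 * of_int (k - 1)) * g (j - 1) (k - 1)
   + (X 5 * of_int j - X 10 * of_int (k - 2)) * g j (k - 2)
   + X 6 * of_int (j + 1) * g (j + 1) (k - 3) - X 13 * of_int (k + 1) * g (j - 3) (k + 1))"

text \<open>Step \<open>n\<close> fills in degree \<open>n + 3\<close>, starting from
  \<open>zw\<close>. Off the diagonal the coefficient solves \<open>(j - k) a + NN focT = 0\<close>;
  on the diagonal this cannot be solved, the free coefficient is set to zero and the obstruction is
  left for \<open>focS\<close>.\<close>

primrec focA :: "(nat \<Rightarrow> 'a::comm_ring_1) \<Rightarrow> nat \<Rightarrow> int \<Rightarrow> int \<Rightarrow> 'a" where
  "focA X 0 = (\<lambda>j k. if j = 1 \<and> k = 1 then 1 else 0)"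
| "focA X (Suc n) = (\<lambda>j k. if j \<ge> 0 \<and> k \<ge> 0 \<and> j + k = int n + 3
     then (if j = k then 0 else of_int (NN div (k - j)) * focT X (focA X n) j k) else focA X n j k)"

text \<open>The obstruction in degree \<open>2 * m + 2\<close>. For \<open>m = 12\<close> it
  involves coefficients of degree at most 25, which are final after 23 steps.\<close>

definition focS :: "(nat \<Rightarrow> 'a::comm_ring_1) \<Rightarrow> nat \<Rightarrow> 'a" where
  "focS X m = focT X (focA X 23) (int m + 1) (int m + 1)"

text \<open>
  The same recursion modulo \<open>q\<close>, on the zero-padded list of coefficients of each homogeneous part,
  in a form that the simplifier can evaluate.
\<close>

fun tstep :: "int \<Rightarrow> int \<Rightarrow> int \<Rightarrow> int \<Rightarrow> int \<Rightarrow> int \<Rightarrow> int \<Rightarrow> int \<Rightarrow> int \<Rightarrow> int \<Rightarrow> int \<Rightarrow> int \<Rightarrow> int \<Rightarrow> int \<Rightarrow>  int \<Rightarrow> int \<Rightarrow> int \<Rightarrow> int \<Rightarrow> int list \<Rightarrow> int list \<Rightarrow> int list" where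
  "tstep x0 x1 x2 x3 x4 x5 x6 x7 x8 x9 x10 x11 x12 x13 n q j k (a # b # c # d # r) (e # f # g # h # i # s) =
    (((x0 * (j - 1) - x8 * k) * b + (x1 * j - x7 * (k - 1)) * c + x2 * (j + 1) * d - x9 * (k + 1) * a
      + n * ((x3 * (j - 2) - x12 * k) * f + (x4 * (j - 1) - x11 * (k - 1)) * g
      + (x5 * j - x10 * (k - 2)) * h + x6 * (j + 1) * i - x13 * (k + 1) * e)) mod q)
    # tstep x0 x1 x2 x3 x4 x5 x6 x7 x8 x9 x10 x11 x12 x13 n q (j + 1) (k - 1) (b # c # d # r) (f # g # h # i # s)"
| "tstep x0 x1 x2 x3 x4 x5 x6 x7 x8 x9 x10 x11 x12 x13 n q j k _ _ = []"

fun gstep :: "int \<Rightarrow> int \<Rightarrow> int \<Rightarrow> int list \<Rightarrow> int list" where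
  "gstep q j k (t # ts) = (if j = k then 0 else ((NN div (k - j)) mod q * t) mod q) # gstep q (j + 1) (k - 1) ts"
| "gstep q j k [] = []"

fun diag :: "int \<Rightarrow> int \<Rightarrow> int list \<Rightarrow> int list" where
  "diag j k (t # ts) = (if j = k then [t] else diag (j + 1) (k - 1) ts)"
| "diag j k [] = []"

text \<open>The lists \<open>r2\<close> and \<open>r1\<close> hold the coefficients of degrees
  \<open>d - 2\<close> and \<open>d - 1\<close>. Three, respectively two, zeros on either side cover
  all indices that \<open>tstep\<close> reaches.\<close>

primrec focrun :: "(nat \<Rightarrow> int) \<Rightarrow> int \<Rightarrow> nat \<Rightarrow> int \<Rightarrow> int list \<Rightarrow> int list \<Rightarrow> int list" where
  "focrun X q 0 d r2 r1 = []"
| "focrun X q (Suc n) d r2 r1 = (let t = tstep (X 0) (X 1) (X 2) (X 3) (X 4) (X 5) (X 6) (X 7) (X 8) (X 9) (X 10) (X 11) (X 12) (X 13) (NN mod q) q 0 d ([0,0] @ r1 @ [0,0]) ([0,0,0] @ r2 @ [0,0,0])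
     in diag 0 d t @ focrun X q n (d + 1) r1 (gstep q 0 d t))"

text \<open>
  Mod 37 the system \<open>ctr\<close> has a focus of order 12, and the differentials of the first 11 focal
  values are independent there (found by a search over sparse systems).
\<close>

definition ctr :: "nat \<Rightarrow> int" where
  "ctr = (\<lambda>i. [0, 0, 0, -6, 0, 0, -3, 0, -9, 0, 0, 0, 1, 0] ! i)"

text \<open>The run covers the degrees 3 to 26 and starts from a zero linear part and the quadratic
  part \<open>zw\<close>. The modulus is \<open>37^2\<close> since one factor 37 is lost in reading
  off derivatives from shifts by 37.\<close>

definition focvals :: "(nat \<Rightarrow> int) \<Rightarrow> int list" where
  "focvals X = focrun X 1369 24 3 [0,0] [0,1,0]"

section \<open>Correctness of the modular evaluation\<close>

lemma upto_split: "i \<le> j + 1 \<Longrightarrow> j \<le> k \<Longrightarrow> [i..k] = [i..j] @ [j + 1..k::int]"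
  using upto_split1[of i "j + 1" k] by (cases "j = k") auto

lemma focA_outside: "j < 0 \<or> k < 0 \<Longrightarrow> focA X n j k = 0"
  by (induction n) auto

lemma focA_stable: "j + k \<le> int n + 2 \<Longrightarrow> focA X (n + i) j k = focA X n j k"
  by (induction i) auto

lemma focT_cong:
  assumes "\<And>a b. a + b = j + k - 1 \<or> a + b = j + k - 2 \<Longrightarrow> g a b = g' a b"
  shows "focT X g j k = focT X g' j k"
  unfolding focT_def by (simp add: assms)

lemma focA_rec:
  assumes "3 \<le> j + k" "j + k \<le> int n + 2" "0 \<le> j" "0 \<le> k"
  shows "focA X n j k = (if j = k then 0 else of_int (NN div (k - j)) * focT X (focA X n) j k)"
proof -
  define m where "m = nat (j + k - 3)"
  have m: "j + k = int m + 3" "m + 1 \<le> n" using assms by (auto simp: m_def)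
  have "focA X n j k = focA X (Suc m) j k"
    using focA_stable[of j k "Suc m" X "n - Suc m"] m by simp
  also have "\<dots> = (if j = k then 0 else of_int (NN div (k - j)) * focT X (focA X m) j k)"
    using assms m by simp
  also have "focT X (focA X m) j k = focT X (focA X n) j k"
  proof (rule focT_cong)
    fix a b assume "a + b = j + k - 1 \<or> a + b = j + k - 2"
    then show "focA X m a b = focA X n a b"
      using focA_stable[of a b m X "n - m"] m by auto
  qed
  finally show ?thesis .
qed

lemma focA_small: "j + k \<le> 2 \<Longrightarrow> focA X n j k = (if j = 1 \<and> k = 1 then 1 else 0)"
  using focA_stable[of j k 0 X n] by simp

lemma tstep_correct:
  assumes "j - 1 \<le> m" "k = s - j"
  shows "tstep (X 0) (X 1) (X 2) (X 3) (X 4) (X 5) (X 6) (X 7) (X 8) (X 9) (X 10) (X 11) (X 12) (X 13) (NN mod q) q j k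
      (map (\<lambda>i. g i (s - 1 - i) mod q) [j - 2..m + 1]) (map (\<lambda>i. g i (s - 2 - i) mod q) [j - 3..m + 1])
    = map (\<lambda>i. focT X g i (s - i) mod q) [j..m]"
  using assms
proof (induction "nat (m + 1 - j)" arbitrary: j k)
  case 0
  \<comment> \<open>Three entries remain in the first window, one too few for the first equation of
    \<open>tstep\<close>, so the recursion stops exactly here.\<close>
  then have m: "m = j - 1" by simp
  have "[j - 2..m + 1] = [j - 2, j - 1, j]" using m by (simp add: upto_rec1)
  then show ?case using m by simp
next
  case (Suc n)
  then have jm: "j \<le> m" by simp
  have 1: "[j - 2..m + 1] = (j - 2) # (j - 1) # j # (j + 1) # [j + 2..m + 1]"
    using jm by (simp add: upto_rec1 add.commute)
  have 0: "[j - 1..m + 1] = (j - 1) # j # (j + 1) # [j + 2..m + 1]"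
    using jm by (simp add: upto_rec1 add.commute)
  have 2: "[j - 3..m + 1] = (j - 3) # (j - 2) # (j - 1) # j # (j + 1) # [j + 2..m + 1]"
    using jm by (simp add: upto_rec1 add.commute)
  have 3: "[j..m] = j # [j + 1..m]" using jm by (simp add: upto_rec1)
  have IH: "tstep (X 0) (X 1) (X 2) (X 3) (X 4) (X 5) (X 6) (X 7) (X 8) (X 9) (X 10) (X 11) (X 12) (X 13) (NN mod q) q (j + 1) (k - 1)
      (map (\<lambda>i. g i (s - 1 - i) mod q) [j - 1..m + 1]) (map (\<lambda>i. g i (s - 2 - i) mod q) [j - 2..m + 1])
    = map (\<lambda>i. focT X g i (s - i) mod q) [j + 1..m]"
    using Suc.hyps(1)[of "j + 1" "k - 1"] Suc.hyps(2) Suc.prems by simp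
  have k: "s - j = k" "s - 1 - (j - 2) = k + 1" "s - 1 - (j - 1) = k" "s - 1 - j = k - 1" "s - 1 - (j + 1) = k - 2"
    "s - 2 - (j - 3) = k + 1" "s - 2 - (j - 2) = k" "s - 2 - (j - 1) = k - 1" "s - 2 - j = k - 2"
    "s - 2 - (j + 1) = k - 3"
    using Suc.prems by auto
  have md: "[x mod q = x] (mod q)" for x by (simp add: cong_def)
  have "[(X 0 * (j - 1) - X 8 * k) * (g (j - 1) k mod q) + (X 1 * j - X 7 * (k - 1)) * (g j (k - 1) mod q)
      + X 2 * (j + 1) * (g (j + 1) (k - 2) mod q) - X 9 * (k + 1) * (g (j - 2) (k + 1) mod q)
      + NN mod q * ((X 3 * (j - 2) - X 12 * k) * (g (j - 2) k mod q) + (X 4 * (j - 1) - X 11 * (k - 1)) * (g (j - 1) (k - 1) mod q)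
      + (X 5 * j - X 10 * (k - 2)) * (g j (k - 2) mod q) + X 6 * (j + 1) * (g (j + 1) (k - 3) mod q)
      - X 13 * (k + 1) * (g (j - 3) (k + 1) mod q)) = focT X g j k] (mod q)"
    unfolding focT_def of_int_eq_id id_apply by (intro cong_add cong_diff cong_mult md cong_refl)
  then show ?case
    using IH unfolding 0 unfolding 1 2 3 list.map k
    by (simp only: tstep.simps cong_def[symmetric] list.inject)
qed

lemma gstep_correct:
  assumes "0 \<le> j" "m \<le> s" "3 \<le> s" "s \<le> 25" "k = s - j" "j \<le> m + 1"
  shows "gstep q j k (map (\<lambda>i. focT X (focA X 23) i (s - i) mod q) [j..m])
    = map (\<lambda>i. focA X 23 i (s - i) mod q) [j..m]"
  using assms
proof (induction "nat (m + 1 - j)" arbitrary: j k)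
  case 0 then show ?case by simp
next
  case (Suc n)
  then have 3: "[j..m] = j # [j + 1..m]" by (simp add: upto_rec1)
  have IH: "gstep q (j + 1) (k - 1) (map (\<lambda>i. focT X (focA X 23) i (s - i) mod q) [j + 1..m])
    = map (\<lambda>i. focA X 23 i (s - i) mod q) [j + 1..m]"
    by (rule Suc.hyps(1)) (use Suc.hyps(2) Suc.prems in auto)
  have "focA X 23 j (s - j) = (if j = k then 0 else NN div (k - j) * focT X (focA X 23) j (s - j))"
    using focA_rec[of j k 23 X] Suc.hyps(2) Suc.prems by auto
  then show ?case using IH unfolding 3 by (simp add: mod_mult_eq)
qed

lemma diag_correct:
  assumes "0 \<le> j" "j \<le> s + 1" "k = s - j"
  shows "diag j k (map f [j..s]) = (if even s \<and> 2 * j \<le> s then [f (s div 2)] else [])"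
  using assms
proof (induction "nat (s + 1 - j)" arbitrary: j k)
  case 0
  then have "j = s + 1" "0 \<le> s + 1" by simp_all
  then show ?case by auto
next
  case (Suc n)
  then have 3: "[j..s] = j # [j + 1..s]" by (simp add: upto_rec1)
  have IH: "diag (j + 1) (k - 1) (map f [j + 1..s]) = (if even s \<and> 2 * (j + 1) \<le> s then [f (s div 2)] else [])"
    by (rule Suc.hyps(1)) (use Suc.hyps(2) Suc.prems in auto)
  show ?case
  proof (cases "j = k")
    case True
    then have "s = 2 * j" using Suc.prems by simp
    then show ?thesis unfolding 3 using True by simp
  next
    case False
    have "even s \<and> 2 * (j + 1) \<le> s \<longleftrightarrow> even s \<and> 2 * j \<le> s"
      using False Suc.prems by presburger
    then show ?thesis using IH False by (simp add: 3)
  qed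
qed

lemma focrun_correct:
  assumes "3 \<le> d" "d + int n \<le> 27"
  shows "focrun X q n d (map (\<lambda>i. focA X 23 i (d - 2 - i) mod q) [0..d - 2])
      (map (\<lambda>i. focA X 23 i (d - 1 - i) mod q) [0..d - 1])
    = concat (map (\<lambda>s. if even s then [focT X (focA X 23) (s div 2) (s div 2) mod q] else []) [d..d + int n - 1])"
  using assms
proof (induction n arbitrary: d)
  case 0 then show ?case by simp
next
  case (Suc n)
  let ?r1 = "map (\<lambda>i. focA X 23 i (d - 1 - i) mod q)" and ?r2 = "map (\<lambda>i. focA X 23 i (d - 2 - i) mod q)"
  have "[- 2..d + 1] = [- 2, - 1] @ [0..d - 1] @ [d, d + 1]"
    using Suc.prems upto_split[of "-2" "-1" "d + 1"] upto_split[of 0 "d - 1" "d + 1"] by (simp add: upto_rec1)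
  then have r1: "[0, 0] @ ?r1 [0..d - 1] @ [0, 0] = ?r1 [0 - 2..d + 1]"
    by (simp add: focA_outside)
  have "[- 3..d + 1] = [- 3, - 2, - 1] @ [0..d - 2] @ [d - 1, d, d + 1]"
    using Suc.prems upto_split[of "-3" "-1" "d + 1"] upto_split[of 0 "d - 2" "d + 1"] by (simp add: upto_rec1)
  then have r2: "[0, 0, 0] @ ?r2 [0..d - 2] @ [0, 0, 0] = ?r2 [0 - 3..d + 1]"
    by (simp add: focA_outside)
  define t where "t = map (\<lambda>i. focT X (focA X 23) i (d - i) mod q) [0..d]"
  have t: "tstep (X 0) (X 1) (X 2) (X 3) (X 4) (X 5) (X 6) (X 7) (X 8) (X 9) (X 10) (X 11) (X 12) (X 13) (NN mod q) q 0 d ([0, 0] @ ?r1 [0..d - 1] @ [0, 0]) ([0, 0, 0] @ ?r2 [0..d - 2] @ [0, 0, 0]) = t"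
    unfolding r1 r2 t_def by (rule tstep_correct) (use Suc.prems in auto)
  have dg: "diag 0 d t = (if even d then [focT X (focA X 23) (d div 2) (d div 2) mod q] else [])"
    unfolding t_def using diag_correct[of 0 d d] Suc.prems by (auto elim!: evenE)
  have IH: "focrun X q n (d + 1) (?r1 [0..d - 1]) (gstep q 0 d t)
    = concat (map (\<lambda>s. if even s then [focT X (focA X 23) (s div 2) (s div 2) mod q] else []) [d + 1..d + int n])"
  \<comment> \<open>In the last round \<open>d\<close> may be 26, beyond the range of
    \<open>gstep_correct\<close>; the remaining run is then empty and the new row does not
    matter.\<close>
  proof (cases "n = 0")
    case False
    then have "gstep q 0 d t = map (\<lambda>i. focA X 23 i (d - i) mod q) [0..d]"
      unfolding t_def by (intro gstep_correct) (use Suc.prems in auto)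
    then show ?thesis using Suc.IH[of "d + 1"] Suc.prems by (simp add: diff_diff_eq add.commute)
  qed simp
  have "[d..d + int (Suc n) - 1] = d # [d + 1..d + int n]" by (simp add: upto_rec1)
  then show ?case using IH dg by (simp only: focrun.simps Let_def t) simp
qed

lemma focvals_correct: "focvals X = map (\<lambda>m. focS X m mod 1369) [1..<13]"
proof -
  have 1: "map (\<lambda>i. focA X 23 i (3 - 2 - i) mod 1369) [0..3 - 2] = [0, 0]"
    by (simp add: upto_rec1 focA_small)
  have 2: "map (\<lambda>i. focA X 23 i (3 - 1 - i) mod 1369) [0..3 - 1] = [0, 1, 0]"
    by (simp add: upto_rec1 focA_small)
  have "focvals X = concat (map (\<lambda>s. if even s then [focT X (focA X 23) (s div 2) (s div 2) mod 1369] else []) [3..26])"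
    using focrun_correct[of 3 24 X 1369] unfolding 1 2 by (simp add: focvals_def)
  also have "\<dots> = map (\<lambda>m. focS X m mod 1369) [1..<13]"
    by (simp add: upto_rec1 upt_rec focS_def)
  finally show ?thesis .
qed

definition ctr_shift :: "nat \<Rightarrow> nat \<Rightarrow> int" where
  "ctr_shift c = (\<lambda>i. [0, 0, 0, -6, 0, 0, -3, 0, -9, 0, 0, 0, 1, 0] ! i + (if i = c then 37 else 0))"

section \<open>Integer polynomial functions and Hensel lifting\<close>

inductive_set rpf :: "((nat \<Rightarrow> 'a::comm_ring_1) \<Rightarrow> 'a) set" where
  rpf_const: "(\<lambda>_. of_int c) \<in> rpf"
| rpf_var: "i < 14 \<Longrightarrow> (\<lambda>X. X i) \<in> rpf"
| rpf_add: "f \<in> rpf \<Longrightarrow> g \<in> rpf \<Longrightarrow> (\<lambda>X. f X + g X) \<in> rpf"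
| rpf_mult: "f \<in> rpf \<Longrightarrow> g \<in> rpf \<Longrightarrow> (\<lambda>X. f X * g X) \<in> rpf"

lemma rpf_diff: "f \<in> rpf \<Longrightarrow> g \<in> rpf \<Longrightarrow> (\<lambda>X. f X - g X) \<in> rpf"
  using rpf_add[OF _ rpf_mult[OF rpf_const[of "-1"]], of f g] by simp

lemma rpf_focT:
  assumes "\<And>a b. (\<lambda>X. g X a b) \<in> rpf"
  shows "(\<lambda>X. focT X (g X) j k) \<in> rpf"
  unfolding focT_def by (intro rpf_add rpf_diff rpf_mult rpf_const rpf_var assms) simp_all

lemma rpf_focA: "(\<lambda>X::nat \<Rightarrow> 'a::comm_ring_1. focA X n j k) \<in> rpf"
proof (induction n arbitrary: j k)
  case 0
  show ?case using rpf_const[of 0] rpf_const[of 1] by (cases "j = 1 \<and> k = 1") auto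
next
  case (Suc n)
  have "(\<lambda>X::nat \<Rightarrow> 'a. of_int (NN div (k - j)) * focT X (focA X n) j k) \<in> rpf"
    by (intro rpf_mult rpf_const rpf_focT Suc.IH)
  then show ?case using Suc.IH[of j k] rpf_const[of 0]
    by (cases "j \<ge> 0 \<and> k \<ge> 0 \<and> j + k = int n + 3"; cases "j = k") auto
qed

text \<open>Stated over an arbitrary commutative ring, this serves the integers, for congruences,
  and the complex numbers, for membership in \<open>pf\<close>.\<close>

lemma rpf_focS: "(\<lambda>X. focS X m) \<in> rpf"
  unfolding focS_def by (rule rpf_focT[OF rpf_focA])

lemma pf_focS: "(\<lambda>z. focS z m) \<in> pf {..<14}"
proof -
  have "f \<in> pf {..<14}" if "f \<in> rpf" for f :: cfun
    using that by (induction rule: rpf.induct) (auto intro: pf.intros)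
  then show ?thesis using rpf_focS by blast
qed

lemma focT_of_int:
  "focT (\<lambda>i. of_int (X i)) (\<lambda>a b. of_int (g a b)) j k = (of_int (focT X g j k) :: 'a::comm_ring_1)"
  unfolding focT_def by simp

lemma focA_of_int: "focA (\<lambda>i. of_int (X i)) n j k = (of_int (focA X n j k) :: 'a::comm_ring_1)"
proof (induction n arbitrary: j k)
  case (Suc n)
  have "focA (\<lambda>i. of_int (X i)) n = (\<lambda>a b. of_int (focA X n a b) :: 'a)" using Suc.IH by blast
  then show ?case using Suc.IH by (simp add: focT_of_int)
qed simp

lemma focS_of_int: "focS (\<lambda>i. of_int (X i)) m = (of_int (focS X m) :: 'a::comm_ring_1)"
proof -
  have "focA (\<lambda>i. of_int (X i)) 23 = (\<lambda>a b. of_int (focA X 23 a b) :: 'a)"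
    using focA_of_int by blast
  then show ?thesis by (simp add: focS_def focT_of_int)
qed

lemma rpf_cong:
  fixes f :: "(nat \<Rightarrow> int) \<Rightarrow> int"
  assumes "f \<in> rpf" "\<And>i. i < 14 \<Longrightarrow> [X i = Y i] (mod p)"
  shows "[f X = f Y] (mod p)"
  using assms(1) by (induction rule: rpf.induct) (auto intro: cong_add cong_mult assms(2))

text \<open>\<open>D\<close> is the gradient at \<open>a\<close> modulo \<open>p\<close>, expressed
  by the first-order Taylor expansion. The base point may be any \<open>X\<close> congruent to
  \<open>a\<close>, so one \<open>D\<close> serves all lifting steps.\<close>

definition has_gradient :: "int \<Rightarrow> (nat \<Rightarrow> int) \<Rightarrow> ((nat \<Rightarrow> int) \<Rightarrow> int) \<Rightarrow> (nat \<Rightarrow> int) \<Rightarrow> bool" where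
  "has_gradient p a f D \<longleftrightarrow> (\<forall>X h k. k \<ge> 1 \<longrightarrow> (\<forall>i<14. [X i = a i] (mod p)) \<longrightarrow>
    [f (\<lambda>i. X i + p ^ k * h i) = f X + p ^ k * (\<Sum>i<14. D i * h i)] (mod p ^ (k + 1)))"

lemma has_gradientD:
  assumes "has_gradient p a f D" "k \<ge> 1" "\<forall>i<14. [X i = a i] (mod p)"
  shows "[f (\<lambda>i. X i + p ^ k * h i) = f X + p ^ k * (\<Sum>i<14. D i * h i)] (mod p ^ (k + 1))"
  using assms unfolding has_gradient_def by blast

lemma rpf_taylor:
  fixes f :: "(nat \<Rightarrow> int) \<Rightarrow> int"
  assumes "f \<in> rpf"
  shows "\<exists>D. has_gradient p a f D"
  using assms
proof (induction rule: rpf.induct)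
  case (rpf_const c) then show ?case by (intro exI[of _ "\<lambda>_. 0"]) (simp add: has_gradient_def)
next
  case (rpf_var i)
  then have "(\<Sum>j<14. (if j = i then 1 else 0) * h j) = h i" for h :: "nat \<Rightarrow> int"
    by (simp add: if_distrib[of "\<lambda>x. x * _"] cong: if_cong)
  then show ?case by (intro exI[of _ "\<lambda>j. if j = i then 1 else 0"]) (simp add: has_gradient_def)
next
  case (rpf_add f g)
  then obtain D E where DE: "has_gradient p a f D" "has_gradient p a g E" by blast
  note D = has_gradientD[OF DE(1)] and E = has_gradientD[OF DE(2)]
  show ?case
  unfolding has_gradient_def
  proof (intro exI[of _ "\<lambda>i. D i + E i"] allI impI)
    fix X h :: "nat \<Rightarrow> int" and k :: nat assume *: "k \<ge> 1" "\<forall>i<14. [X i = a i] (mod p)"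
    have eq: "f X + g X + p ^ k * (\<Sum>i<14. (D i + E i) * h i) =
      (f X + p ^ k * (\<Sum>i<14. D i * h i)) + (g X + p ^ k * (\<Sum>i<14. E i * h i))"
      by (simp add: sum.distrib algebra_simps)
    show "[f (\<lambda>i. X i + p ^ k * h i) + g (\<lambda>i. X i + p ^ k * h i) =
      f X + g X + p ^ k * (\<Sum>i<14. (D i + E i) * h i)] (mod p ^ (k + 1))"
      unfolding eq by (rule cong_add[OF D[OF *] E[OF *]])
  qed
next
  case (rpf_mult f g)
  then obtain D E where DE: "has_gradient p a f D" "has_gradient p a g E" by blast
  note D = has_gradientD[OF DE(1)] and E = has_gradientD[OF DE(2)]
  show ?case
  unfolding has_gradient_def
  proof (intro exI[of _ "\<lambda>i. D i * g a + f a * E i"] allI impI)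
    fix X h :: "nat \<Rightarrow> int" and k :: nat assume *: "k \<ge> 1" "\<forall>i<14. [X i = a i] (mod p)"
    define A B where "A = (\<Sum>i<14. D i * h i)" and "B = (\<Sum>i<14. E i * h i)"
    have "[f a = f X] (mod p)" by (rule cong_sym, rule rpf_cong[OF rpf_mult.hyps(1)]) (use *(2) in simp)
    moreover have "[g a = g X] (mod p)" by (rule cong_sym, rule rpf_cong[OF rpf_mult.hyps(2)]) (use *(2) in simp)
    \<comment> \<open>Replacing the values at \<open>X\<close> by those at \<open>a\<close> in the
      product rule costs a multiple of \<open>p\<close>, hence of \<open>p ^ (k + 1)\<close> once
      multiplied by \<open>p ^ k\<close>.\<close>
    ultimately obtain u v where u: "f X = f a + p * u" "g X = g a + p * v"
      by (auto simp: cong_iff_lin)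
    obtain l where l: "k = Suc l" using *(1) by (cases k) auto
    have "[f (\<lambda>i. X i + p ^ k * h i) * g (\<lambda>i. X i + p ^ k * h i) = (f X + p ^ k * A) * (g X + p ^ k * B)] (mod p ^ (k + 1))"
      unfolding A_def B_def by (rule cong_mult[OF D[OF *] E[OF *]])
    also have "(f X + p ^ k * A) * (g X + p ^ k * B) =
       f X * g X + p ^ k * (A * g a + f a * B) + p ^ (k + 1) * (A * v + u * B + p ^ l * A * B)"
      by (simp add: u l algebra_simps)
    also have "[\<dots> = f X * g X + p ^ k * (A * g a + f a * B)] (mod p ^ (k + 1))"
      by (simp add: cong_iff_dvd_diff)
    also have "A * g a + f a * B = (\<Sum>i<14. (D i * g a + f a * E i) * h i)"
      by (simp add: A_def B_def sum.distrib sum_distrib_left sum_distrib_right algebra_simps)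
    finally show "[f (\<lambda>i. X i + p ^ k * h i) * g (\<lambda>i. X i + p ^ k * h i) =
      f X * g X + p ^ k * (\<Sum>i<14. (D i * g a + f a * E i) * h i)] (mod p ^ (k + 1))" .
  qed
qed

text \<open>The coordinates left over by the eleven Jacobian columns that \<open>jac_inverse\<close>
  inverts modulo 37.\<close>

definition free_coords :: "nat set" where "free_coords = {6, 12, 13}"

text \<open>Newton iteration gaining one power of \<open>p\<close> per step. The vectors
  \<open>v r\<close> form a right inverse of the Jacobian in the coordinates outside
  \<open>B\<close>, with the partial derivatives expressed by increments under a shift by
  \<open>p\<close>; corrections never touch \<open>B\<close>, where the values \<open>t\<close> are
  prescribed.\<close>

lemma hensel_lift:
  fixes f :: "nat \<Rightarrow> (nat \<Rightarrow> int) \<Rightarrow> int"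
  assumes f: "\<And>m. m < n \<Longrightarrow> f m \<in> rpf" "\<And>m. m < n \<Longrightarrow> p dvd f m a"
    and B: "B \<subseteq> {..<14}" and pp: "p \<noteq> 0"
    and v: "\<And>m r. m < n \<Longrightarrow> r < n \<Longrightarrow>
      [(\<Sum>i\<in>{..<14} - B. (f m (\<lambda>j. a j + (if j = i then p else 0)) - f m a) * v r i) = (if m = r then p else 0)] (mod p\<^sup>2)"
    and t: "\<And>i. i \<in> B \<Longrightarrow> [t i = a i] (mod p)"
  shows "\<exists>X. (\<forall>i<14. [X i = a i] (mod p)) \<and> (\<forall>i\<in>B. X i = t i) \<and> (\<forall>m<n. p ^ Suc k dvd f m X)"
proof -
  have "\<forall>m\<in>{..<n}. \<exists>D. has_gradient p a (f m) D" using rpf_taylor[OF f(1)] by blast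
  then obtain D where "\<forall>m\<in>{..<n}. has_gradient p a (f m) (D m)" by (rule bchoice[THEN exE])
  then have grad: "\<And>m. m < n \<Longrightarrow> has_gradient p a (f m) (D m)" by blast
  note D = has_gradientD[OF grad]
  \<comment> \<open>An increment is \<open>p\<close> times the partial derivative modulo the square
    of \<open>p\<close>; dividing the hypothesis by \<open>p\<close> leaves an inverse modulo
    \<open>p\<close>.\<close>
  have Dv: "[(\<Sum>i\<in>{..<14} - B. D m i * v r i) = (if m = r then 1 else 0)] (mod p)" if "m < n" "r < n" for m r
  proof -
    have "[f m (\<lambda>j. a j + (if j = i then p else 0)) - f m a = p * D m i] (mod p\<^sup>2)" if i: "i < 14" for i
    proof -
      have "(\<Sum>j<14. D m j * (if j = i then 1 else 0)) = D m i"
        using i by (simp add: if_distrib[of "\<lambda>x. _ * x"] cong: if_cong)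
      then have "[f m (\<lambda>j. a j + p ^ 1 * (if j = i then 1 else 0)) = f m a + p ^ 1 * D m i] (mod p ^ (1 + 1))"
        using D[OF \<open>m < n\<close>, of 1 a "\<lambda>j. if j = i then 1 else 0"] by simp
      moreover have "(\<lambda>j. a j + p ^ 1 * (if j = i then 1 else 0)) = (\<lambda>j. a j + (if j = i then p else 0))" by auto
      ultimately show ?thesis
        by (simp add: cong_iff_dvd_diff numeral_2_eq_2 algebra_simps)
    qed
    then have "[(\<Sum>i\<in>{..<14} - B. (f m (\<lambda>j. a j + (if j = i then p else 0)) - f m a) * v r i)
       = (\<Sum>i\<in>{..<14} - B. p * D m i * v r i)] (mod p\<^sup>2)"
      by (intro cong_sum cong_mult cong_refl) auto
    with v[OF that] have "[(\<Sum>i\<in>{..<14} - B. p * D m i * v r i) = (if m = r then p else 0)] (mod p\<^sup>2)"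
      using cong_trans cong_sym by blast
    moreover have "(\<Sum>i\<in>{..<14} - B. p * D m i * v r i) - (if m = r then p else 0)
       = p * ((\<Sum>i\<in>{..<14} - B. D m i * v r i) - (if m = r then 1 else 0))"
      by (auto simp: sum_distrib_left right_diff_distrib mult.assoc)
    ultimately have "p * p dvd p * ((\<Sum>i\<in>{..<14} - B. D m i * v r i) - (if m = r then 1 else 0))"
      unfolding cong_iff_dvd_diff power2_eq_square by simp
    then show ?thesis using pp unfolding cong_iff_dvd_diff by simp
  qed
  show ?thesis
  proof (induction k)
    case 0
    define X where "X i = (if i \<in> B then t i else a i)" for i
    have X: "\<forall>i<14. [X i = a i] (mod p)" using t by (simp add: X_def)
    have "p dvd f m X" if "m < n" for m
      using rpf_cong[OF f(1)[OF that], of X a p] X f(2)[OF that] by (auto simp: cong_dvd_iff)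
    moreover have "\<forall>i\<in>B. X i = t i" by (simp add: X_def)
    ultimately show ?case using X by (intro exI[of _ X]) auto
  next
    case (Suc k)
    then obtain X where X: "\<forall>i<14. [X i = a i] (mod p)" "\<forall>i\<in>B. X i = t i" "\<forall>m<n. p ^ Suc k dvd f m X" by blast
    define e where "e m = f m X div p ^ Suc k" for m
    have e: "f m X = p ^ Suc k * e m" if "m < n" for m using X(3) that by (simp add: e_def)
    \<comment> \<open>The Newton correction: the residuals \<open>e\<close>, multiplied by the
      inverse of the Jacobian and negated.\<close>
    define h where "h i = (if i \<in> B then 0 else - (\<Sum>r<n. e r * v r i))" for i
    define Y where "Y = (\<lambda>i. X i + p ^ Suc k * h i)"
    have "[Y i = a i] (mod p)" if "i < 14" for i
    proof -
      have "[Y i = X i] (mod p)" by (simp add: Y_def cong_iff_dvd_diff)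
      then show ?thesis using X(1) that cong_trans by blast
    qed
    moreover have "Y i = t i" if "i \<in> B" for i using that X(2) by (simp add: Y_def h_def)
    moreover have "p ^ Suc (Suc k) dvd f m Y" if m: "m < n" for m
    proof -
      have "(\<Sum>i<14. D m i * h i) = (\<Sum>i\<in>{..<14} - B. D m i * h i)"
        by (rule sum.mono_neutral_right) (auto simp: h_def)
      also have "\<dots> = (\<Sum>i\<in>{..<14} - B. - (\<Sum>r<n. e r * (D m i * v r i)))"
        by (rule sum.cong) (auto simp: h_def sum_distrib_left algebra_simps)
      also have "\<dots> = - (\<Sum>r<n. e r * (\<Sum>i\<in>{..<14} - B. D m i * v r i))"
        unfolding sum_negf sum_distrib_left by (subst sum.swap) simp
      finally have hs: "(\<Sum>i<14. D m i * h i) = - (\<Sum>r<n. e r * (\<Sum>i\<in>{..<14} - B. D m i * v r i))" .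
      have "[(\<Sum>r<n. e r * (\<Sum>i\<in>{..<14} - B. D m i * v r i)) = (\<Sum>r<n. e r * (if m = r then 1 else 0))] (mod p)"
        by (intro cong_sum cong_mult cong_refl Dv m) auto
      also have "(\<Sum>r<n. e r * (if m = r then 1 else 0)) = e m"
        using m by (simp add: if_distrib[of "\<lambda>x. _ * x"] cong: if_cong)
      finally have "p dvd e m - (\<Sum>r<n. e r * (\<Sum>i\<in>{..<14} - B. D m i * v r i))"
        by (simp add: cong_iff_dvd_diff dvd_diff_commute)
      then have "p dvd e m + (\<Sum>i<14. D m i * h i)" by (simp add: hs)
      then have "p ^ Suc k * p dvd p ^ Suc k * (e m + (\<Sum>i<14. D m i * h i))" by (intro mult_dvd_mono) auto
      then have "p ^ (Suc k + 1) dvd f m X + p ^ Suc k * (\<Sum>i<14. D m i * h i)"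
        unfolding e[OF m] by (simp add: distrib_left mult.commute mult.left_commute)
      moreover have "[f m Y = f m X + p ^ Suc k * (\<Sum>i<14. D m i * h i)] (mod p ^ (Suc k + 1))"
        unfolding Y_def by (rule D[OF m _ X(1)]) simp
      ultimately have "p ^ (Suc k + 1) dvd f m Y" by (simp add: cong_dvd_iff)
      then show ?thesis by simp
    qed
    ultimately show ?case by blast
  qed
qed

text \<open>A nonzero \<open>w\<close> extends to a basis of the complex numbers over the rationals.
  The functional makes complex cofactors rational while integer factors pass through it, and its
  normalization keeps one chosen value from being lost.\<close>

lemma rational_functional:
  assumes "(w::complex) \<noteq> 0"
  obtains \<pi> :: "complex \<Rightarrow> rat" where "\<And>x y. \<pi> (x + y) = \<pi> x + \<pi> y"
    "\<And>k x. \<pi> (of_int k * x) = of_int k * \<pi> x" "\<pi> w = 1"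
proof -
  interpret Q_C: vector_space "\<lambda>(r::rat) (x::complex). of_rat r * x"
    by standard (simp_all add: algebra_simps of_rat_add of_rat_mult)
  interpret Q_Q: vector_space "\<lambda>(r::rat) (x::rat). r * x"
    by standard (simp_all add: algebra_simps)
  interpret Q_CQ: vector_space_pair "\<lambda>(r::rat) (x::complex). of_rat r * x" "\<lambda>(r::rat) (x::rat). r * x"
    by standard
  have "Q_C.independent {w}" using assms by (simp only: Q_C.dependent_single not_False_eq_True)
  then obtain \<pi> where \<pi>: "Vector_Spaces.linear (\<lambda>(r::rat) (x::complex). of_rat r * x) (\<lambda>(r::rat) (x::rat). r * x) \<pi>"
    "\<forall>x\<in>{w}. \<pi> x = 1"
    using Q_CQ.linear_independent_extend[of "{w}" "\<lambda>_. 1"] by blast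
  interpret l: Vector_Spaces.linear "\<lambda>(r::rat) (x::complex). of_rat r * x" "\<lambda>(r::rat) (x::rat). r * x" \<pi>
    by (rule \<pi>(1))
  show ?thesis
  proof (rule that[of \<pi>])
    show "\<pi> (x + y) = \<pi> x + \<pi> y" for x y by (rule l.add)
    show "\<pi> (of_int k * x) = of_int k * \<pi> x" for k x using l.scale[of "of_int k" x] by simp
    show "\<pi> w = 1" using \<pi>(2) by simp
  qed
qed

text \<open>At an integer point \<open>f\<close> is an integral combination of its finitely many
  coefficients. A common denominator of their rational images therefore works at all integer
  points.\<close>

lemma pf_bounded_denominators:
  fixes \<pi> :: "complex \<Rightarrow> rat"
  assumes \<pi>: "\<And>x y. \<pi> (x + y) = \<pi> x + \<pi> y" "\<And>k x. \<pi> (of_int k * x) = of_int k * \<pi> x"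
    and f: "f \<in> pf V"
  shows "\<exists>D>0. \<forall>X. \<exists>a. of_int D * \<pi> (f (\<lambda>i. of_int (X i))) = of_int a"
proof -
  obtain d c where f: "f = (\<lambda>z. \<Sum>i<d. c i * prod_list (map z (from_nat i :: nat list)))"
    using pf_countable_span[OF f] by blast
  have "\<exists>D>0. \<forall>X. \<exists>a. of_int D * \<pi> (\<Sum>i<d. c i * prod_list (map (\<lambda>i. of_int (X i)) (from_nat i :: nat list))) = of_int a"
  proof (induction d)
    case 0
    have "\<pi> 0 = 0" using \<pi>(1)[of 0 0] by simp
    then show ?case by (intro exI[of _ 1]) (auto intro: exI[of _ 0])
  next
    case (Suc d)
    then obtain D where D: "D > 0"
      "\<And>X. \<exists>a. of_int D * \<pi> (\<Sum>i<d. c i * prod_list (map (\<lambda>i. of_int (X i)) (from_nat i :: nat list))) = of_int a" by blast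
    obtain p q where pq: "quotient_of (\<pi> (c d)) = (p, q)" by force
    then have q: "q > 0" "\<pi> (c d) = of_int p / of_int q"
      by (simp_all add: quotient_of_denom_pos quotient_of_div)
    show ?case
    proof (rule exI[of _ "D * q"], intro conjI allI)
      show "D * q > 0" using D(1) q(1) by simp
      fix X :: "nat \<Rightarrow> int"
      obtain a where a: "of_int D * \<pi> (\<Sum>i<d. c i * prod_list (map (\<lambda>i. of_int (X i)) (from_nat i :: nat list))) = of_int a"
        using D(2) by blast
      define m where "m = prod_list (map X (from_nat d :: nat list))"
      have "prod_list (map (\<lambda>i. of_int (X i)) l) = (of_int (prod_list (map X l)) :: complex)" for l :: "nat list"
        by (induction l) auto
      then have last: "\<pi> (c d * prod_list (map (\<lambda>i. of_int (X i)) (from_nat d :: nat list))) = of_int m * \<pi> (c d)"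
        using \<pi>(2)[of m "c d"] by (simp add: m_def mult.commute)
      have qc: "of_int q * \<pi> (c d) = of_int p" using q by simp
      have alg: "of_int (D * q) * (u + of_int m * w) = of_int q * (of_int D * u) + of_int (D * m) * (of_int q * w)"
        for u w :: rat by (simp add: algebra_simps)
      have "of_int (D * q) * \<pi> (\<Sum>i<Suc d. c i * prod_list (map (\<lambda>i. of_int (X i)) (from_nat i :: nat list)))
        = of_int q * (of_int D * \<pi> (\<Sum>i<d. c i * prod_list (map (\<lambda>i. of_int (X i)) (from_nat i :: nat list))))
          + of_int (D * m) * (of_int q * \<pi> (c d))"
        by (simp only: sum.lessThan_Suc \<pi>(1) last alg)
      also have "\<dots> = of_int (q * a + D * m * p)" unfolding a qc by simp
      finally have "of_int (D * q) * \<pi> (\<Sum>i<Suc d. c i * prod_list (map (\<lambda>i. of_int (X i)) (from_nat i :: nat list)))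
        = of_int (q * a + D * m * p)" .
      then show "\<exists>a. of_int (D * q) * \<pi> (\<Sum>i<Suc d. c i * prod_list (map (\<lambda>i. of_int (X i)) (from_nat i :: nat list))) = of_int a"
        by blast
    qed
  qed
  then show ?thesis unfolding f .
qed

text \<open>One variable at a time: each residue class modulo \<open>p\<close> is infinite, so it is
  not contained in the roots of a nonzero univariate polynomial.\<close>

lemma pf_nonzero_at_integers:
  assumes "finite B" "f \<in> pf B" "f \<noteq> (\<lambda>_. 0)" "p \<noteq> 0"
  shows "\<exists>t. (\<forall>i. [t i = a i] (mod p)) \<and> f (\<lambda>i. of_int (t i :: int)) \<noteq> 0"
  using assms
proof (induction B arbitrary: f rule: finite_induct)
  case empty
  have "f = (\<lambda>_. f (\<lambda>i. of_int (a i)))" using pf_empty_const[OF empty(1)] .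
  then have "f (\<lambda>i. of_int (a i)) \<noteq> 0" using empty(2) by (auto dest: fun_cong)
  then show ?case by (intro exI[of _ a]) simp
next
  case (insert j B)
  obtain c M where c: "\<And>i. c i \<in> pf B" "f = (\<lambda>z. \<Sum>i\<le>(M::nat). c i z * z j ^ i)"
    using pf_insert_expand[OF insert.prems(1)] by blast
  have "\<exists>k\<le>M. c k \<noteq> (\<lambda>_. 0)"
  proof (rule ccontr)
    assume "\<not> ?thesis"
    then have "f = (\<lambda>_. 0)" unfolding c(2) by (intro ext sum.neutral) auto
    then show False using insert.prems(2) by blast
  qed
  then obtain k where k: "k \<le> M" "c k \<noteq> (\<lambda>_. 0)" by blast
  then obtain t where t: "\<forall>i. [t i = a i] (mod p)" "c k (\<lambda>i. of_int (t i)) \<noteq> 0"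
    using insert.IH[OF c(1) _ insert.prems(3)] by blast
  define P where "P = (\<Sum>i\<le>M. monom (c i (\<lambda>i. of_int (t i))) i)"
  have "coeff P k \<noteq> 0" using t(2) k(1) by (simp add: P_def coeff_sum)
  then have "P \<noteq> 0" by auto
  have "inj (\<lambda>s::int. of_int (a j + p * s) :: complex)"
  proof (rule injI)
    fix x y assume "complex_of_int (a j + p * x) = of_int (a j + p * y)"
    then have "a j + p * x = a j + p * y" by (simp only: of_int_eq_iff)
    then show "x = y" using insert.prems(3) by simp
  qed
  then have "infinite (range (\<lambda>s::int. of_int (a j + p * s) :: complex))"
    using finite_imageD infinite_UNIV_int by blast
  then have "\<not> range (\<lambda>s::int. of_int (a j + p * s) :: complex) \<subseteq> {x. poly P x = 0}"
    using poly_roots_finite[OF \<open>P \<noteq> 0\<close>] finite_subset by blast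
  then obtain s where s: "poly P (of_int (a j + p * s)) \<noteq> 0" by blast
  define t' where "t' = t(j := a j + p * s)"
  have "c i (\<lambda>i. of_int (t' i)) = c i (\<lambda>i. of_int (t i))" for i
    by (rule pf_depends[OF c(1)]) (use insert.hyps(2) in \<open>auto simp: t'_def\<close>)
  then have "f (\<lambda>i. of_int (t' i)) = poly P (of_int (a j + p * s))"
    by (simp add: c(2) P_def poly_sum poly_monom) (simp add: t'_def)
  then show ?case using s t(1)
    by (intro exI[of _ t']) (auto simp: t'_def cong_iff_dvd_diff)
qed

text \<open>Evaluated at an approximate solution \<open>X\<close>, the right side is divisible by a
  high power of \<open>p\<close> up to a fixed denominator \<open>E\<close>. On the left
  \<open>g X\<close> is prime to \<open>p\<close>, and the value of \<open>q\<close> depends on the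
  prescribed coordinates alone, where the functional is normalized to 1.\<close>

lemma padic_avoid:
  fixes f :: "nat \<Rightarrow> (nat \<Rightarrow> int) \<Rightarrow> int" and F :: "nat \<Rightarrow> cfun" and g :: "(nat \<Rightarrow> int) \<Rightarrow> int"
  assumes F: "\<And>m X. m < n \<Longrightarrow> F m (\<lambda>i. of_int (X i)) = of_int (f m X)"
    and G: "\<And>X. G (\<lambda>i. of_int (X i)) = of_int (g X)"
    and p: "prime p" "p = int p'"
    and B: "finite B" and h: "\<And>m. m < n \<Longrightarrow> h m \<in> pf V" and q: "q \<in> pf B" "q \<noteq> (\<lambda>_. 0)"
    and sol: "\<And>t k. (\<And>i. [t i = a i] (mod p)) \<Longrightarrow> \<exists>X. (\<forall>i\<in>B. X i = t i) \<and> (\<forall>m<n. p ^ Suc k dvd f m X) \<and> \<not> p dvd g X"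
  shows "(\<lambda>z. G z ^ N * q z) \<noteq> (\<lambda>z. \<Sum>m<n. h m z * F m z)"
proof
  assume eq: "(\<lambda>z. G z ^ N * q z) = (\<lambda>z. \<Sum>m<n. h m z * F m z)"
  have "p \<noteq> 0" "p > 1" using p(1) prime_gt_1_int by auto
  obtain t where t: "\<And>i. [t i = a i] (mod p)" "q (\<lambda>i. of_int (t i)) \<noteq> 0"
    using pf_nonzero_at_integers[OF B q \<open>p \<noteq> 0\<close>, of a] by blast
  obtain \<pi> where \<pi>: "\<And>x y. \<pi> (x + y) = \<pi> x + \<pi> y" "\<And>k x. \<pi> (of_int k * x) = of_int k * \<pi> x"
    "\<pi> (q (\<lambda>i. of_int (t i))) = (1::rat)" using rational_functional[OF t(2)] by blast
  have \<pi>0: "\<pi> 0 = 0" using \<pi>(1)[of 0 0] by simp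
  have \<pi>sum: "\<pi> (\<Sum>m\<in>A. u m) = (\<Sum>m\<in>A. \<pi> (u m))" for A and u :: "nat \<Rightarrow> complex"
    by (induction A rule: infinite_finite_induct) (simp_all add: \<pi>(1) \<pi>0)
  have "\<forall>m<n. \<exists>D>0. \<forall>X. \<exists>a. of_int D * \<pi> (h m (\<lambda>i. of_int (X i))) = of_int a"
    using pf_bounded_denominators[OF \<pi>(1,2) h] by blast
  then obtain D where D: "\<And>m. m < n \<Longrightarrow> D m > 0"
    "\<And>m X. m < n \<Longrightarrow> \<exists>a. of_int (D m) * \<pi> (h m (\<lambda>i. of_int (X i))) = of_int a"
    by metis
  define E where "E = (\<Prod>m<n. D m)"
  have "E > 0" unfolding E_def by (intro prod_pos) (use D in auto)
  \<comment> \<open>The denominator \<open>E\<close> is fixed before \<open>X\<close> is chosen, and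
    \<open>p ^ Suc k\<close> with \<open>k = E\<close> already exceeds it.\<close>
  define k where "k = nat E"
  obtain X where X: "\<forall>i\<in>B. X i = t i" "\<forall>m<n. p ^ Suc k dvd f m X" "\<not> p dvd g X"
    using sol[OF t(1)] by blast
  have EX: "\<exists>b. of_int E * \<pi> (h m (\<lambda>i. of_int (X i))) = of_int b" if m: "m < n" for m
  proof -
    obtain b where b: "of_int (D m) * \<pi> (h m (\<lambda>i. of_int (X i))) = of_int b" using D(2)[OF m] by blast
    have "E = D m * (\<Prod>m\<in>{..<n} - {m}. D m)" unfolding E_def using m by (intro prod.remove) auto
    then have "of_int E * \<pi> (h m (\<lambda>i. of_int (X i))) = of_int ((\<Prod>m\<in>{..<n} - {m}. D m) * b)"
      using b by (simp add: mult.commute mult.left_commute)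
    then show ?thesis by blast
  qed
  then obtain b where b: "\<And>m. m < n \<Longrightarrow> of_int E * \<pi> (h m (\<lambda>i. of_int (X i))) = of_int (b m)" by metis
  have "q (\<lambda>i. of_int (X i)) = q (\<lambda>i. of_int (t i))" by (rule pf_depends[OF q(1)]) (use X in auto)
  then have "of_int (g X ^ N) * q (\<lambda>i. of_int (t i)) = (\<Sum>m<n. of_int (f m X) * h m (\<lambda>i. of_int (X i)))"
    using fun_cong[OF eq, of "\<lambda>i. of_int (X i)"] by (simp add: F G mult.commute)
  then have "\<pi> (of_int (g X ^ N) * q (\<lambda>i. of_int (t i))) = \<pi> (\<Sum>m<n. of_int (f m X) * h m (\<lambda>i. of_int (X i)))"
    by (rule arg_cong)
  then have "of_int (g X ^ N) = (\<Sum>m<n. of_int (f m X) * \<pi> (h m (\<lambda>i. of_int (X i))))"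
    unfolding \<pi>sum \<pi>(2) by (simp add: \<pi>(3))
  then have "of_int (E * g X ^ N) = (\<Sum>m<n. of_int (f m X) * (of_int E * \<pi> (h m (\<lambda>i. of_int (X i)))))"
    by (simp add: sum_distrib_left mult_ac)
  also have "\<dots> = (\<Sum>m<n. of_int (f m X * b m))" by (rule sum.cong) (simp_all add: b)
  finally have "rat_of_int (E * g X ^ N) = of_int (\<Sum>m<n. f m X * b m)" by simp
  then have "E * g X ^ N = (\<Sum>m<n. f m X * b m)" by (simp only: of_int_eq_iff)
  moreover have "p ^ Suc k dvd (\<Sum>m<n. f m X * b m)" using X(2) by (intro dvd_sum) auto
  moreover have "coprime (p ^ Suc k) (g X ^ N)" using X(3) p(1) by (simp add: prime_imp_coprime)
  ultimately have "p ^ Suc k dvd E" by (metis coprime_dvd_mult_left_iff)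
  then have "p ^ Suc k \<le> E" using \<open>E > 0\<close> zdvd_imp_le by blast
  moreover have "int (Suc k) < p ^ Suc k"
  proof -
    have "p' > 1" using \<open>p > 1\<close> p(2) by simp
    then have "Suc k < p' ^ Suc k" by (intro power_gt_expt) simp
    then show ?thesis unfolding p(2) by (simp only: of_nat_power[symmetric] of_nat_less_iff)
  qed
  ultimately show False using \<open>E > 0\<close> by (simp add: k_def)
qed

section \<open>Evaluation at the centre and at its shifts\<close>

lemma focvals_ctr: "focvals ctr = [0, 0, 1036, 0, 0, 1073, 0, 0, 296, 0, 0, 241]"
  by code_simp

lemma focvals_ctr_shift_0: "focvals (ctr_shift 0) = [0, 0, 703, 0, 0, 111, 0, 0, 592, 0, 0, 1351]"
  by code_simp

lemma focvals_ctr_shift_1: "focvals (ctr_shift 1) = [0, 0, 1036, 1110, 0, 1073, 518, 0, 296, 962, 0, 241]"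
  by code_simp

lemma focvals_ctr_shift_2: "focvals (ctr_shift 2) = [0, 74, 1036, 0, 74, 1073, 0, 1221, 296, 0, 666, 241]"
  by code_simp

lemma focvals_ctr_shift_3: "focvals (ctr_shift 3) = [0, 0, 1332, 0, 0, 740, 0, 0, 407, 0, 0, 204]"
  by code_simp

lemma focvals_ctr_shift_4: "focvals (ctr_shift 4) = [333, 0, 1036, 0, 0, 1073, 185, 0, 296, 703, 0, 241]"
  by code_simp

lemma focvals_ctr_shift_5: "focvals (ctr_shift 5) = [0, 296, 1036, 0, 296, 1073, 0, 888, 296, 0, 962, 241]"
  by code_simp

lemma focvals_ctr_shift_7: "focvals (ctr_shift 7) = [1110, 0, 1036, 851, 0, 1073, 407, 0, 296, 296, 0, 241]"
  by code_simp

lemma focvals_ctr_shift_8: "focvals (ctr_shift 8) = [0, 0, 851, 0, 0, 148, 0, 0, 481, 0, 0, 500]"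
  by code_simp

lemma focvals_ctr_shift_9: "focvals (ctr_shift 9) = [0, 925, 1036, 0, 962, 1073, 0, 925, 296, 0, 555, 241]"
  by code_simp

lemma focvals_ctr_shift_10: "focvals (ctr_shift 10) = [0, 1184, 1036, 0, 1073, 1073, 0, 666, 296, 0, 259, 241]"
  by code_simp

lemma focvals_ctr_shift_11: "focvals (ctr_shift 11) = [1036, 0, 1036, 1184, 0, 1073, 1147, 0, 296, 74, 0, 241]"
  by code_simp

text \<open>The nonzero entries 1036, 1073 and 296 are 28, 29 and 8 times 37, whereas 241 is 19
  modulo 37. So \<open>ctr\<close> solves the eleven equations modulo 37 but not modulo
  \<open>37^2\<close>.\<close>

definition base_vals :: "int list" where
  "base_vals = [0, 0, 1036, 0, 0, 1073, 0, 0, 296, 0, 0, 241]"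

text \<open>Row \<open>i\<close> belongs to coordinate \<open>i\<close>. The rows 6, 12 and 13 of
  the free coordinates are filled with the unshifted values, merely to keep the numbering.\<close>

definition shift_vals :: "int list list" where
  "shift_vals = [[0, 0, 703, 0, 0, 111, 0, 0, 592, 0, 0, 1351],
    [0, 0, 1036, 1110, 0, 1073, 518, 0, 296, 962, 0, 241],
    [0, 74, 1036, 0, 74, 1073, 0, 1221, 296, 0, 666, 241],
    [0, 0, 1332, 0, 0, 740, 0, 0, 407, 0, 0, 204],
    [333, 0, 1036, 0, 0, 1073, 185, 0, 296, 703, 0, 241],
    [0, 296, 1036, 0, 296, 1073, 0, 888, 296, 0, 962, 241],
    [0, 0, 1036, 0, 0, 1073, 0, 0, 296, 0, 0, 241],
    [1110, 0, 1036, 851, 0, 1073, 407, 0, 296, 296, 0, 241],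
    [0, 0, 851, 0, 0, 148, 0, 0, 481, 0, 0, 500],
    [0, 925, 1036, 0, 962, 1073, 0, 925, 296, 0, 555, 241],
    [0, 1184, 1036, 0, 1073, 1073, 0, 666, 296, 0, 259, 241],
    [1036, 0, 1036, 1184, 0, 1073, 1147, 0, 296, 74, 0, 241],
    [0, 0, 1036, 0, 0, 1073, 0, 0, 296, 0, 0, 241],
    [0, 0, 1036, 0, 0, 1073, 0, 0, 296, 0, 0, 241]]"

text \<open>Row \<open>r\<close> is the vector \<open>v r\<close> of \<open>hensel_lift\<close>. It
  is supported on the coordinates 0, 3, 8 or 1, 4, 7, 11 or 2, 5, 9, 10, according to the class of
  \<open>r + 1\<close> modulo 3, reflecting the block structure of the Jacobian.\<close>

definition jac_inverse :: "int list list" where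
  "jac_inverse = [[0, 6, 0, 0, 22, 0, 0, 33, 0, 0, 0, 25, 0, 0],
    [0, 0, 29, 0, 0, 4, 0, 0, 0, 10, 16, 0, 0, 0],
    [18, 0, 0, 32, 0, 0, 0, 0, 26, 0, 0, 0, 0, 0],
    [0, 27, 0, 0, 9, 0, 0, 4, 0, 0, 0, 10, 0, 0],
    [0, 0, 7, 0, 0, 36, 0, 0, 0, 15, 17, 0, 0, 0],
    [4, 0, 0, 34, 0, 0, 0, 0, 25, 0, 0, 0, 0, 0],
    [0, 20, 0, 0, 13, 0, 0, 9, 0, 0, 0, 6, 0, 0],
    [0, 0, 16, 0, 0, 35, 0, 0, 0, 12, 4, 0, 0, 0],
    [1, 0, 0, 17, 0, 0, 0, 0, 18, 0, 0, 0, 0, 0],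
    [0, 25, 0, 0, 31, 0, 0, 19, 0, 0, 0, 8, 0, 0],
    [0, 0, 14, 0, 0, 28, 0, 0, 0, 4, 26, 0, 0, 0]]"

lemma jac_inverse_correct:
  "list_all (\<lambda>m. list_all (\<lambda>r.
     ((\<Sum>i\<leftarrow>[0, 1, 2, 3, 4, 5, 7, 8, 9, 10, 11]. (shift_vals ! i ! m - base_vals ! m) * jac_inverse ! r ! i)
       - (if m = r then 37 else 0)) mod 1369 = 0) [0..<11]) [0..<11]"
  by code_simp

lemma focS_cong_focvals: "m < 12 \<Longrightarrow> [focS X (Suc m) = focvals X ! m] (mod 1369)"
  unfolding focvals_correct by (simp add: cong_def)

lemma focvals_shift:
  assumes "i \<in> {0, 1, 2, 3, 4, 5, 7, 8, 9, 10, 11}"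
  shows "focvals (ctr_shift i) = shift_vals ! i"
  using assms
  by (elim insertE emptyE)
    (simp_all add: shift_vals_def focvals_ctr_shift_0 focvals_ctr_shift_1 focvals_ctr_shift_2
      focvals_ctr_shift_3 focvals_ctr_shift_4 focvals_ctr_shift_5 focvals_ctr_shift_7
      focvals_ctr_shift_8 focvals_ctr_shift_9 focvals_ctr_shift_10 focvals_ctr_shift_11
      flip: One_nat_def)

lemma coords_minus_free: "{..<14} - free_coords = {0, 1, 2, 3, 4, 5, 7, 8, 9, 10, 11::nat}"
  by (auto simp: free_coords_def) presburger

lemma jacobian_cong:
  assumes "m < 11" "r < 11"
  shows "[(\<Sum>i\<in>{..<14} - free_coords. (focS (\<lambda>j. ctr j + (if j = i then 37 else 0)) (Suc m) - focS ctr (Suc m)) * jac_inverse ! r ! i)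
    = (if m = r then 37 else 0)] (mod 37\<^sup>2)"
proof -
  have shift: "(\<lambda>j. ctr j + (if j = i then 37 else 0)) = ctr_shift i" for i
    by (simp add: ctr_def ctr_shift_def)
  have c1: "[(\<Sum>i\<in>{..<14} - free_coords. (focS (ctr_shift i) (Suc m) - focS ctr (Suc m)) * jac_inverse ! r ! i)
    = (\<Sum>i\<in>{..<14} - free_coords. (shift_vals ! i ! m - base_vals ! m) * jac_inverse ! r ! i)] (mod 1369)"
  proof (intro cong_sum cong_mult cong_diff cong_refl)
    fix i assume "i \<in> {..<14} - free_coords"
    then show "[focS (ctr_shift i) (Suc m) = shift_vals ! i ! m] (mod 1369)"
      using focS_cong_focvals[of m "ctr_shift i"] focvals_shift[of i] assms(1)
      unfolding coords_minus_free by simp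
    show "[focS ctr (Suc m) = base_vals ! m] (mod 1369)"
      using focS_cong_focvals[of m ctr] assms(1) by (simp add: focvals_ctr base_vals_def)
  qed
  have s1: "(\<Sum>i\<in>{..<14} - free_coords. (shift_vals ! i ! m - base_vals ! m) * jac_inverse ! r ! i)
     = (\<Sum>i\<leftarrow>[0, 1, 2, 3, 4, 5, 7, 8, 9, 10, 11]. (shift_vals ! i ! m - base_vals ! m) * jac_inverse ! r ! i)"
    unfolding coords_minus_free by simp
  have c2: "[(\<Sum>i\<leftarrow>[0, 1, 2, 3, 4, 5, 7, 8, 9, 10, 11]. (shift_vals ! i ! m - base_vals ! m) * jac_inverse ! r ! i)
    = (if m = r then 37 else 0)] (mod 1369)"
    using jac_inverse_correct assms unfolding list_all_iff cong_iff_dvd_diff dvd_eq_mod_eq_0 by simp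
  have "(37::int)\<^sup>2 = 1369" by simp
  then show ?thesis unfolding shift using cong_trans[OF c1[unfolded s1] c2] by (simp only:)
qed

section \<open>The ideal of the first eleven focal polynomials and a prime above it\<close>

definition focal_ideal :: "cfun set" where
  "focal_ideal = {(\<lambda>z. \<Sum>m<11. h m z * focS z (Suc m)) | h. \<forall>m. h m \<in> pf {..<14}}"

lemma focal_idealI: "(\<And>m. h m \<in> pf {..<14}) \<Longrightarrow> (\<lambda>z. \<Sum>m<11. h m z * focS z (Suc m)) \<in> focal_ideal"
  by (auto simp: focal_ideal_def)

lemma focal_idealE:
  assumes "f \<in> focal_ideal"
  obtains h where "\<And>m. h m \<in> pf {..<14}" "f = (\<lambda>z. \<Sum>m<11. h m z * focS z (Suc m))"
  using assms by (auto simp: focal_ideal_def)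

lemma pf_ideal_focal_ideal: "pf_ideal {..<14} focal_ideal"
  unfolding pf_ideal_def
proof (intro conjI ballI subsetI)
  show "f \<in> pf {..<14}" if "f \<in> focal_ideal" for f
    using that by (elim focal_idealE) (auto intro!: pf_sum pf_mult pf_focS)
  show "(\<lambda>_. 0) \<in> focal_ideal"
    using focal_idealI[of "\<lambda>_ _. 0"] by (simp add: pf_const)
next
  fix f g assume fg: "f \<in> focal_ideal" "g \<in> focal_ideal"
  obtain h where h: "\<And>m. h m \<in> pf {..<14}" "f = (\<lambda>z. \<Sum>m<11. h m z * focS z (Suc m))"
    by (rule focal_idealE[OF fg(1)]) (rule that)
  obtain k where k: "\<And>m. k m \<in> pf {..<14}" "g = (\<lambda>z. \<Sum>m<11. k m z * focS z (Suc m))"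
    by (rule focal_idealE[OF fg(2)]) (rule that)
  have "(\<lambda>z. f z + g z) = (\<lambda>z. \<Sum>m<11. (h m z + k m z) * focS z (Suc m))"
    unfolding h(2) k(2) by (simp add: sum.distrib distrib_right)
  then show "(\<lambda>z. f z + g z) \<in> focal_ideal"
    using focal_idealI[of "\<lambda>m z. h m z + k m z"] pf_add[OF h(1) k(1)] by simp
next
  fix r f assume r: "r \<in> pf {..<14}" and f: "f \<in> focal_ideal"
  obtain h where h: "\<And>m. h m \<in> pf {..<14}" "f = (\<lambda>z. \<Sum>m<11. h m z * focS z (Suc m))"
    by (rule focal_idealE[OF f]) (rule that)
  have "(\<lambda>z. r z * f z) = (\<lambda>z. \<Sum>m<11. (r z * h m z) * focS z (Suc m))"
    unfolding h(2) by (simp add: sum_distrib_left mult.assoc)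
  then show "(\<lambda>z. r z * f z) \<in> focal_ideal"
    using focal_idealI[of "\<lambda>m z. r z * h m z"] pf_mult[OF r h(1)] by simp
qed

lemma focS_in_focal_ideal:
  assumes "m < 11" shows "(\<lambda>z. focS z (Suc m)) \<in> focal_ideal"
proof -
  have "(\<Sum>k<11. (if k = m then 1 else 0) * focS z (Suc k)) = focS z (Suc m)" for z :: "nat \<Rightarrow> complex"
    using assms by (simp add: if_distrib[of "\<lambda>x. x * _"] cong: if_cong)
  then show ?thesis using focal_idealI[of "\<lambda>k _. if k = m then 1 else 0"] by (simp add: pf_const)
qed

lemma focS_ctr_cong: "m < 12 \<Longrightarrow> [focS ctr (Suc m) = base_vals ! m] (mod 37)"
proof -
  assume "m < 12"
  from focS_cong_focvals[OF this, of ctr] have "[focS ctr (Suc m) = base_vals ! m] (mod 1369)"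
    by (simp only: focvals_ctr base_vals_def)
  then show ?thesis by (rule cong_dvd_modulus) simp
qed

lemma focS_ctr_dvd: "m < 11 \<Longrightarrow> 37 dvd focS ctr (Suc m)"
proof -
  assume m: "m < 11"
  have "list_all (\<lambda>x. 37 dvd x) (take 11 base_vals)" "length base_vals = 12"
    by (simp_all add: base_vals_def)
  then have "37 dvd base_vals ! m" using m by (auto simp: list_all_length)
  moreover have "[focS ctr (Suc m) = base_vals ! m] (mod 37)" using m by (intro focS_ctr_cong) simp
  ultimately show ?thesis by (simp only: cong_dvd_iff)
qed

lemma focS_12_ctr: "\<not> 37 dvd focS ctr 12"
proof -
  have "[focS ctr (Suc 11) = base_vals ! 11] (mod 37)" by (rule focS_ctr_cong) simp
  moreover have "base_vals ! 11 = 241" by (simp add: base_vals_def)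
  ultimately have "[focS ctr 12 = 241] (mod 37)" by simp
  then show ?thesis by (simp add: cong_dvd_iff)
qed

text \<open>The point where arithmetic enters: a common element would be an identity excluded by
  \<open>padic_avoid\<close>, with Hensel lifting as the supply of approximate solutions. They are
  congruent to \<open>ctr\<close> modulo 37, hence the twelfth value remains prime to 37.\<close>

lemma focal_ideal_avoid: "focal_ideal \<inter> pf_avoid (\<lambda>z. focS z 12) free_coords = {}"
proof (rule ccontr)
  assume "\<not> ?thesis"
  then obtain s where s: "s \<in> focal_ideal" "s \<in> pf_avoid (\<lambda>z. focS z 12) free_coords" by blast
  obtain h where h: "\<And>m. h m \<in> pf {..<14}" and eq1: "s = (\<lambda>z. \<Sum>m<11. h m z * focS z (Suc m))"
    by (rule focal_idealE[OF s(1)]) (rule that)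
  obtain N q where q: "q \<in> pf free_coords" "q \<noteq> (\<lambda>_. 0)" and eq2: "s = (\<lambda>z. focS z 12 ^ N * q z)"
    using s(2) by (auto simp: pf_avoid_def)
  have "(\<lambda>z. focS z 12 ^ N * q z) \<noteq> (\<lambda>z. \<Sum>m<11. h m z * focS z (Suc m))"
  proof (rule padic_avoid[where f = "\<lambda>m X. focS X (Suc m)" and g = "\<lambda>X. focS X 12" and p = 37 and p' = 37
        and a = ctr and B = free_coords and V = "{..<14}"])
    fix t :: "nat \<Rightarrow> int" and k :: nat assume t: "\<And>i. [t i = ctr i] (mod 37)"
    have "\<exists>X. (\<forall>i<14. [X i = ctr i] (mod 37)) \<and> (\<forall>i\<in>free_coords. X i = t i) \<and>
        (\<forall>m<11. 37 ^ Suc k dvd focS X (Suc m))"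
    proof (rule hensel_lift[where v = "\<lambda>r i. jac_inverse ! r ! i" and f = "\<lambda>m X. focS X (Suc m)"])
      show "free_coords \<subseteq> {..<14}" by (simp add: free_coords_def)
      show "[t i = ctr i] (mod 37)" for i by (rule t)
    qed (rule rpf_focS focS_ctr_dvd jacobian_cong | assumption | simp)+
    then obtain X where X: "\<forall>i<14. [X i = ctr i] (mod 37)" "\<forall>i\<in>free_coords. X i = t i"
      "\<forall>m<11. 37 ^ Suc k dvd focS X (Suc m)" by blast
    moreover have "\<not> 37 dvd focS X 12"
      using rpf_cong[OF rpf_focS[of 12], of X ctr 37] X(1) focS_12_ctr by (simp add: cong_dvd_iff)
    ultimately show "\<exists>X. (\<forall>i\<in>free_coords. X i = t i) \<and> (\<forall>m<11. 37 ^ Suc k dvd focS X (Suc m)) \<and> \<not> 37 dvd focS X 12"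
      by blast
  qed (use h q in \<open>auto simp: focS_of_int free_coords_def\<close>)
  then show False using eq1 eq2 by simp
qed

theorem focal_prime_exists:
  obtains P where "pf_prime {..<14} P" "\<And>m. m < 11 \<Longrightarrow> (\<lambda>z. focS z (Suc m)) \<in> P"
    "(\<lambda>z. focS z 12) \<notin> P" "pf_indep P free_coords"
    "\<And>j. j \<in> {..<14} - free_coords \<Longrightarrow> \<not> pf_indep P (insert j free_coords)"
proof -
  let ?g = "\<lambda>z::nat \<Rightarrow> complex. focS z 12"
  have B: "free_coords \<subseteq> {..<14}" by (auto simp: free_coords_def)
  note props = pf_avoid_props[OF pf_focS[of 12] B]
  obtain P where P: "focal_ideal \<subseteq> P" "pf_prime {..<14} P" "P \<inter> pf_avoid ?g free_coords = {}"
    and maxi: "\<And>r. r \<in> pf {..<14} \<Longrightarrow> r \<notin> P \<Longrightarrow>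
      \<exists>u\<in>pf {..<14}. \<exists>s\<in>pf_avoid ?g free_coords. (\<lambda>z. s z - u z * r z) \<in> P"
    using pf_prime_avoiding[OF pf_ideal_focal_ideal focal_ideal_avoid props(1,2,3)] by blast
  show ?thesis
  proof (rule that[OF P(2)])
    show "(\<lambda>z. focS z (Suc m)) \<in> P" if "m < 11" for m using focS_in_focal_ideal[OF that] P(1) by blast
    show "?g \<notin> P" using props(4) P(3) by blast
    show "pf_indep P free_coords" using props(5) P(3) unfolding pf_indep_def by blast
    show "\<not> pf_indep P (insert j free_coords)" if "j \<in> {..<14} - free_coords" for j
      using pf_maximal_dependent[OF P(2,3) pf_focS B _ _ maxi] that by blast
  qed
qed

section \<open>Focal values\<close>

text \<open>The filtration by total degree. Membership of \<open>F - G\<close> in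
  \<open>ord_ge n\<close> serves throughout as congruence of series in all degrees below
  \<open>n\<close>.\<close>

definition ord_ge :: "nat \<Rightarrow> complex fps fps set" where
  "ord_ge n = {F. \<forall>i j. i + j < n \<longrightarrow> F $ j $ i = 0}"

definition cst :: "complex \<Rightarrow> complex fps fps" where "cst c = fps_const (fps_const c)"

definition zz :: "complex fps fps" where "zz = fps_x + cst \<i> * fps_y"

definition ww :: "complex fps fps" where "ww = fps_x - cst \<i> * fps_y"

lemma cst_simps:
  "cst a * cst b = cst (a * b)" "cst a + cst b = cst (a + b)" "cst a - cst b = cst (a - b)" "- cst a = cst (- a)"
  "cst 0 = 0" "cst 1 = 1"
  by (simp_all add: cst_def)

lemma cst_mult_left: "cst a * (cst b * F) = cst (a * b) * F"
  by (simp add: cst_simps flip: mult.assoc)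

lemma cst_nth: "(cst c * F) $ j $ i = c * F $ j $ i"
  by (simp add: cst_def)

lemma cst_of_nat: "of_nat n = cst (of_nat n)"
  by (simp add: cst_def fps_of_nat)

lemma cst_power: "cst a ^ n = cst (a ^ n)"
  by (induction n) (simp_all add: cst_simps)

lemma ord_ge_0: "F \<in> ord_ge 0" by (simp add: ord_ge_def)

lemma ord_ge_zero: "0 \<in> ord_ge n" by (simp add: ord_ge_def)

lemma ord_ge_mono: "F \<in> ord_ge n \<Longrightarrow> m \<le> n \<Longrightarrow> F \<in> ord_ge m" by (auto simp: ord_ge_def)

lemma ord_ge_add: "F \<in> ord_ge n \<Longrightarrow> G \<in> ord_ge n \<Longrightarrow> F + G \<in> ord_ge n"
  by (simp add: ord_ge_def)

lemma ord_ge_diff: "F \<in> ord_ge n \<Longrightarrow> G \<in> ord_ge n \<Longrightarrow> F - G \<in> ord_ge n"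
  by (simp add: ord_ge_def)

lemma ord_ge_sum: "(\<And>i. i \<in> A \<Longrightarrow> f i \<in> ord_ge n) \<Longrightarrow> sum f A \<in> ord_ge n"
  by (induction A rule: infinite_finite_induct) (auto intro: ord_ge_zero ord_ge_add)

lemma ord_ge_mult:
  assumes "F \<in> ord_ge n" "G \<in> ord_ge m" shows "F * G \<in> ord_ge (n + m)"
  unfolding ord_ge_def
proof (intro CollectI allI impI)
  fix i j assume ij: "i + j < n + m"
  have "(F * G) $ j $ i = (\<Sum>a=0..j. \<Sum>b=0..i. F $ a $ b * G $ (j - a) $ (i - b))"
    by (simp add: fps_mult_nth fps_sum_nth)
  also have "\<dots> = 0"
  proof (intro sum.neutral ballI)
    fix a b assume "a \<in> {0..j}" "b \<in> {0..i}"
    then have "b + a < n \<or> (i - b) + (j - a) < m" using ij by auto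
    then show "F $ a $ b * G $ (j - a) $ (i - b) = 0" using assms by (auto simp: ord_ge_def)
  qed
  finally show "(F * G) $ j $ i = 0" .
qed

lemma ord_ge_mult_left: "F \<in> ord_ge n \<Longrightarrow> G * F \<in> ord_ge n"
  using ord_ge_mult[OF ord_ge_0, of F n G] by simp

lemma ord_ge_power: "F \<in> ord_ge n \<Longrightarrow> F ^ k \<in> ord_ge (n * k)"
proof (induction k)
  case (Suc k) then show ?case using ord_ge_mult[of F n "F ^ k" "n * k"] by simp
qed (simp add: ord_ge_0)

lemma fps_x_ord: "fps_x \<in> ord_ge 1" and fps_y_ord: "fps_y \<in> ord_ge 1"
  by (simp_all add: ord_ge_def fps_x_def fps_y_def)

lemma zz_ord: "zz \<in> ord_ge 1" and ww_ord: "ww \<in> ord_ge 1"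
  unfolding zz_def ww_def by (intro ord_ge_add ord_ge_diff ord_ge_mult_left fps_x_ord fps_y_ord)+

lemma monom_ord: "zz ^ j * ww ^ k \<in> ord_ge (j + k)"
  using ord_ge_mult[OF ord_ge_power[OF zz_ord, of j] ord_ge_power[OF ww_ord, of k]] by simp

lemma deriv_x_nth: "deriv_x F $ j $ i = of_nat (i + 1) * F $ j $ (i + 1)"
  by (simp add: deriv_x_def)

lemma deriv_y_nth: "deriv_y F $ j $ i = of_nat (j + 1) * F $ (j + 1) $ i"
  by (simp add: deriv_y_def fps_of_nat[symmetric] del: of_nat_Suc of_nat_add)

lemma deriv_ord: "F \<in> ord_ge n \<Longrightarrow> deriv_x F \<in> ord_ge (n - 1)" "F \<in> ord_ge n \<Longrightarrow> deriv_y F \<in> ord_ge (n - 1)"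
  by (auto simp: ord_ge_def deriv_x_nth deriv_y_nth)

lemma deriv_x_add: "deriv_x (F + G) = deriv_x F + deriv_x G"
  by (intro fps_ext) (simp add: deriv_x_nth algebra_simps)

lemma deriv_x_mult: "deriv_x (F * G) = deriv_x F * G + F * deriv_x G"
proof (rule fps_ext)
  fix j
  have "deriv_x (F * G) $ j = fps_deriv (\<Sum>a=0..j. F $ a * G $ (j - a))"
    by (simp add: deriv_x_def fps_mult_nth)
  also have "\<dots> = (\<Sum>a=0..j. fps_deriv (F $ a) * G $ (j - a)) + (\<Sum>a=0..j. F $ a * fps_deriv (G $ (j - a)))"
    by (simp add: fps_deriv_sum sum.distrib add.commute)
  finally show "deriv_x (F * G) $ j = (deriv_x F * G + F * deriv_x G) $ j"
    by (simp add: fps_mult_nth deriv_x_def)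
qed

lemma deriv_x_basic: "deriv_x (cst c) = 0" "deriv_x fps_x = 1" "deriv_x fps_y = 0"
proof -
  show "deriv_x (cst c) = 0" by (rule fps_ext) (simp add: deriv_x_def cst_def)
  show "deriv_x fps_x = 1" by (rule fps_ext) (simp add: deriv_x_def fps_x_def)
  show "deriv_x fps_y = 0" by (rule fps_ext) (simp add: deriv_x_def fps_y_def)
qed

lemma deriv_y_basic: "deriv_y (cst c) = 0" "deriv_y fps_x = 0" "deriv_y fps_y = 1"
  "deriv_y (F + G) = deriv_y F + deriv_y G" "deriv_y (F * G) = deriv_y F * G + F * deriv_y G"
  by (simp_all add: deriv_y_def cst_def fps_x_def fps_y_def add.commute)

text \<open>
  In the coordinates \<open>z = x + i y\<close>, \<open>w = x - i y\<close> the system reads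
  \<open>z' = - i (z + A)\<close>, \<open>w' = i (w + B)\<close>, and its linear part acts diagonally on monomials.
\<close>

locale complex_coords =
  fixes P Q :: "complex poly poly" and A B :: "complex fps fps"
  assumes bP: "bfps_of_poly P = fps_x + cst (1/2) * (A + B)"
    and bQ: "bfps_of_poly Q = fps_y + cst (\<i>/2) * (B - A)"
    and A_ord: "A \<in> ord_ge 2" and B_ord: "B \<in> ord_ge 2"
begin

text \<open>The derivative of \<open>F\<close> along the system, which is the determinant in
  Poincare's identity.\<close>

definition vf :: "complex fps fps \<Rightarrow> complex fps fps" where
  "vf F = deriv_x F * bfps_of_poly Q - deriv_y F * bfps_of_poly P"

lemma PQ_ord: "bfps_of_poly P \<in> ord_ge 1" "bfps_of_poly Q \<in> ord_ge 1"
  unfolding bP bQ using ord_ge_mono[OF A_ord, of 1] ord_ge_mono[OF B_ord, of 1] fps_x_ord fps_y_ord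
  by (auto intro!: ord_ge_add ord_ge_diff ord_ge_mult_left)

lemma vf_ord: "F \<in> ord_ge n \<Longrightarrow> vf F \<in> ord_ge n"
proof (cases n)
  case (Suc m)
  assume "F \<in> ord_ge n"
  then show ?thesis unfolding vf_def
    using ord_ge_mult[OF deriv_ord(1) PQ_ord(2), of F n] ord_ge_mult[OF deriv_ord(2) PQ_ord(1), of F n] Suc
    by (auto intro: ord_ge_diff)
qed (simp add: ord_ge_0)

lemma vf_add: "vf (F + G) = vf F + vf G"
  by (simp add: vf_def deriv_x_add deriv_y_basic algebra_simps)

lemma vf_mult: "vf (F * G) = vf F * G + F * vf G"
  by (simp add: vf_def deriv_x_mult deriv_y_basic algebra_simps)

lemma vf_cst: "vf (cst c) = 0"
  by (simp add: vf_def deriv_x_basic deriv_y_basic)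

lemma vf_cst_mult: "vf (cst c * F) = cst c * vf F"
  by (simp add: vf_mult vf_cst)

lemma vf_diff: "vf (F - G) = vf F - vf G"
  using vf_add[of F "cst (- 1) * G"] vf_cst_mult[of "- 1" G] by (simp add: cst_simps flip: cst_simps(4))

lemma vf_sum: "vf (sum f S) = (\<Sum>i\<in>S. vf (f i))"
  using vf_cst[of 0] by (induction S rule: infinite_finite_induct) (simp_all add: vf_add cst_simps)

lemma vf_power: "vf (F ^ n) = of_nat n * F ^ (n - 1) * vf F"
proof (induction n)
  case 0 then show ?case using vf_cst[of 1] by (simp add: cst_simps)
next
  case (Suc n)
  then show ?case by (cases n) (simp_all add: vf_mult algebra_simps)
qed

lemma cst_half: "cst (\<i>/2) = cst \<i> * cst (1/2)" "cst (1/2) + cst (1/2) = 1" "cst \<i> * cst \<i> = - 1"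
  by (simp_all add: cst_simps) (simp flip: cst_simps)

lemma vf_zz: "vf zz = - cst \<i> * (zz + A)"
proof -
  have "vf zz = bfps_of_poly Q - cst \<i> * bfps_of_poly P"
    by (simp add: vf_def zz_def deriv_x_add deriv_x_mult deriv_x_basic deriv_y_basic)
  also have "\<dots> = fps_y + cst \<i> * cst (1/2) * (B - A) - cst \<i> * (fps_x + cst (1/2) * (A + B))"
    by (simp add: bP bQ cst_half(1))
  also have "\<dots> = - cst \<i> * (zz + A)"
    unfolding zz_def using cst_half(2,3) by algebra
  finally show ?thesis .
qed

lemma vf_ww: "vf ww = cst \<i> * (ww + B)"
proof -
  have e: "ww = fps_x + cst (- \<i>) * fps_y" by (simp add: ww_def flip: cst_simps(4))
  have "deriv_x ww = 1" unfolding e by (simp add: deriv_x_add deriv_x_mult deriv_x_basic)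
  moreover have "deriv_y ww = - cst \<i>" unfolding e by (simp add: deriv_y_basic cst_simps)
  ultimately have "vf ww = bfps_of_poly Q + cst \<i> * bfps_of_poly P"
    by (simp add: vf_def)
  also have "\<dots> = fps_y + cst \<i> * cst (1/2) * (B - A) + cst \<i> * (fps_x + cst (1/2) * (A + B))"
    by (simp add: bP bQ cst_half(1))
  also have "\<dots> = cst \<i> * (ww + B)"
    unfolding ww_def using cst_half(2,3) by algebra
  finally show ?thesis .
qed

lemma vf_monom:
  "vf (zz ^ j * ww ^ k) = cst (- \<i> * (of_nat j - of_nat k)) * (zz ^ j * ww ^ k)
     + cst (- \<i> * of_nat j) * (zz ^ (j - 1) * ww ^ k * A) + cst (\<i> * of_nat k) * (zz ^ j * ww ^ (k - 1) * B)"
proof -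
  have alg: "n * p * (I * (z + C)) * q = n * I * (zj * q) + n * I * (p * q * C)"
    if "n * p * z = n * zj" for n p I z C q zj :: "complex fps fps"
  proof -
    have "n * p * (I * (z + C)) * q = I * q * (n * p * z) + n * I * (p * q * C)" by (simp add: algebra_simps)
    also have "I * q * (n * p * z) = I * q * (n * zj)" by (simp only: that)
    finally show ?thesis by (simp add: algebra_simps)
  qed
  \<comment> \<open>For \<open>n = 0\<close> both sides vanish, so the truncated exponent
    \<open>n - 1\<close> does no harm.\<close>
  have pw: "of_nat n * F ^ (n - 1) * F = of_nat n * F ^ n" for n and F :: "complex fps fps"
    by (cases n) (simp_all add: mult.assoc mult.commute[of F])
  have 1: "of_nat j * zz ^ (j - 1) * (- cst \<i> * (zz + A)) * ww ^ k
    = cst (- \<i> * of_nat j) * (zz ^ j * ww ^ k) + cst (- \<i> * of_nat j) * (zz ^ (j - 1) * ww ^ k * A)"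
  proof -
    have "of_nat j * - cst \<i> = cst (- \<i> * of_nat j)" by (simp add: cst_of_nat cst_simps mult.commute)
    then show ?thesis using alg[OF pw, of j zz "- cst \<i>" A "ww ^ k"] by simp
  qed
  have 2: "zz ^ j * (of_nat k * ww ^ (k - 1) * (cst \<i> * (ww + B)))
    = cst (\<i> * of_nat k) * (zz ^ j * ww ^ k) + cst (\<i> * of_nat k) * (zz ^ j * ww ^ (k - 1) * B)"
  proof -
    have "of_nat k * cst \<i> = cst (\<i> * of_nat k)" by (simp add: cst_of_nat cst_simps mult.commute)
    then show ?thesis using alg[OF pw, of k ww "cst \<i>" B "zz ^ j"] by (simp add: mult_ac)
  qed
  have 3: "cst (- \<i> * (of_nat j - of_nat k)) = cst (- \<i> * of_nat j) + cst (\<i> * of_nat k)"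
    by (simp add: cst_simps algebra_simps)
  show ?thesis
    unfolding vf_mult vf_power vf_zz vf_ww 1 2 3 by (simp add: distrib_right)
qed

end

section \<open>Homogeneous forms in z and w\<close>

definition hom_sum :: "nat \<Rightarrow> (nat \<Rightarrow> complex) \<Rightarrow> complex fps fps" where
  "hom_sum n c = (\<Sum>j\<le>n. cst (c j) * (zz ^ j * ww ^ (n - j)))"

lemma hom_sum_ord: "hom_sum n c \<in> ord_ge n"
  unfolding hom_sum_def
proof (rule ord_ge_sum, rule ord_ge_mult_left)
  fix j assume "j \<in> {..n}"
  then show "zz ^ j * ww ^ (n - j) \<in> ord_ge n" using monom_ord[of j "n - j"] by simp
qed

lemma hom_sum_add: "hom_sum n c + hom_sum n d = hom_sum n (\<lambda>j. c j + d j)"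
  by (simp add: hom_sum_def cst_simps(2)[symmetric] distrib_right sum.distrib)

lemma hom_sum_cst: "cst a * hom_sum n c = hom_sum n (\<lambda>j. a * c j)"
  by (simp add: hom_sum_def sum_distrib_left cst_mult_left)

lemma hom_sum_diff: "hom_sum n c - hom_sum n d = hom_sum n (\<lambda>j. c j - d j)"
  by (simp add: hom_sum_def cst_simps(3)[symmetric] left_diff_distrib sum_subtractf)

lemma hom_sum_single: "j \<le> n \<Longrightarrow> hom_sum n (\<lambda>i. if i = j then a else 0) = cst a * (zz ^ j * ww ^ (n - j))"
  unfolding hom_sum_def by (simp add: if_distrib[of cst] if_distrib[of "\<lambda>x. x * _"] cst_simps cong: if_cong)

lemma hom_sum_zz: "\<exists>d. zz * hom_sum n c = hom_sum (Suc n) d"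
proof
  have "hom_sum (Suc n) (\<lambda>j. case j of 0 \<Rightarrow> 0 | Suc i \<Rightarrow> c i) = (\<Sum>j\<le>n. cst (c j) * (zz ^ Suc j * ww ^ (n - j)))"
    unfolding hom_sum_def by (subst sum.atMost_Suc_shift) (simp add: cst_simps)
  then show "zz * hom_sum n c = hom_sum (Suc n) (\<lambda>j. case j of 0 \<Rightarrow> 0 | Suc i \<Rightarrow> c i)"
    by (simp add: hom_sum_def sum_distrib_left mult_ac)
qed

lemma hom_sum_ww: "\<exists>d. ww * hom_sum n c = hom_sum (Suc n) d"
proof
  have "hom_sum (Suc n) (\<lambda>j. if j \<le> n then c j else 0) = (\<Sum>j\<le>n. cst (c j) * (zz ^ j * ww ^ Suc (n - j)))"
    unfolding hom_sum_def by (simp add: cst_simps Suc_diff_le)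
  then show "ww * hom_sum n c = hom_sum (Suc n) (\<lambda>j. if j \<le> n then c j else 0)"
    by (simp add: hom_sum_def sum_distrib_left mult_ac)
qed

lemma fps_x_eq: "fps_x = cst (1/2) * zz + cst (1/2) * ww"
proof -
  have "cst (1/2) + cst (1/2) = 1" by (simp only: cst_simps) (simp flip: cst_simps)
  then show ?thesis unfolding zz_def ww_def by algebra
qed

lemma fps_y_eq: "fps_y = cst (- \<i>/2) * zz + cst (\<i>/2) * ww"
proof -
  have "cst (- \<i>/2) = - cst (\<i>/2)" "cst (\<i>/2) + cst (\<i>/2) = cst \<i>" "cst \<i> * cst \<i> = - 1"
    by (simp_all add: cst_simps) (simp flip: cst_simps)
  then show ?thesis unfolding zz_def ww_def by algebra
qed

lemma hom_sum_comb: "\<exists>d. (cst a * zz + cst b * ww) * hom_sum n c = hom_sum (Suc n) d"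
proof -
  obtain d e where "zz * hom_sum n c = hom_sum (Suc n) d" "ww * hom_sum n c = hom_sum (Suc n) e"
    using hom_sum_zz hom_sum_ww by blast
  then have "(cst a * zz + cst b * ww) * hom_sum n c = cst a * hom_sum (Suc n) d + cst b * hom_sum (Suc n) e"
    by (simp add: distrib_right mult.assoc)
  then show ?thesis by (auto simp: hom_sum_cst hom_sum_add)
qed

lemma xy_monom_hom_sum: "\<exists>c. fps_x ^ i * fps_y ^ j = hom_sum (i + j) c"
proof (induction i)
  case 0
  show ?case
  proof (induction j)
    case 0
    have "hom_sum 0 (\<lambda>_. 1) = 1" by (simp add: hom_sum_def cst_simps)
    then show ?case by (metis add_0 mult_1 power_0)
  next
    case (Suc j)
    then obtain c where "fps_x ^ 0 * fps_y ^ j = hom_sum (0 + j) c" by blast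
    moreover obtain d where "(cst (- \<i>/2) * zz + cst (\<i>/2) * ww) * hom_sum j c = hom_sum (Suc j) d"
      using hom_sum_comb by blast
    then have "fps_y * hom_sum j c = hom_sum (Suc j) d" by (simp only: fps_y_eq)
    ultimately show ?case by auto
  qed
next
  case (Suc i)
  then obtain c where "fps_x ^ i * fps_y ^ j = hom_sum (i + j) c" by blast
  then show ?case using hom_sum_comb[of "1/2" "1/2" "i + j" c] by (simp add: fps_x_eq[symmetric] mult.assoc)
qed

lemma xy_monom_nth: "(fps_x ^ a * fps_y ^ b) $ j $ i = (if i = a \<and> j = b then 1 else 0)"
  unfolding fps_x_def fps_y_def fps_const_power fps_mult_left_const_nth fps_X_power_nth by auto

lemma leading_form:
  assumes "F \<in> ord_ge n"
  obtains c where "F - hom_sum n c \<in> ord_ge (Suc n)"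
proof -
  define L where "L = (\<Sum>b\<le>n. cst (F $ b $ (n - b)) * (fps_x ^ (n - b) * fps_y ^ b))"
  have sums: "\<exists>c. (\<Sum>b\<le>m. cst (F $ b $ (n - b)) * (fps_x ^ (n - b) * fps_y ^ b)) = hom_sum n c" if "m \<le> n" for m
    using that
  proof (induction m)
    case 0
    then show ?case using xy_monom_hom_sum[of n 0] by (auto simp: hom_sum_cst)
  next
    case (Suc m)
    then obtain c where "(\<Sum>b\<le>m. cst (F $ b $ (n - b)) * (fps_x ^ (n - b) * fps_y ^ b)) = hom_sum n c" by auto
    moreover obtain d where "fps_x ^ (n - Suc m) * fps_y ^ Suc m = hom_sum n d"
      using xy_monom_hom_sum[of "n - Suc m" "Suc m"] Suc.prems by auto
    ultimately show ?case by (auto simp: hom_sum_cst hom_sum_add simp del: power_Suc)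
  qed
  have "(F - L) $ j $ i = 0" if "i + j < Suc n" for i j
  proof -
    have "L $ j $ i = (\<Sum>b\<le>n. F $ b $ (n - b) * (if i = n - b \<and> j = b then 1 else 0))"
      by (simp add: L_def fps_sum_nth cst_nth xy_monom_nth)
    also have "\<dots> = (\<Sum>b\<le>n. if b = j then (if i + j = n then F $ j $ i else 0) else 0)"
      by (rule sum.cong) auto
    also have "\<dots> = (if i + j = n then F $ j $ i else 0)" by auto
    finally show ?thesis using assms that by (auto simp: ord_ge_def)
  qed
  then have "F - L \<in> ord_ge (Suc n)" by (auto simp: ord_ge_def)
  moreover obtain c where "L = hom_sum n c" using sums[of n] by (auto simp: L_def)
  ultimately show ?thesis using that by simp
qed

lemma ord_geD: "F \<in> ord_ge n \<Longrightarrow> i + j < n \<Longrightarrow> F $ j $ i = 0"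
  by (simp add: ord_ge_def)

text \<open>Setting \<open>y = 0\<close> turns both \<open>z\<close> and \<open>w\<close> into
  \<open>x\<close>, so the monomial becomes a nonzero multiple of \<open>x^(j + k)\<close> unless
  \<open>c = 0\<close>.\<close>

lemma monom_not_ord: "cst c * (zz ^ j * ww ^ k) \<in> ord_ge (Suc (j + k)) \<Longrightarrow> c = 0"
proof -
  assume "cst c * (zz ^ j * ww ^ k) \<in> ord_ge (Suc (j + k))"
  then have "(cst c * (zz ^ j * ww ^ k)) $ 0 $ (j + k) = 0" by (rule ord_geD) simp
  moreover have "zz $ 0 = fps_X" "ww $ 0 = fps_X"
    by (simp_all add: zz_def ww_def cst_def fps_x_def fps_y_def)
  then have "(zz ^ j * ww ^ k) $ 0 = fps_X ^ (j + k)"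
    by (simp add: fps_power_zeroth power_add)
  ultimately show "c = 0" by (simp add: cst_def)
qed

definition rhs_term :: "nat \<Rightarrow> complex fps fps" where
  "rhs_term k = fps_x ^ (2 * k + 2) + fps_y ^ (2 * k + 2)"

text \<open>The middle coefficient is nonzero: the powers of \<open>x\<close> and of
  \<open>y\<close> contribute the same positive number to it. Hence \<open>s k\<close> times this
  form can absorb the obstruction in degree \<open>2 * k + 2\<close>, which sits on the
  diagonal.\<close>

lemma rhs_term_hom_sum:
  obtains c where "rhs_term k = hom_sum (2 * k + 2) c" "c (k + 1) \<noteq> 0"
proof -
  define n where "n = 2 * k + 2"
  have x: "fps_x ^ n = hom_sum n (\<lambda>j. of_nat (n choose j) * (1/2) ^ n)"
  proof -
    have "fps_x ^ n = (\<Sum>j\<le>n. of_nat (n choose j) * (cst (1/2) * zz) ^ j * (cst (1/2) * ww) ^ (n - j))"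
      unfolding fps_x_eq by (rule binomial_ring)
    also have "\<dots> = (\<Sum>j\<le>n. cst (of_nat (n choose j) * (1/2) ^ n) * (zz ^ j * ww ^ (n - j)))"
    proof (rule sum.cong)
      fix j assume j: "j \<in> {..n}"
      have "of_nat (n choose j) * (cst (1/2) * zz) ^ j * (cst (1/2) * ww) ^ (n - j) =
        (cst (of_nat (n choose j)) * (cst (1/2) ^ j * cst (1/2) ^ (n - j))) * (zz ^ j * ww ^ (n - j))"
        by (simp add: power_mult_distrib cst_of_nat mult_ac)
      also have "cst (1/2) ^ j * cst (1/2) ^ (n - j) = cst ((1/2) ^ n)"
      proof -
        have "(1/2) ^ j * (1/2) ^ (n - j) = (1/2 :: complex) ^ n" using j by (simp flip: power_add)
        then show ?thesis by (simp only: cst_power cst_simps)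
      qed
      finally show "of_nat (n choose j) * (cst (1/2) * zz) ^ j * (cst (1/2) * ww) ^ (n - j) =
        cst (of_nat (n choose j) * (1/2) ^ n) * (zz ^ j * ww ^ (n - j))" by (simp add: cst_simps)
    qed simp
    finally show ?thesis by (simp add: hom_sum_def)
  qed
  have y: "fps_y ^ n = hom_sum n (\<lambda>j. of_nat (n choose j) * ((- \<i>/2) ^ j * (\<i>/2) ^ (n - j)))"
  proof -
    have "fps_y ^ n = (\<Sum>j\<le>n. of_nat (n choose j) * (cst (- \<i>/2) * zz) ^ j * (cst (\<i>/2) * ww) ^ (n - j))"
      unfolding fps_y_eq by (rule binomial_ring)
    also have "\<dots> = (\<Sum>j\<le>n. cst (of_nat (n choose j) * ((- \<i>/2) ^ j * (\<i>/2) ^ (n - j))) * (zz ^ j * ww ^ (n - j)))"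
    proof (rule sum.cong)
      fix j assume j: "j \<in> {..n}"
      have "of_nat (n choose j) * (cst (- \<i>/2) * zz) ^ j * (cst (\<i>/2) * ww) ^ (n - j) =
        (cst (of_nat (n choose j)) * (cst (- \<i>/2) ^ j * cst (\<i>/2) ^ (n - j))) * (zz ^ j * ww ^ (n - j))"
        by (simp only: power_mult_distrib cst_of_nat mult_ac)
      then show "of_nat (n choose j) * (cst (- \<i>/2) * zz) ^ j * (cst (\<i>/2) * ww) ^ (n - j) =
        cst (of_nat (n choose j) * ((- \<i>/2) ^ j * (\<i>/2) ^ (n - j))) * (zz ^ j * ww ^ (n - j))"
        by (simp only: cst_simps cst_power)
    qed simp
    finally show ?thesis by (simp add: hom_sum_def)
  qed
  have nk: "n - (k + 1) = k + 1" by (simp add: n_def)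
  \<comment> \<open>The factors pair up to \<open>1/4\<close> each, so the sign of the imaginary
    unit disappears in the middle term.\<close>
  have "(- \<i>/2) ^ (k + 1) * (\<i>/2) ^ (n - (k + 1)) = ((- \<i>/2) * (\<i>/2)) ^ (k + 1)"
    by (simp only: nk power_mult_distrib)
  also have "\<dots> = (1/4) ^ (k + 1)" by simp
  also have "(1/4 :: complex) ^ (k + 1) = (1/2) ^ n"
  proof -
    have "(1/2 :: complex) ^ n = ((1/2)\<^sup>2) ^ (k + 1)" unfolding n_def power_mult[symmetric] by simp
    then show ?thesis by (simp add: power2_eq_square)
  qed
  finally have mid: "of_nat (n choose (k + 1)) * (1/2) ^ n +
     of_nat (n choose (k + 1)) * ((- \<i>/2) ^ (k + 1) * (\<i>/2) ^ (n - (k + 1))) = of_nat (n choose (k + 1)) * (2 * (1/2 :: complex) ^ n)"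
    by (simp add: algebra_simps)
  have nz: "of_nat (n choose (k + 1)) * (2 * (1/2 :: complex) ^ n) \<noteq> 0"
  proof -
    have "n choose (k + 1) \<noteq> 0" by (simp add: n_def)
    then have "of_nat (n choose (k + 1)) \<noteq> (0 :: complex)" by (simp only: of_nat_eq_0_iff not_False_eq_True)
    then show ?thesis by simp
  qed
  show ?thesis
  proof (rule that)
    show "rhs_term k = hom_sum (2 * k + 2)
      (\<lambda>j. of_nat (n choose j) * (1/2) ^ n + of_nat (n choose j) * ((- \<i>/2) ^ j * (\<i>/2) ^ (n - j)))"
      unfolding rhs_term_def n_def[symmetric] x y hom_sum_add ..
    show "of_nat (n choose (k + 1)) * (1/2) ^ n +
      of_nat (n choose (k + 1)) * ((- \<i>/2) ^ (k + 1) * (\<i>/2) ^ (n - (k + 1))) \<noteq> (0::complex)"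
      unfolding mid by (rule nz)
  qed
qed

lemma rhs_term_ord: "rhs_term k \<in> ord_ge (2 * k + 2)"
  by (metis hom_sum_ord rhs_term_hom_sum)

context complex_coords begin

lemma vf_hom_sum: "vf (hom_sum n c) - hom_sum n (\<lambda>j. - \<i> * (2 * of_nat j - of_nat n) * c j) \<in> ord_ge (Suc n)"
proof -
  have eq: "vf (hom_sum n c) - hom_sum n (\<lambda>j. - \<i> * (2 * of_nat j - of_nat n) * c j) =
    (\<Sum>j\<le>n. cst (c j) * (cst (- \<i> * of_nat j) * (zz ^ (j - 1) * ww ^ (n - j) * A) +
       cst (\<i> * of_nat (n - j)) * (zz ^ j * ww ^ (n - j - 1) * B)))"
    unfolding hom_sum_def vf_sum sum_subtractf[symmetric]
  proof (rule sum.cong)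
    fix j assume "j \<in> {..n}"
    then have e: "- \<i> * (of_nat j - of_nat (n - j)) = - \<i> * (2 * of_nat j - of_nat n)"
      by (simp add: of_nat_diff)
    have f: "cst (- \<i> * (2 * of_nat j - of_nat n) * c j) = cst (c j) * cst (- \<i> * (2 * of_nat j - of_nat n))"
      by (simp add: cst_simps mult.commute)
    show "vf (cst (c j) * (zz ^ j * ww ^ (n - j))) - cst (- \<i> * (2 * of_nat j - of_nat n) * c j) * (zz ^ j * ww ^ (n - j)) =
      cst (c j) * (cst (- \<i> * of_nat j) * (zz ^ (j - 1) * ww ^ (n - j) * A) +
       cst (\<i> * of_nat (n - j)) * (zz ^ j * ww ^ (n - j - 1) * B))"
      unfolding vf_cst_mult vf_monom e f by (simp add: distrib_left mult.assoc)
  qed simp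
  have a: "cst (- \<i> * of_nat j) * (zz ^ (j - 1) * ww ^ (n - j) * A) \<in> ord_ge (Suc n)" if "j \<le> n" for j
  proof (cases j)
    case (Suc i)
    have "zz ^ (j - 1) * ww ^ (n - j) * A \<in> ord_ge (j - 1 + (n - j) + 2)" by (rule ord_ge_mult[OF monom_ord A_ord])
    then have "zz ^ (j - 1) * ww ^ (n - j) * A \<in> ord_ge (Suc n)" using that Suc by simp
    then show ?thesis by (rule ord_ge_mult_left)
  qed (simp add: cst_simps ord_ge_zero)
  have b: "cst (\<i> * of_nat (n - j)) * (zz ^ j * ww ^ (n - j - 1) * B) \<in> ord_ge (Suc n)" if "j \<le> n" for j
  proof (cases "n - j")
    case (Suc i)
    have "zz ^ j * ww ^ (n - j - 1) * B \<in> ord_ge (j + (n - j - 1) + 2)" by (rule ord_ge_mult[OF monom_ord B_ord])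
    then have "zz ^ j * ww ^ (n - j - 1) * B \<in> ord_ge (Suc n)" using that Suc by (elim ord_ge_mono) simp
    then show ?thesis by (rule ord_ge_mult_left)
  qed (simp add: cst_simps ord_ge_zero)
  show ?thesis unfolding eq
    by (rule ord_ge_sum, rule ord_ge_mult_left, rule ord_ge_add[OF a b]) simp_all
qed

text \<open>The monomials are eigenvectors of the linear part with distinct eigenvalues.\<close>

lemma hom_sum_independent:
  assumes "hom_sum n c \<in> ord_ge (Suc n)" "j \<le> n" shows "c j = 0"
proof -
  have "\<forall>c. hom_sum n c \<in> ord_ge (Suc n) \<longrightarrow> {i. i \<le> n \<and> c i \<noteq> 0} \<subseteq> S \<longrightarrow> (\<forall>j\<le>n. c j = 0)" if "finite S" for S
    using that
  proof (induction S rule: finite_induct)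
    case (insert m S)
    show ?case
    proof (intro allI impI)
      fix c j assume c: "hom_sum n c \<in> ord_ge (Suc n)" "{i. i \<le> n \<and> c i \<noteq> 0} \<subseteq> insert m S" and j: "j \<le> n"
      \<comment> \<open>Applying the linear part minus its eigenvalue at \<open>m\<close> kills the
        coefficient of \<open>m\<close> and multiplies the others by nonzero numbers, so the
        induction hypothesis for \<open>S\<close> applies.\<close>
      define d where "d i = - \<i> * (2 * of_nat i - of_nat n) * c i - - \<i> * (2 * of_nat m - of_nat n) * c i" for i
      have d: "d i = - \<i> * 2 * (of_nat i - of_nat m) * c i" for i by (simp add: d_def algebra_simps)
      have eq: "hom_sum n d = (hom_sum n (\<lambda>j. - \<i> * (2 * of_nat j - of_nat n) * c j) - vf (hom_sum n c)) + vf (hom_sum n c)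
        - cst (- \<i> * (2 * of_nat m - of_nat n)) * hom_sum n c"
        unfolding hom_sum_cst d_def[abs_def] hom_sum_diff[symmetric] by (simp add: mult.assoc)
      have "hom_sum n (\<lambda>j. - \<i> * (2 * of_nat j - of_nat n) * c j) - vf (hom_sum n c) \<in> ord_ge (Suc n)"
        using ord_ge_diff[OF ord_ge_zero vf_hom_sum] by simp
      then have "hom_sum n d \<in> ord_ge (Suc n)"
        unfolding eq by (rule ord_ge_diff[OF ord_ge_add[OF _ vf_ord[OF c(1)]] ord_ge_mult_left[OF c(1)]])
      moreover have "{i. i \<le> n \<and> d i \<noteq> 0} \<subseteq> S" using c(2) by (auto simp: d)
      ultimately have "\<forall>j\<le>n. d j = 0" using insert.IH by blast
      then have z: "c i = 0" if "i \<le> n" "i \<noteq> m" for i using that by (auto simp: d)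
      show "c j = 0"
      proof (cases "j = m")
        case True
        have "hom_sum n c = hom_sum n (\<lambda>i. if i = j then c j else 0)"
          unfolding hom_sum_def by (rule sum.cong) (use z True in auto)
        then have "cst (c j) * (zz ^ j * ww ^ (n - j)) \<in> ord_ge (Suc (j + (n - j)))"
          using c(1) j by (simp add: hom_sum_single)
        then show ?thesis by (rule monom_not_ord)
      qed (use z j in auto)
    qed
  qed auto
  from this[of "{..n}"] show ?thesis using assms by auto
qed

lemma hom_sum_unique: "hom_sum n c - hom_sum n d \<in> ord_ge (Suc n) \<Longrightarrow> j \<le> n \<Longrightarrow> c j = d j"
  using hom_sum_independent[of n "\<lambda>j. c j - d j" j] by (simp add: hom_sum_diff)

end

lemma ord_ge_add_diff:
  "F - G \<in> ord_ge n \<Longrightarrow> F' - G' \<in> ord_ge n \<Longrightarrow> (F + F') - (G + G') \<in> ord_ge n"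
  using ord_ge_add[of "F - G" n "F' - G'"] by (simp add: algebra_simps)

lemma ord_ge_diff_diff:
  "F - G \<in> ord_ge n \<Longrightarrow> F' - G' \<in> ord_ge n \<Longrightarrow> (F - F') - (G - G') \<in> ord_ge n"
  using ord_ge_diff[of "F - G" n "F' - G'"] by (simp add: algebra_simps)

context complex_coords begin

text \<open>Since the term for \<open>k\<close> starts in degree \<open>2 * k + 2\<close>, any
  truncation of length at least \<open>i + j\<close> has the same coefficient at
  \<open>x^i y^j\<close>. This permits congruences with a truncation that does not depend on the
  coefficient.\<close>

lemma focal_values_iff:
  "focal_values P Q s \<longleftrightarrow> (\<exists>F. F - zz * ww \<in> ord_ge 3 \<and>
     (\<forall>n. vf F - (\<Sum>k=1..n. cst (s k) * rhs_term k) \<in> ord_ge (Suc n)))"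
proof -
  have zw: "zz * ww = fps_x ^ 2 + fps_y ^ 2"
    using cst_half(3) unfolding zz_def ww_def power2_eq_square by algebra
  have 1: "F - zz * ww \<in> ord_ge 3 \<longleftrightarrow> (\<forall>i j. i + j \<le> 2 \<longrightarrow> F $ j $ i = (fps_x ^ 2 + fps_y ^ 2) $ j $ i)" for F
    by (auto simp: ord_ge_def zw)
  have tail: "(\<Sum>k=1..n. cst (s k) * rhs_term k) $ j $ i = (\<Sum>k=1..i+j. cst (s k) * rhs_term k) $ j $ i"
    if "i + j \<le> n" for i j n
  proof -
    have "(cst (s k) * rhs_term k) $ j $ i = 0" if "k \<in> {1..n} - {1..i+j}" for k
      using that ord_geD[OF ord_ge_mult_left[OF rhs_term_ord], of i j k "cst (s k)"] by auto
    then show ?thesis unfolding fps_sum_nth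
      by (intro sum.mono_neutral_right) (use that in auto)
  qed
  have 2: "(\<forall>n. vf F - (\<Sum>k=1..n. cst (s k) * rhs_term k) \<in> ord_ge (Suc n)) \<longleftrightarrow>
    (\<forall>i j. vf F $ j $ i = (\<Sum>k=1..i+j. cst (s k) * rhs_term k) $ j $ i)" (is "?L \<longleftrightarrow> ?R") for F
  proof
    assume L: ?L
    show ?R
    proof (intro allI)
      fix i j
      have "(vf F - (\<Sum>k=1..i+j. cst (s k) * rhs_term k)) $ j $ i = 0" using L by (intro ord_geD) auto
      then show "vf F $ j $ i = (\<Sum>k=1..i+j. cst (s k) * rhs_term k) $ j $ i" by simp
    qed
  next
    assume R: ?R
    show ?L unfolding ord_ge_def
    proof (intro allI CollectI impI)
      fix n i j :: nat assume "i + j < Suc n"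
      then have "(\<Sum>k=1..n. cst (s k) * rhs_term k) $ j $ i = vf F $ j $ i"
        using tail[of i j n] R by simp
      then show "(vf F - (\<Sum>k=1..n. cst (s k) * rhs_term k)) $ j $ i = 0" by simp
    qed
  qed
  show ?thesis
    unfolding focal_values_def 1 2 by (simp add: vf_def cst_def rhs_term_def)
qed

lemma ord_ge_minus: "F - G \<in> ord_ge n \<Longrightarrow> G - F \<in> ord_ge n"
  using ord_ge_diff[OF ord_ge_zero, of "F - G" n] by simp

lemma ord_ge_trans: "F - G \<in> ord_ge n \<Longrightarrow> G - H \<in> ord_ge n \<Longrightarrow> F - H \<in> ord_ge n"
  using ord_ge_add[of "F - G" n "G - H"] by simp

lemma ord_ge_cong: "F - G \<in> ord_ge n \<Longrightarrow> G \<in> ord_ge n \<Longrightarrow> F \<in> ord_ge n"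
  using ord_ge_add[of "F - G" n G] by simp

lemma power_leading:
  assumes "F - zz * ww \<in> ord_ge 3" "k \<ge> 1"
  shows "F ^ k - (zz * ww) ^ k \<in> ord_ge (2 * k + 1)"
  using assms(2)
proof (induction k rule: dec_induct)
  case base then show ?case using assms(1) by simp
next
  case (step k)
  have zw: "zz * ww \<in> ord_ge 2" using monom_ord[of 1 1] by (simp add: numeral_2_eq_2)
  have F2: "F \<in> ord_ge 2" by (rule ord_ge_cong[OF ord_ge_mono[OF assms(1)] zw]) simp
  have "F ^ Suc k - (zz * ww) ^ Suc k = F * (F ^ k - (zz * ww) ^ k) + (F - zz * ww) * (zz * ww) ^ k"
    by (simp add: algebra_simps)
  moreover have "F * (F ^ k - (zz * ww) ^ k) \<in> ord_ge (2 * Suc k + 1)"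
    using ord_ge_mult[OF F2 step.IH] by simp
  moreover have "(F - zz * ww) * (zz * ww) ^ k \<in> ord_ge (2 * Suc k + 1)"
    using ord_ge_mult[OF assms(1) ord_ge_power[OF zw, of k]] by (simp add: numeral_3_eq_3)
  ultimately show ?case by (simp add: ord_ge_add)
qed

text \<open>Only the term whose degree is exactly \<open>n\<close> remains. Its index set is empty
  for odd \<open>n\<close> and a singleton for even \<open>n\<close> from 4 on, so one formula
  covers both parities.\<close>

lemma sum_rhs_lead:
  assumes "\<And>m. m \<ge> 1 \<Longrightarrow> 2 * m + 2 < n \<Longrightarrow> s m = 0"
  shows "(\<Sum>k=1..n. cst (s k) * rhs_term k) - (\<Sum>k | k \<ge> 1 \<and> 2 * k + 2 = n. cst (s k) * rhs_term k) \<in> ord_ge (Suc n)"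
proof -
  let ?S = "{k. k \<ge> 1 \<and> 2 * k + 2 = n}"
  have "?S \<subseteq> {1..n}" by auto
  then have "(\<Sum>k=1..n. cst (s k) * rhs_term k) - (\<Sum>k\<in>?S. cst (s k) * rhs_term k) = (\<Sum>k\<in>{1..n} - ?S. cst (s k) * rhs_term k)"
    by (simp add: sum_diff)
  also have "\<dots> \<in> ord_ge (Suc n)"
  proof (rule ord_ge_sum)
    fix k assume k: "k \<in> {1..n} - ?S"
    show "cst (s k) * rhs_term k \<in> ord_ge (Suc n)"
    proof (cases "2 * k + 2 < n")
      case True then show ?thesis using assms[of k] k by (simp add: cst_simps ord_ge_zero)
    next
      case False
      then have "Suc n \<le> 2 * k + 2" using k by auto
      then show ?thesis by (intro ord_ge_mult_left ord_ge_mono[OF rhs_term_ord])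
    qed
  qed
  finally show ?thesis .
qed

text \<open>
  Subtracting a power series in \<open>F\<^sub>0\<close> from \<open>F\<close>, degree by degree, since up to this
  the kernel of the linear part is spanned by the powers of \<open>z w\<close>.
\<close>

lemma focal_values_first:
  assumes F0: "F0 - zz * ww \<in> ord_ge 3" "vf F0 - cst \<tau> * (zz * ww) ^ (M + 1) \<in> ord_ge (2 * M + 3)"
    and \<tau>: "\<tau> \<noteq> 0" and M: "M \<ge> 1" and s: "focal_values P Q s"
  shows "(\<forall>m\<in>{1..<M}. s m = 0) \<and> s M \<noteq> 0"
proof -
  obtain F where F: "F - zz * ww \<in> ord_ge 3"
    "\<And>n. vf F - (\<Sum>k=1..n. cst (s k) * rhs_term k) \<in> ord_ge (Suc n)"
    using s unfolding focal_values_iff by blast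
  have zw: "zz * ww \<in> ord_ge 2" using monom_ord[of 1 1] by (simp add: numeral_2_eq_2)
  have F02: "F0 \<in> ord_ge 2" by (rule ord_ge_cong[OF ord_ge_mono[OF F0(1)] zw]) simp
  have zwM: "cst \<tau> * (zz * ww) ^ (M + 1) \<in> ord_ge (2 * M + 2)"
    using ord_ge_mult_left[OF ord_ge_power[OF zw, of "M + 1"]] by simp
  \<comment> \<open>\<open>G\<close> is \<open>F0\<close> plus multiples of higher powers of
    \<open>F0\<close>. They leave the leading term of \<open>vf G\<close> unchanged, because
    \<open>vf\<close> of a power of \<open>F0\<close> with exponent at least two has order above
    \<open>2 * M + 2\<close>.\<close>
  have low: "\<exists>G. F - G \<in> ord_ge n \<and> vf G - cst \<tau> * (zz * ww) ^ (M + 1) \<in> ord_ge (2 * M + 3) \<and>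
      (\<forall>m\<ge>1. 2 * m + 2 < n \<longrightarrow> s m = 0)" if "3 \<le> n" "n \<le> 2 * M + 2" for n
    using that
  proof (induction n rule: dec_induct)
    case base
    have "F - F0 \<in> ord_ge 3" using ord_ge_trans[OF F(1) ord_ge_minus[OF F0(1)]] .
    then show ?case using F0(2) by (intro exI[of _ F0]) auto
  next
    case (step n)
    then obtain G where G: "F - G \<in> ord_ge n" "vf G - cst \<tau> * (zz * ww) ^ (M + 1) \<in> ord_ge (2 * M + 3)"
      and sz: "\<And>m. m \<ge> 1 \<Longrightarrow> 2 * m + 2 < n \<Longrightarrow> s m = 0" by auto
    obtain e where e: "(F - G) - hom_sum n e \<in> ord_ge (Suc n)" using leading_form[OF G(1)] .
    have "vf G \<in> ord_ge (Suc n)"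
      by (rule ord_ge_cong[OF ord_ge_mono[OF G(2)] ord_ge_mono[OF zwM]]) (use step.prems in auto)
    then have "vf (F - G) - vf F \<in> ord_ge (Suc n)" using ord_ge_diff[OF ord_ge_zero] by (simp add: vf_diff)
    then have "vf (F - G) - (\<Sum>k=1..n. cst (s k) * rhs_term k) \<in> ord_ge (Suc n)"
      by (rule ord_ge_trans[OF _ F(2)])
    then have R: "vf (F - G) - (\<Sum>k | k \<ge> 1 \<and> 2 * k + 2 = n. cst (s k) * rhs_term k) \<in> ord_ge (Suc n)"
      by (rule ord_ge_trans) (rule sum_rhs_lead[OF sz])
    have "vf (hom_sum n e) - vf (F - G) \<in> ord_ge (Suc n)"
      using vf_ord[OF ord_ge_minus[OF e]] by (simp add: vf_diff)
    then have "vf (hom_sum n e) - (\<Sum>k | k \<ge> 1 \<and> 2 * k + 2 = n. cst (s k) * rhs_term k) \<in> ord_ge (Suc n)"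
      by (rule ord_ge_trans[OF _ R])
    then have eq: "hom_sum n (\<lambda>j. - \<i> * (2 * of_nat j - of_nat n) * e j) - (\<Sum>k | k \<ge> 1 \<and> 2 * k + 2 = n. cst (s k) * rhs_term k) \<in> ord_ge (Suc n)"
      by (rule ord_ge_trans[OF ord_ge_minus[OF vf_hom_sum]])
    show ?case
    proof (cases "even n")
      case False
      then have em: "{k. k \<ge> 1 \<and> 2 * k + 2 = n} = {}" by auto
      have "hom_sum n (\<lambda>j. - \<i> * (2 * of_nat j - of_nat n) * e j) \<in> ord_ge (Suc n)" using eq unfolding em by simp
      then have z: "- \<i> * (2 * of_nat j - of_nat n) * e j = 0" if "j \<le> n" for j
        using hom_sum_independent that by blast
      have "e j = 0" if "j \<le> n" for j
      proof -
        have "of_nat (2 * j) \<noteq> (of_nat n :: complex)" using False by (metis dvd_triv_left of_nat_eq_iff)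
        then show ?thesis using z[OF that] by simp
      qed
      then have "hom_sum n e = 0" by (simp add: hom_sum_def cst_simps)
      then have "F - G \<in> ord_ge (Suc n)" using e by simp
      moreover have "s m = 0" if "m \<ge> 1" "2 * m + 2 < Suc n" for m
        using that False by (intro sz) (auto simp: less_Suc_eq)
      ultimately show ?thesis using G(2) by blast
    next
      case True
      then obtain q where "n = 2 * q" by blast
      moreover have "q \<ge> 2" using step.hyps(1) \<open>n = 2 * q\<close> by simp
      ultimately obtain m where m: "n = 2 * m + 2" "m \<ge> 1"
        by (intro that[of "q - 1"]) auto
      then have "{k. k \<ge> 1 \<and> 2 * k + 2 = n} = {m}" by auto
      then have eq': "hom_sum n (\<lambda>j. - \<i> * (2 * of_nat j - of_nat n) * e j) - cst (s m) * rhs_term m \<in> ord_ge (Suc n)"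
        using eq by simp
      obtain c where c: "rhs_term m = hom_sum n c" "c (m + 1) \<noteq> 0"
        using rhs_term_hom_sum[of m] m(1) by metis
      have z: "- \<i> * (2 * of_nat j - of_nat n) * e j = s m * c j" if "j \<le> n" for j
        using hom_sum_unique[OF eq'[unfolded c(1) hom_sum_cst] that] .
      \<comment> \<open>At the diagonal index the eigenvalue is zero while the coefficient of the
        right side is not.\<close>
      have "s m = 0" using z[of "m + 1"] c(2) m(1) by (simp add: algebra_simps)
      have "e j = 0" if "j \<le> n" "j \<noteq> m + 1" for j
      proof -
        have "of_nat (2 * j) \<noteq> (of_nat n :: complex)" using that(2) m(1) by (simp only: of_nat_eq_iff)
        then show ?thesis using z[OF that(1)] \<open>s m = 0\<close> by simp
      qed
      then have "hom_sum n e = hom_sum n (\<lambda>j. if j = m + 1 then e (m + 1) else 0)"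
        unfolding hom_sum_def by (intro sum.cong) auto
      also have "\<dots> = cst (e (m + 1)) * (zz * ww) ^ (m + 1)"
        using m(1) by (subst hom_sum_single) (simp_all add: power_mult_distrib)
      finally have lead: "hom_sum n e = cst (e (m + 1)) * (zz * ww) ^ (m + 1)" .
      \<comment> \<open>The leading form of \<open>F - G\<close> is a multiple of a power of
        \<open>zw\<close>, so the same power of \<open>F0\<close> removes it.\<close>
      define G' where "G' = G + cst (e (m + 1)) * F0 ^ (m + 1)"
      have "cst (e (m + 1)) * (F0 ^ (m + 1) - (zz * ww) ^ (m + 1)) \<in> ord_ge (Suc n)"
        using ord_ge_mult_left[OF power_leading[OF F0(1), of "m + 1"]] m(1) by simp
      then have "(F - G - hom_sum n e) - cst (e (m + 1)) * (F0 ^ (m + 1) - (zz * ww) ^ (m + 1)) \<in> ord_ge (Suc n)"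
        by (rule ord_ge_diff[OF e])
      then have "F - G' \<in> ord_ge (Suc n)" by (simp add: G'_def lead algebra_simps)
      moreover have "vf G' - cst \<tau> * (zz * ww) ^ (M + 1) \<in> ord_ge (2 * M + 3)"
      proof -
        have "vf F0 \<in> ord_ge (2 * M + 2)" by (rule ord_ge_cong[OF ord_ge_mono[OF F0(2)] zwM]) simp
        then have "F0 ^ m * vf F0 \<in> ord_ge (2 * m + (2 * M + 2))" by (intro ord_ge_mult ord_ge_power F02)
        then have "F0 ^ m * vf F0 \<in> ord_ge (2 * M + 3)" using m(2) by (elim ord_ge_mono) simp
        then have "cst (e (m + 1)) * (of_nat (m + 1) * (F0 ^ m * vf F0)) \<in> ord_ge (2 * M + 3)"
          by (rule ord_ge_mult_left[OF ord_ge_mult_left])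
        then have "vf G' - vf G \<in> ord_ge (2 * M + 3)"
          by (simp add: G'_def vf_add vf_cst_mult vf_power mult.assoc del: power_Suc)
        then show ?thesis by (rule ord_ge_trans[OF _ G(2)])
      qed
      moreover have "s k = 0" if "k \<ge> 1" "2 * k + 2 < Suc n" for k
      proof (cases "k = m")
        case False then show ?thesis using that m(1) by (intro sz) auto
      qed (use \<open>s m = 0\<close> in simp)
      ultimately show ?thesis by blast
    qed
  qed
  define n where "n = 2 * M + 2"
  obtain G where G: "F - G \<in> ord_ge n" "vf G - cst \<tau> * (zz * ww) ^ (M + 1) \<in> ord_ge (Suc n)"
    and sz: "\<And>m. m \<ge> 1 \<Longrightarrow> 2 * m + 2 < n \<Longrightarrow> s m = 0"
  proof -
    have n: "3 \<le> n" "n \<le> 2 * M + 2" "2 * M + 3 = Suc n" using M by (simp_all add: n_def)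
    show ?thesis using low[OF n(1,2)] that unfolding n(3) by blast
  qed
  have em: "{k. k \<ge> 1 \<and> 2 * k + 2 = n} = {M}" using M by (auto simp: n_def)
  have sR: "(\<Sum>k=1..n. cst (s k) * rhs_term k) - cst (s M) * rhs_term M \<in> ord_ge (Suc n)"
    using sum_rhs_lead[of n s, OF sz] unfolding em by simp
  obtain c where c: "rhs_term M = hom_sum n c" "c (M + 1) \<noteq> 0"
    using rhs_term_hom_sum[of M] by (metis n_def)
  obtain e where e: "(F - G) - hom_sum n e \<in> ord_ge (Suc n)" using leading_form[OF G(1)] .
  have zwe: "cst \<tau> * (zz * ww) ^ (M + 1) = hom_sum n (\<lambda>j. if j = M + 1 then \<tau> else 0)"
    by (subst hom_sum_single) (simp_all add: power_mult_distrib n_def)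
  have "vf F - cst (s M) * rhs_term M \<in> ord_ge (Suc n)" by (rule ord_ge_trans[OF F(2) sR])
  then have "vf (F - G) - (cst (s M) * rhs_term M - cst \<tau> * (zz * ww) ^ (M + 1)) \<in> ord_ge (Suc n)"
    unfolding vf_diff by (rule ord_ge_diff_diff[OF _ G(2)])
  moreover have "vf (hom_sum n e) - vf (F - G) \<in> ord_ge (Suc n)"
    using vf_ord[OF ord_ge_minus[OF e]] by (simp add: vf_diff)
  ultimately have "vf (hom_sum n e) - (cst (s M) * rhs_term M - cst \<tau> * (zz * ww) ^ (M + 1)) \<in> ord_ge (Suc n)"
    by (rule ord_ge_trans[rotated])
  then have "hom_sum n (\<lambda>j. - \<i> * (2 * of_nat j - of_nat n) * e j) -
      (cst (s M) * rhs_term M - cst \<tau> * (zz * ww) ^ (M + 1)) \<in> ord_ge (Suc n)"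
    by (rule ord_ge_trans[OF ord_ge_minus[OF vf_hom_sum]])
  then have "hom_sum n (\<lambda>j. - \<i> * (2 * of_nat j - of_nat n) * e j - (s M * c j - (if j = M + 1 then \<tau> else 0))) \<in> ord_ge (Suc n)"
    unfolding c(1) zwe hom_sum_cst hom_sum_diff .
  \<comment> \<open>On the diagonal the unknown leading form \<open>e\<close> drops out, and \<tau>
    is compared directly with \<open>s M\<close>.\<close>
  from hom_sum_independent[OF this, of "M + 1"] have "s M * c (M + 1) = \<tau>" by (simp add: n_def)
  then have "s M \<noteq> 0" using \<tau> by auto
  then show ?thesis using sz by (auto simp: n_def)
qed

end

section \<open>Existence of focal values\<close>

context complex_coords begin

text \<open>In each degree the linear part is invertible off the diagonal; for even \<open>n\<close>
  the scalar \<open>t\<close> is chosen to cancel the diagonal coefficient.\<close>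

lemma focal_step:
  assumes R: "R \<in> ord_ge n" and n: "n \<ge> 3"
  shows "\<exists>H t. H \<in> ord_ge n \<and> vf H + R - (\<Sum>k | k \<ge> 1 \<and> 2 * k + 2 = n. cst t * rhs_term k) \<in> ord_ge (Suc n)"
proof -
  obtain r where r: "R - hom_sum n r \<in> ord_ge (Suc n)" using leading_form[OF R] .
  define ev where "ev j = - \<i> * (2 * of_nat j - of_nat n)" for j :: nat
  have solve: "vf (hom_sum n e) + R - hom_sum n d \<in> ord_ge (Suc n)" if "\<And>j. j \<le> n \<Longrightarrow> ev j * e j + r j = d j" for e d
  proof -
    have "hom_sum n d = hom_sum n (\<lambda>j. ev j * e j) + hom_sum n r"
      unfolding hom_sum_add unfolding hom_sum_def by (rule sum.cong) (auto simp: that)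
    then have eq: "vf (hom_sum n e) + R - hom_sum n d =
      (vf (hom_sum n e) - hom_sum n (\<lambda>j. - \<i> * (2 * of_nat j - of_nat n) * e j)) + (R - hom_sum n r)"
      by (simp add: ev_def)
    show ?thesis unfolding eq by (rule ord_ge_add[OF vf_hom_sum r])
  qed
  have ev0: "ev j \<noteq> 0" if "2 * j \<noteq> n" for j
  proof -
    have "of_nat (2 * j) \<noteq> (of_nat n :: complex)" using that by (simp only: of_nat_eq_iff not_False_eq_True)
    then show ?thesis by (simp add: ev_def)
  qed
  show ?thesis
  proof (cases "even n")
    case False
    then have em: "{k. k \<ge> 1 \<and> 2 * k + 2 = n} = {}" by auto
    have "vf (hom_sum n (\<lambda>j. - r j / ev j)) + R - hom_sum n (\<lambda>_. 0) \<in> ord_ge (Suc n)"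
    proof (rule solve)
      fix j
      have "2 * j \<noteq> n" using False by auto
      then show "ev j * (- r j / ev j) + r j = 0" using ev0[of j] by simp
    qed
    moreover have "hom_sum n (\<lambda>_. 0) = 0" by (simp add: hom_sum_def cst_simps)
    ultimately show ?thesis unfolding em using hom_sum_ord by auto
  next
    case True
    then obtain q where "n = 2 * q" by blast
    moreover have "q \<ge> 2" using n \<open>n = 2 * q\<close> by simp
    ultimately obtain m where m: "n = 2 * m + 2" "m \<ge> 1"
      by (intro that[of "q - 1"]) auto
    then have em: "{k. k \<ge> 1 \<and> 2 * k + 2 = n} = {m}" by auto
    obtain c where c: "rhs_term m = hom_sum n c" "c (m + 1) \<noteq> 0"
      using rhs_term_hom_sum[of m] m(1) by metis
    define t where "t = r (m + 1) / c (m + 1)"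
    have "vf (hom_sum n (\<lambda>j. (t * c j - r j) / ev j)) + R - hom_sum n (\<lambda>j. t * c j) \<in> ord_ge (Suc n)"
    proof (rule solve)
      fix j assume "j \<le> n"
      show "ev j * ((t * c j - r j) / ev j) + r j = t * c j"
      proof (cases "j = m + 1")
        case True then show ?thesis using c(2) by (simp add: t_def)
      next
        case False
        then have "ev j \<noteq> 0" using m(1) by (intro ev0) simp
        then show ?thesis by simp
      qed
    qed
    then show ?thesis unfolding em using hom_sum_ord by (auto simp: c(1) hom_sum_cst)
  qed
qed

text \<open>This gives \<open>has_focus\<close> a witness. Successive degree-by-degree corrections
  are picked by dependent choice and assembled into a series.\<close>

lemma focal_values_exist: "\<exists>s. focal_values P Q s"
proof -
  define T where "T n t = (\<Sum>k | k \<ge> 1 \<and> 2 * k + 2 = n. cst t * rhs_term k)" for n t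
  define ok where "ok n x \<longleftrightarrow> vf (fst x) - snd x \<in> ord_ge (n + 3) \<and> fst x - zz * ww \<in> ord_ge 3 \<and> (n = 0 \<longrightarrow> snd x = 0)"
    for n and x :: "complex fps fps \<times> complex fps fps"
  define nxt where "nxt n x y \<longleftrightarrow> fst y - fst x \<in> ord_ge (n + 3) \<and> (\<exists>t. snd y = snd x + T (n + 3) t)"
    for n and x y :: "complex fps fps \<times> complex fps fps"
  have "\<exists>f. \<forall>n. ok n (f n) \<and> nxt n (f n) (f (Suc n))"
  proof (rule dependent_nat_choice)
    have "vf (zz * ww) = cst (- \<i>) * (ww * A) + cst \<i> * (zz * B)"
      using vf_monom[of 1 1] by (simp add: cst_simps)
    moreover have "ww * A \<in> ord_ge 3" "zz * B \<in> ord_ge 3"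
      using ord_ge_mult[OF ww_ord A_ord] ord_ge_mult[OF zz_ord B_ord] by (simp_all add: numeral_3_eq_3 numeral_2_eq_2)
    ultimately have "vf (zz * ww) \<in> ord_ge 3" by (simp add: ord_ge_add ord_ge_mult_left)
    then show "\<exists>x. ok 0 x" by (intro exI[of _ "(zz * ww, 0)"]) (simp add: ok_def ord_ge_zero)
  next
    fix x n assume x: "ok n x"
    then obtain H t where H: "H \<in> ord_ge (n + 3)" "vf H + (vf (fst x) - snd x) - T (n + 3) t \<in> ord_ge (Suc (n + 3))"
      using focal_step[of "vf (fst x) - snd x" "n + 3"] by (auto simp: ok_def T_def)
    have "(fst x + H) - zz * ww = (fst x - zz * ww) + H" by simp
    also have "\<dots> \<in> ord_ge 3"
      by (rule ord_ge_add) (use x ord_ge_mono[OF H(1)] in \<open>auto simp: ok_def\<close>)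
    finally have "ok (Suc n) (fst x + H, snd x + T (n + 3) t)"
      using H(2) by (simp add: ok_def vf_add algebra_simps)
    moreover have "nxt n x (fst x + H, snd x + T (n + 3) t)" using H(1) by (auto simp: nxt_def)
    ultimately show "\<exists>y. ok (Suc n) y \<and> nxt n x y" by blast
  qed
  then obtain f where f: "\<And>n. ok n (f n)" "\<And>n. nxt n (f n) (f (Suc n))" by blast
  define Fn S where "Fn n = fst (f n)" and "S n = snd (f n)" for n
  have "\<forall>n. \<exists>t. S (Suc n) = S n + T (n + 3) t"
    using f(2) by (auto simp: nxt_def S_def)
  then obtain t where t: "\<And>n. S (Suc n) = S n + T (n + 3) (t n)" by metis
  have Fstep: "Fn (Suc n) - Fn n \<in> ord_ge (n + 3)" for n using f(2)[of n] by (simp add: nxt_def Fn_def)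
  have Fmn: "Fn (n + m) - Fn n \<in> ord_ge (n + 3)" for n m
  proof (induction m)
    case (Suc m)
    have "Fn (Suc (n + m)) - Fn (n + m) \<in> ord_ge (n + 3)" by (rule ord_ge_mono[OF Fstep]) simp
    then show ?case using ord_ge_trans[OF _ Suc.IH] by simp
  qed (simp add: ord_ge_zero)
  \<comment> \<open>The coefficients of degree at most \<open>n + 2\<close> no longer change from
    stage \<open>n\<close> on, so stage \<open>i + j\<close> already has the final one.\<close>
  define F where "F = Abs_fps (\<lambda>j. Abs_fps (\<lambda>i. Fn (i + j) $ j $ i))"
  have FF: "F - Fn n \<in> ord_ge (n + 3)" for n
    unfolding ord_ge_def
  proof (intro CollectI allI impI)
    fix i j assume ij: "i + j < n + 3"
    show "(F - Fn n) $ j $ i = 0"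
    proof (cases "i + j \<le> n")
      case True
      then have "(Fn n - Fn (i + j)) $ j $ i = 0"
        using ord_geD[OF Fmn[of "i + j" "n - (i + j)"], of i j] by simp
      then show ?thesis by (simp add: F_def)
    next
      case False
      then have "(Fn (i + j) - Fn n) $ j $ i = 0"
        using ord_geD[OF Fmn[of n "i + j - n"], of i j] ij by simp
      then show ?thesis by (simp add: F_def)
    qed
  qed
  \<comment> \<open>Stage \<open>n\<close> treats degree \<open>n + 3\<close>, which equals
    \<open>2 * k + 2\<close> for \<open>n = 2 * k - 1\<close>.\<close>
  define s where "s k = t (2 * k - 1)" for k
  have Sn: "S n = (\<Sum>k | k \<ge> 1 \<and> 2 * k + 2 < n + 3. cst (s k) * rhs_term k)" for n
  proof (induction n)
    case 0
    have "{k::nat. k \<ge> 1 \<and> 2 * k + 2 < 0 + 3} = {}" by auto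
    moreover have "S 0 = 0" using f(1)[of 0] by (simp add: ok_def S_def)
    ultimately show ?case by (simp only: sum.empty)
  next
    case (Suc n)
    have fin: "finite {k::nat. k \<ge> 1 \<and> 2 * k + 2 < n + 3}" "finite {k::nat. k \<ge> 1 \<and> 2 * k + 2 = n + 3}"
      by (auto intro: finite_subset[of _ "{..n + 3}"])
    have T: "T (n + 3) (t n) = (\<Sum>k | k \<ge> 1 \<and> 2 * k + 2 = n + 3. cst (s k) * rhs_term k)"
      unfolding T_def
    proof (rule sum.cong)
      fix k assume "k \<in> {k. k \<ge> 1 \<and> 2 * k + 2 = n + 3}"
      then have "n = 2 * k - 1" by auto
      then show "cst (t n) * rhs_term k = cst (s k) * rhs_term k" by (simp add: s_def)
    qed simp
    have un: "{k::nat. k \<ge> 1 \<and> 2 * k + 2 < Suc n + 3} = {k. k \<ge> 1 \<and> 2 * k + 2 < n + 3} \<union> {k. k \<ge> 1 \<and> 2 * k + 2 = n + 3}"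
      by auto
    have dis: "{k::nat. k \<ge> 1 \<and> 2 * k + 2 < n + 3} \<inter> {k. k \<ge> 1 \<and> 2 * k + 2 = n + 3} = {}" by auto
    show ?case unfolding t Suc.IH T un sum.union_disjoint[OF fin dis] ..
  qed
  have "vf F - (\<Sum>k=1..n. cst (s k) * rhs_term k) \<in> ord_ge (Suc n)" for n
  proof -
    have "vf F - vf (Fn n) \<in> ord_ge (n + 3)" using vf_ord[OF FF[of n]] by (simp add: vf_diff)
    moreover have "vf (Fn n) - S n \<in> ord_ge (n + 3)" using f(1)[of n] by (simp add: ok_def Fn_def S_def)
    ultimately have "vf F - S n \<in> ord_ge (Suc n)"
      using ord_ge_mono[OF ord_ge_trans, of "vf F" "vf (Fn n)" "n + 3" "S n" "Suc n"] by simp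
    moreover have "(\<Sum>k=1..n. cst (s k) * rhs_term k) - S n \<in> ord_ge (Suc n)"
    proof -
      let ?K = "{k. k \<ge> 1 \<and> 2 * k + 2 < n + 3}"
      have "?K \<subseteq> {1..n}" by auto
      then have "(\<Sum>k=1..n. cst (s k) * rhs_term k) - S n = (\<Sum>k\<in>{1..n} - ?K. cst (s k) * rhs_term k)"
        unfolding Sn by (simp only: sum_diff finite_atLeastAtMost)
      also have "\<dots> \<in> ord_ge (Suc n)"
      proof (rule ord_ge_sum, rule ord_ge_mult_left)
        fix k assume "k \<in> {1..n} - ?K"
        then show "rhs_term k \<in> ord_ge (Suc n)" by (intro ord_ge_mono[OF rhs_term_ord]) auto
      qed
      finally show ?thesis .
    qed
    ultimately show ?thesis using ord_ge_trans ord_ge_minus by blast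
  qed
  moreover have "F - zz * ww \<in> ord_ge 3"
    using ord_ge_trans[OF FF[of 0, simplified]] f(1)[of 0] by (simp add: ok_def Fn_def)
  ultimately show ?thesis unfolding focal_values_iff by blast
qed

end

section \<open>Polynomials in z and w truncated beyond degree 26\<close>

definition mono_zw :: "int \<Rightarrow> int \<Rightarrow> complex fps fps" where
  "mono_zw p q = zz ^ nat p * ww ^ nat q"

text \<open>The bound is the degree \<open>2 * 12 + 2\<close> in which the twelfth focal value
  appears. Integer indices let the recursion refer to positions outside the quadrant, where the
  coefficients are zero.\<close>

definition idx :: "(int \<times> int) set" where
  "idx = {(j, k). 0 \<le> j \<and> 0 \<le> k \<and> j + k \<le> 26}"

definition zw_poly :: "(int \<Rightarrow> int \<Rightarrow> complex) \<Rightarrow> complex fps fps" where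
  "zw_poly c = (\<Sum>(j, k)\<in>idx. cst (c j k) * mono_zw j k)"

lemma finite_idx: "finite idx"
  by (rule finite_subset[of _ "{0..26} \<times> {0..26}"]) (auto simp: idx_def)

lemma zw_poly_add: "zw_poly (\<lambda>j k. c j k + d j k) = zw_poly c + zw_poly d"
  by (simp add: zw_poly_def sum.distrib[symmetric] case_prod_unfold distrib_right[symmetric] cst_simps)

lemma zw_poly_diff: "zw_poly (\<lambda>j k. c j k - d j k) = zw_poly c - zw_poly d"
  by (simp add: zw_poly_def sum_subtractf[symmetric] case_prod_unfold left_diff_distrib[symmetric] cst_simps)

lemma zw_poly_cong: "(\<And>j k. (j, k) \<in> idx \<Longrightarrow> c j k = d j k) \<Longrightarrow> zw_poly c = zw_poly d"
  unfolding zw_poly_def by (rule sum.cong) auto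

lemma mono_zw_ord: "0 \<le> p \<Longrightarrow> 0 \<le> q \<Longrightarrow> int n \<le> p + q \<Longrightarrow> mono_zw p q \<in> ord_ge n"
  unfolding mono_zw_def by (rule ord_ge_mono[OF monom_ord]) auto

text \<open>\<open>mono_zw\<close> cuts negative exponents to zero, hence the requirement that
  coefficients vanish where the shift leaves the quadrant. As the shift does not lower the degree,
  every target in \<open>idx\<close> has its source in \<open>idx\<close>, and what is pushed out
  has degree at least 27.\<close>

lemma zw_poly_shift:
  assumes c: "\<And>j k. j < 0 \<or> k < 0 \<or> j + u < 0 \<or> k + v < 0 \<Longrightarrow> c j k = 0" and uv: "0 \<le> u + v"
  shows "(\<Sum>(j, k)\<in>idx. cst (c j k) * mono_zw (j + u) (k + v)) - zw_poly (\<lambda>p q. c (p - u) (q - v)) \<in> ord_ge 27"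
proof -
  define T1 where "T1 = {(j, k) \<in> idx. 0 \<le> j + u \<and> 0 \<le> k + v \<and> j + k + u + v \<le> 26}"
  define T2 where "T2 = {(p, q) \<in> idx. 0 \<le> p - u \<and> 0 \<le> q - v}"
  have sub: "T1 \<subseteq> idx" "T2 \<subseteq> idx" by (auto simp: T1_def T2_def)
  let ?f = "\<lambda>(j, k). cst (c j k) * mono_zw (j + u) (k + v)"
  let ?g = "\<lambda>(p, q). cst (c (p - u) (q - v)) * mono_zw p q"
  have "zw_poly (\<lambda>p q. c (p - u) (q - v)) = sum ?g T2"
    unfolding zw_poly_def
  proof (rule sum.mono_neutral_right[OF finite_idx sub(2)], intro ballI)
    fix x assume x: "x \<in> idx - T2"
    obtain p q where pq: "x = (p, q)" by (cases x)
    have "p - u < 0 \<or> q - v < 0" using x by (auto simp: pq T2_def)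
    then have "c (p - u) (q - v) = 0" by (intro c) auto
    then show "?g x = 0" by (simp add: pq cst_simps)
  qed
  also have "sum ?g T2 = sum ?f T1"
    by (rule sum.reindex_bij_witness[of _ "\<lambda>(j, k). (j + u, k + v)" "\<lambda>(p, q). (p - u, q - v)"])
      (use uv in \<open>auto simp: T1_def T2_def idx_def\<close>)
  finally have "sum ?f idx - zw_poly (\<lambda>p q. c (p - u) (q - v)) = sum ?f (idx - T1)"
    using sum.subset_diff[OF sub(1) finite_idx, of ?f] by simp
  also have "\<dots> \<in> ord_ge 27"
  proof (rule ord_ge_sum)
    fix x assume x: "x \<in> idx - T1"
    obtain j k where jk: "x = (j, k)" by (cases x)
    show "?f x \<in> ord_ge 27"
    proof (cases "j + u < 0 \<or> k + v < 0")
      case True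
      then have "c j k = 0" by (intro c) auto
      then show ?thesis by (simp add: jk cst_simps ord_ge_zero)
    next
      case False
      then have "27 \<le> (j + u) + (k + v)" using x by (auto simp: jk T1_def)
      then have "mono_zw (j + u) (k + v) \<in> ord_ge 27" using False by (intro mono_zw_ord) auto
      then show ?thesis by (simp add: jk ord_ge_mult_left)
    qed
  qed
  finally show ?thesis .
qed

type_synonym zw_terms = "(complex \<times> nat \<times> nat) list"

definition zw_series :: "zw_terms \<Rightarrow> complex fps fps" where
  "zw_series L = (\<Sum>(c, a, b)\<leftarrow>L. cst c * (zz ^ a * ww ^ b))"

text \<open>The partial derivative in \<open>z\<close>, multiplied by a monomial
  \<open>z^a w^b\<close>, amounts to a shift of indices by \<open>(a - 1, b)\<close>; the list is
  treated one monomial at a time. The factor \<open>of_int j\<close> removes the column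
  \<open>j = 0\<close>, where the exponent is truncated.\<close>

lemma zw_terms_z:
  assumes G: "\<And>j k. j < 0 \<or> k < 0 \<Longrightarrow> G j k = 0" and L: "\<And>c a b. (c, a, b) \<in> set L \<Longrightarrow> a + b \<ge> 1"
  shows "(\<Sum>(j, k)\<in>idx. cst (of_int j * G j k) * (zz ^ (nat j - 1) * ww ^ nat k * zw_series L))
     - zw_poly (\<lambda>p q. \<Sum>(c, a, b)\<leftarrow>L. c * of_int (p + 1 - int a) * G (p + 1 - int a) (q - int b)) \<in> ord_ge 27"
  using L
proof (induction L)
  case Nil
  then show ?case by (simp add: zw_series_def zw_poly_def cst_simps ord_ge_zero)
next
  case (Cons x L)
  obtain c a b where x: "x = (c, a, b)" by (cases x)
  have IH: "(\<Sum>(j, k)\<in>idx. cst (of_int j * G j k) * (zz ^ (nat j - 1) * ww ^ nat k * zw_series L))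
     - zw_poly (\<lambda>p q. \<Sum>(c, a, b)\<leftarrow>L. c * of_int (p + 1 - int a) * G (p + 1 - int a) (q - int b)) \<in> ord_ge 27"
    by (rule Cons.IH) (use Cons.prems in auto)
  have term1: "cst (of_int j * G j k) * (zz ^ (nat j - 1) * ww ^ nat k * (cst c * (zz ^ a * ww ^ b)))
    = cst (c * of_int j * G j k) * mono_zw (j + (int a - 1)) (k + int b)" if "(j, k) \<in> idx" for j k
  proof (cases "j = 0")
    case False
    have "nat (j + (int a - 1)) = nat j - 1 + a" "nat (k + int b) = nat k + b"
      using that False by (auto simp: idx_def)
    then have m: "mono_zw (j + (int a - 1)) (k + int b) = zz ^ (nat j - 1) * ww ^ nat k * (zz ^ a * ww ^ b)"
      by (simp add: mono_zw_def power_add mult_ac)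
    have "cst (c * of_int j * G j k) = cst (of_int j * G j k) * cst c" by (simp add: cst_simps mult_ac)
    then show ?thesis unfolding m by (simp only: mult_ac)
  qed (simp add: cst_simps)
  have split: "(\<Sum>(j, k)\<in>idx. cst (of_int j * G j k) * (zz ^ (nat j - 1) * ww ^ nat k * zw_series (x # L)))
    = (\<Sum>(j, k)\<in>idx. cst (c * of_int j * G j k) * mono_zw (j + (int a - 1)) (k + int b))
      + (\<Sum>(j, k)\<in>idx. cst (of_int j * G j k) * (zz ^ (nat j - 1) * ww ^ nat k * zw_series L))"
    unfolding sum.distrib[symmetric]
  proof (rule sum.cong)
    fix y assume "y \<in> idx"
    then obtain j k where y: "y = (j, k)" "(j, k) \<in> idx" by (cases y) auto
    show "(case y of (j, k) \<Rightarrow> cst (of_int j * G j k) * (zz ^ (nat j - 1) * ww ^ nat k * zw_series (x # L))) =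
      (case y of (j, k) \<Rightarrow> cst (c * of_int j * G j k) * mono_zw (j + (int a - 1)) (k + int b)) +
      (case y of (j, k) \<Rightarrow> cst (of_int j * G j k) * (zz ^ (nat j - 1) * ww ^ nat k * zw_series L))"
      unfolding y(1) prod.case term1[OF y(2), symmetric] by (simp add: zw_series_def x distrib_left)
  qed simp
  have shift: "(\<Sum>(j, k)\<in>idx. cst (c * of_int j * G j k) * mono_zw (j + (int a - 1)) (k + int b)) -
     zw_poly (\<lambda>p q. c * of_int (p - (int a - 1)) * G (p - (int a - 1)) (q - int b)) \<in> ord_ge 27"
  proof (rule zw_poly_shift)
    fix j k :: int assume "j < 0 \<or> k < 0 \<or> j + (int a - 1) < 0 \<or> k + int b < 0"
    then have "j < 0 \<or> k < 0 \<or> j = 0" by auto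
    then show "c * of_int j * G j k = 0" using G by auto
  qed (use Cons.prems[of c a b] x in auto)
  have "(\<Sum>(j, k)\<in>idx. cst (of_int j * G j k) * (zz ^ (nat j - 1) * ww ^ nat k * zw_series (x # L)))
    - (zw_poly (\<lambda>p q. c * of_int (p - (int a - 1)) * G (p - (int a - 1)) (q - int b)) +
      zw_poly (\<lambda>p q. \<Sum>(c, a, b)\<leftarrow>L. c * of_int (p + 1 - int a) * G (p + 1 - int a) (q - int b))) \<in> ord_ge 27"
    unfolding split by (rule ord_ge_add_diff[OF shift IH])
  moreover have "p - (int a - 1) = p + 1 - int a" for p by simp
  ultimately show ?case unfolding zw_poly_add[symmetric] by (simp add: x)
qed

lemma zw_terms_w:
  assumes G: "\<And>j k. j < 0 \<or> k < 0 \<Longrightarrow> G j k = 0" and L: "\<And>c a b. (c, a, b) \<in> set L \<Longrightarrow> a + b \<ge> 1"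
  shows "(\<Sum>(j, k)\<in>idx. cst (of_int k * G j k) * (zz ^ nat j * ww ^ (nat k - 1) * zw_series L))
     - zw_poly (\<lambda>p q. \<Sum>(c, a, b)\<leftarrow>L. c * of_int (q + 1 - int b) * G (p - int a) (q + 1 - int b)) \<in> ord_ge 27"
  using L
proof (induction L)
  case Nil
  then show ?case by (simp add: zw_series_def zw_poly_def cst_simps ord_ge_zero)
next
  case (Cons x L)
  obtain c a b where x: "x = (c, a, b)" by (cases x)
  have IH: "(\<Sum>(j, k)\<in>idx. cst (of_int k * G j k) * (zz ^ nat j * ww ^ (nat k - 1) * zw_series L))
     - zw_poly (\<lambda>p q. \<Sum>(c, a, b)\<leftarrow>L. c * of_int (q + 1 - int b) * G (p - int a) (q + 1 - int b)) \<in> ord_ge 27"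
    by (rule Cons.IH) (use Cons.prems in auto)
  have term1: "cst (of_int k * G j k) * (zz ^ nat j * ww ^ (nat k - 1) * (cst c * (zz ^ a * ww ^ b)))
    = cst (c * of_int k * G j k) * mono_zw (j + int a) (k + (int b - 1))" if "(j, k) \<in> idx" for j k
  proof (cases "k = 0")
    case False
    have "nat (k + (int b - 1)) = nat k - 1 + b" "nat (j + int a) = nat j + a"
      using that False by (auto simp: idx_def)
    then have m: "mono_zw (j + int a) (k + (int b - 1)) = zz ^ nat j * ww ^ (nat k - 1) * (zz ^ a * ww ^ b)"
      by (simp add: mono_zw_def power_add mult_ac)
    have "cst (c * of_int k * G j k) = cst (of_int k * G j k) * cst c" by (simp add: cst_simps mult_ac)
    then show ?thesis unfolding m by (simp only: mult_ac)
  qed (simp add: cst_simps)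
  have split: "(\<Sum>(j, k)\<in>idx. cst (of_int k * G j k) * (zz ^ nat j * ww ^ (nat k - 1) * zw_series (x # L)))
    = (\<Sum>(j, k)\<in>idx. cst (c * of_int k * G j k) * mono_zw (j + int a) (k + (int b - 1)))
      + (\<Sum>(j, k)\<in>idx. cst (of_int k * G j k) * (zz ^ nat j * ww ^ (nat k - 1) * zw_series L))"
    unfolding sum.distrib[symmetric]
  proof (rule sum.cong)
    fix y assume "y \<in> idx"
    then obtain j k where y: "y = (j, k)" "(j, k) \<in> idx" by (cases y) auto
    show "(case y of (j, k) \<Rightarrow> cst (of_int k * G j k) * (zz ^ nat j * ww ^ (nat k - 1) * zw_series (x # L))) =
      (case y of (j, k) \<Rightarrow> cst (c * of_int k * G j k) * mono_zw (j + int a) (k + (int b - 1))) +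
      (case y of (j, k) \<Rightarrow> cst (of_int k * G j k) * (zz ^ nat j * ww ^ (nat k - 1) * zw_series L))"
      unfolding y(1) prod.case term1[OF y(2), symmetric] by (simp add: zw_series_def x distrib_left)
  qed simp
  have shift: "(\<Sum>(j, k)\<in>idx. cst (c * of_int k * G j k) * mono_zw (j + int a) (k + (int b - 1))) -
     zw_poly (\<lambda>p q. c * of_int (q - (int b - 1)) * G (p - int a) (q - (int b - 1))) \<in> ord_ge 27"
  proof (rule zw_poly_shift)
    fix j k :: int assume "j < 0 \<or> k < 0 \<or> j + int a < 0 \<or> k + (int b - 1) < 0"
    then have "j < 0 \<or> k < 0 \<or> k = 0" by auto
    then show "c * of_int k * G j k = 0" using G by auto
  qed (use Cons.prems[of c a b] x in auto)
  have "(\<Sum>(j, k)\<in>idx. cst (of_int k * G j k) * (zz ^ nat j * ww ^ (nat k - 1) * zw_series (x # L)))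
    - (zw_poly (\<lambda>p q. c * of_int (q - (int b - 1)) * G (p - int a) (q - (int b - 1))) +
      zw_poly (\<lambda>p q. \<Sum>(c, a, b)\<leftarrow>L. c * of_int (q + 1 - int b) * G (p - int a) (q + 1 - int b))) \<in> ord_ge 27"
    unfolding split by (rule ord_ge_add_diff[OF shift IH])
  moreover have "q - (int b - 1) = q + 1 - int b" for q by simp
  ultimately show ?case unfolding zw_poly_add[symmetric] by (simp add: x)
qed

lemma vf_zw_poly:
  assumes cc: "complex_coords P Q (zw_series LA) (zw_series LB)"
    and G: "\<And>j k. j < 0 \<or> k < 0 \<Longrightarrow> G j k = 0"
    and LA: "\<And>c a b. (c, a, b) \<in> set LA \<Longrightarrow> a + b \<ge> 1" and LB: "\<And>c a b. (c, a, b) \<in> set LB \<Longrightarrow> a + b \<ge> 1"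
  shows "complex_coords.vf P Q (zw_poly G) - cst (- \<i>) * zw_poly (\<lambda>p q. of_int (p - q) * G p q
     + (\<Sum>(c, a, b)\<leftarrow>LA. c * of_int (p + 1 - int a) * G (p + 1 - int a) (q - int b))
     - (\<Sum>(c, a, b)\<leftarrow>LB. c * of_int (q + 1 - int b) * G (p - int a) (q + 1 - int b))) \<in> ord_ge 27"
proof -
  interpret complex_coords P Q "zw_series LA" "zw_series LB" by (rule cc)
  let ?S1 = "\<Sum>(j, k)\<in>idx. cst (of_int j * G j k) * (zz ^ (nat j - 1) * ww ^ nat k * zw_series LA)"
  let ?S2 = "\<Sum>(j, k)\<in>idx. cst (of_int k * G j k) * (zz ^ nat j * ww ^ (nat k - 1) * zw_series LB)"
  have eq: "vf (zw_poly G) = cst (- \<i>) * (zw_poly (\<lambda>p q. of_int (p - q) * G p q) + ?S1 - ?S2)"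
    unfolding zw_poly_def vf_sum sum.distrib[symmetric] sum_subtractf[symmetric] sum_distrib_left
  proof (rule sum.cong)
    fix y assume "y \<in> idx"
    then obtain j k where y: "y = (j, k)" "0 \<le> j" "0 \<le> k" by (cases y) (auto simp: idx_def)
    have nj: "of_nat (nat j) = (of_int j :: complex)" "of_nat (nat k) = (of_int k :: complex)"
      using y by (simp_all add: of_nat_nat)
    have e: "cst (G j k) * (cst (- \<i> * (of_int j - of_int k)) * M1 + cst (- \<i> * of_int j) * M2 + cst (\<i> * of_int k) * M3)
      = cst (- \<i>) * (cst (of_int (j - k) * G j k) * M1 + cst (of_int j * G j k) * M2 - cst (of_int k * G j k) * M3)"
      for M1 M2 M3
    proof -
      have c: "cst (- \<i> * (of_int j - of_int k)) = cst (- \<i>) * cst (of_int (j - k))"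
        "cst (- \<i> * of_int j) = cst (- \<i>) * cst (of_int j)" "cst (\<i> * of_int k) = - (cst (- \<i>) * cst (of_int k))"
        by (simp_all add: cst_simps)
      have g: "cst (of_int n * G j k) = cst (of_int n) * cst (G j k)" for n :: int by (simp add: cst_simps)
      have alg: "g * (I * d * M1 + I * J * M2 + - (I * K) * M3) = I * (d * g * M1 + J * g * M2 - K * g * M3)"
        for g I d J K :: "complex fps fps" by (simp add: algebra_simps)
      show ?thesis unfolding c g by (rule alg)
    qed
    show "vf (case y of (j, k) \<Rightarrow> cst (G j k) * mono_zw j k) = cst (- \<i>) *
      ((case y of (j, k) \<Rightarrow> cst (of_int (j - k) * G j k) * mono_zw j k) +
       (case y of (j, k) \<Rightarrow> cst (of_int j * G j k) * (zz ^ (nat j - 1) * ww ^ nat k * zw_series LA)) -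
       (case y of (j, k) \<Rightarrow> cst (of_int k * G j k) * (zz ^ nat j * ww ^ (nat k - 1) * zw_series LB)))"
      unfolding y(1) prod.case vf_cst_mult mono_zw_def vf_monom nj e ..
  qed simp
  have alg: "I * (Z + S - T) - I * (Z + S' - T') = I * ((S - S') - (T - T'))"
    for I Z S T S' T' :: "complex fps fps" by (simp add: algebra_simps)
  show ?thesis
    unfolding zw_poly_add zw_poly_diff eq alg
    by (rule ord_ge_mult_left, rule ord_ge_diff[OF zw_terms_z[OF G LA] zw_terms_w[OF G LB]]) auto
qed

section \<open>The polynomial system with given coordinates\<close>

definition termsA :: "(nat \<Rightarrow> complex) \<Rightarrow> zw_terms" where
  "termsA X = [(of_int NN * X 0, 2, 0), (of_int NN * X 1, 1, 1), (of_int NN * X 2, 0, 2),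
    (of_int NN ^ 2 * X 3, 3, 0), (of_int NN ^ 2 * X 4, 2, 1), (of_int NN ^ 2 * X 5, 1, 2), (of_int NN ^ 2 * X 6, 0, 3)]"

text \<open>The order is that of \<open>termsA\<close> with \<open>z\<close> and \<open>w\<close>
  exchanged, so real systems are those with \<open>X (i + 7)\<close> conjugate to
  \<open>X i\<close>. As there, terms of degree \<open>d\<close> carry the factor
  \<open>NN ^ (d - 1)\<close>.\<close>

definition termsB :: "(nat \<Rightarrow> complex) \<Rightarrow> zw_terms" where
  "termsB X = [(of_int NN * X 7, 0, 2), (of_int NN * X 8, 1, 1), (of_int NN * X 9, 2, 0),
    (of_int NN ^ 2 * X 10, 0, 3), (of_int NN ^ 2 * X 11, 1, 2), (of_int NN ^ 2 * X 12, 2, 1), (of_int NN ^ 2 * X 13, 3, 0)]"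

definition pcst :: "complex \<Rightarrow> complex poly poly" where "pcst c = [:[:c:]:]"

definition pzz :: "complex poly poly" where "pzz = [:[:0, 1:], [:\<i>:]:]"

definition pww :: "complex poly poly" where "pww = [:[:0, 1:], [:- \<i>:]:]"

definition zw_pol :: "zw_terms \<Rightarrow> complex poly poly" where
  "zw_pol L = (\<Sum>(c, a, b)\<leftarrow>L. pcst c * (pzz ^ a * pww ^ b))"

definition sysP :: "(nat \<Rightarrow> complex) \<Rightarrow> complex poly poly" where
  "sysP X = [:[:0, 1:]:] + pcst (1/2) * (zw_pol (termsA X) + zw_pol (termsB X))"

definition sysQ :: "(nat \<Rightarrow> complex) \<Rightarrow> complex poly poly" where
  "sysQ X = [:0, 1:] + pcst (\<i>/2) * (zw_pol (termsB X) - zw_pol (termsA X))"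

lemma bfps_nth: "bfps_of_poly P $ j = fps_of_poly (coeff P j)"
  by (simp add: bfps_of_poly_def coeff_map_poly)

lemma bfps_hom:
  "bfps_of_poly (P + Q) = bfps_of_poly P + bfps_of_poly Q"
  "bfps_of_poly (P - Q) = bfps_of_poly P - bfps_of_poly Q"
  "bfps_of_poly (P * Q) = bfps_of_poly P * bfps_of_poly Q"
  "bfps_of_poly 0 = 0" "bfps_of_poly 1 = 1"
proof -
  show "bfps_of_poly (P + Q) = bfps_of_poly P + bfps_of_poly Q"
    by (rule fps_ext) (simp add: bfps_nth fps_of_poly_add)
  show "bfps_of_poly (P - Q) = bfps_of_poly P - bfps_of_poly Q"
    by (rule fps_ext) (simp add: bfps_nth fps_of_poly_diff)
  show "bfps_of_poly (P * Q) = bfps_of_poly P * bfps_of_poly Q"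
    by (rule fps_ext) (simp add: bfps_nth coeff_mult fps_mult_nth fps_of_poly_sum fps_of_poly_mult atMost_atLeast0)
  show "bfps_of_poly 0 = 0" by (rule fps_ext) (simp add: bfps_nth)
  show "bfps_of_poly 1 = 1" by (rule fps_ext) (simp add: bfps_nth)
qed

lemma bfps_power: "bfps_of_poly (P ^ n) = bfps_of_poly P ^ n"
  by (induction n) (simp_all add: bfps_hom)

lemma bfps_basic:
  "bfps_of_poly (pcst c) = cst c" "bfps_of_poly [:[:0, 1:]:] = fps_x" "bfps_of_poly [:0, 1:] = fps_y"
  "bfps_of_poly pzz = zz" "bfps_of_poly pww = ww"
  by (rule fps_ext; simp add: bfps_nth pcst_def cst_def fps_x_def fps_y_def pzz_def pww_def zz_def ww_def
      coeff_pCons fps_of_poly_pCons fps_X_def split: nat.split)+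

lemma bfps_zw_pol: "bfps_of_poly (zw_pol L) = zw_series L"
  by (induction L) (auto simp: zw_pol_def zw_series_def bfps_hom bfps_power bfps_basic)

lemma zw_series_ord: "(\<And>c a b. (c, a, b) \<in> set L \<Longrightarrow> a + b \<ge> n) \<Longrightarrow> zw_series L \<in> ord_ge n"
proof (induction L)
  case Nil then show ?case by (simp add: zw_series_def ord_ge_zero)
next
  case (Cons x L)
  obtain c a b where x: "x = (c, a, b)" by (cases x)
  have "cst c * (zz ^ a * ww ^ b) \<in> ord_ge n"
    using Cons.prems[of c a b] x by (intro ord_ge_mult_left ord_ge_mono[OF monom_ord[of a b]]) auto
  moreover have "zw_series L \<in> ord_ge n" using Cons by auto
  ultimately show ?case by (simp add: zw_series_def x ord_ge_add)
qed

lemma terms_degree: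
  "(c, a, b) \<in> set (termsA X) \<Longrightarrow> a + b \<ge> 2" "(c, a, b) \<in> set (termsB X) \<Longrightarrow> a + b \<ge> 2"
  by (auto simp: termsA_def termsB_def)

lemma complex_coords_sys: "complex_coords (sysP X) (sysQ X) (zw_series (termsA X)) (zw_series (termsB X))"
proof
  show "bfps_of_poly (sysP X) = fps_x + cst (1/2) * (zw_series (termsA X) + zw_series (termsB X))"
    by (simp add: sysP_def bfps_hom bfps_basic bfps_zw_pol)
  show "bfps_of_poly (sysQ X) = fps_y + cst (\<i>/2) * (zw_series (termsB X) - zw_series (termsA X))"
    by (simp add: sysQ_def bfps_hom bfps_basic bfps_zw_pol)
  show "zw_series (termsA X) \<in> ord_ge 2" "zw_series (termsB X) \<in> ord_ge 2"
    by (rule zw_series_ord, erule terms_degree)+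
qed

text \<open>The differences of exponents up to degree 26 reach 26, which is \<open>2 * 13\<close>
  and thus already divides the least common multiple of the numbers up to 25.\<close>

lemma NN_dvd: "1 \<le> \<bar>d\<bar> \<Longrightarrow> \<bar>d\<bar> \<le> 26 \<Longrightarrow> d dvd NN"
proof -
  assume d: "1 \<le> \<bar>d\<bar>" "\<bar>d\<bar> \<le> 26"
  have "\<forall>e\<in>set [1..26::int]. e dvd NN" by (simp add: upto_rec1 NN_def)
  then have "\<bar>d\<bar> dvd NN" using d unfolding set_upto by (meson atLeastAtMost_iff)
  then show ?thesis by (simp only: abs_dvd_iff)
qed

lemma focT_terms:
  "of_int (p - q) * G p q + (\<Sum>(c, a, b)\<leftarrow>termsA X. c * of_int (p + 1 - int a) * G (p + 1 - int a) (q - int b))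
     - (\<Sum>(c, a, b)\<leftarrow>termsB X. c * of_int (q + 1 - int b) * G (p - int a) (q + 1 - int b))
   = of_int (p - q) * G p q + of_int NN * focT X G p q"
proof -
  have "p + 1 - int 2 = p - 1" "p + 1 - int 1 = p" "p + 1 - int 0 = p + 1" "p + 1 - int 3 = p - 2"
    "q + 1 - int 2 = q - 1" "q + 1 - int 1 = q" "q + 1 - int 0 = q + 1" "q + 1 - int 3 = q - 2"
    "int 2 = 2" "int 3 = 3" "int 1 = 1" "int 0 = 0" "p - 0 = p" "q - 0 = q" by simp_all
  note simps = this
  show ?thesis
    unfolding termsA_def termsB_def list.map sum_list.Cons sum_list.Nil prod.case simps focT_def
    by (simp add: algebra_simps power2_eq_square)
qed

lemma focT_low: "p + q \<le> 2 \<Longrightarrow> focT X (focA X n) p q = 0"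
proof -
  assume pq: "p + q \<le> 2"
  have "focT X (focA X n) p q = focT X (\<lambda>_ _. 0) p q"
    by (rule focT_cong) (use pq in \<open>auto simp: focA_small\<close>)
  then show ?thesis by (simp add: focT_def)
qed

text \<open>Off the diagonal the recursion was set up to cancel; on the diagonal \<open>NN\<close>
  times the obstruction is left. Here 24 steps are taken, one more than in \<open>focS\<close>,
  since also the terms of degree 26 off the diagonal must cancel.\<close>

lemma focal_coefficient:
  fixes X :: "nat \<Rightarrow> complex"
  assumes z: "\<And>m. 1 \<le> m \<Longrightarrow> m \<le> 11 \<Longrightarrow> focS X m = 0" and pq: "(p, q) \<in> idx"
  shows "of_int (p - q) * focA X 24 p q + of_int NN * focT X (focA X 24) p q
    = (if p = 13 \<and> q = 13 then of_int NN * focS X 12 else 0)"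
proof (cases "p + q \<le> 2")
  case True
  then have "focT X (focA X 24) p q = 0" by (rule focT_low)
  moreover have "of_int (p - q) * focA X 24 p q = 0" using focA_small[OF True, of X 24] by auto
  ultimately show ?thesis using True by auto
next
  case False
  have rec: "focA X 24 p q = (if p = q then 0 else of_int (NN div (q - p)) * focT X (focA X 24) p q)"
    using focA_rec[of p q 24 X] False pq by (simp add: idx_def)
  show ?thesis
  proof (cases "p = q")
    case False
    have "(q - p) dvd NN" using False pq by (intro NN_dvd) (auto simp: idx_def)
    then have "(p - q) * (NN div (q - p)) = - NN"
      by (metis dvd_mult_div_cancel minus_diff_eq mult_minus_left)
    then have "of_int (p - q) * of_int (NN div (q - p)) = - (of_int NN :: complex)"
      by (metis of_int_minus of_int_mult)
    then have "of_int (p - q) * (of_int (NN div (q - p)) * focT X (focA X 24) p q) = - of_int NN * focT X (focA X 24) p q"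
      by (simp only: mult.assoc[symmetric])
    then show ?thesis using False rec by auto
  next
    case True
    define m where "m = nat (p - 1)"
    have m: "p = int m + 1" "1 \<le> m" "m \<le> 12" using False True pq by (auto simp: m_def idx_def)
    have "focT X (focA X 24) p q = focS X m"
      unfolding focS_def True[symmetric] m(1)
    proof (rule focT_cong)
      fix a b assume "a + b = int m + 1 + (int m + 1) - 1 \<or> a + b = int m + 1 + (int m + 1) - 2"
      then show "focA X 24 a b = focA X 23 a b"
        using focA_stable[of a b 23 X 1] m by auto
    qed
    moreover have "p = 13 \<longleftrightarrow> m = 12" using m by auto
    ultimately show ?thesis using z[of m] m rec True by (cases "m = 12") auto
  qed
qed

text \<open>The recursion yields \<open>F0\<close> for which \<open>vf F0\<close> is, up to degree
  26, a nonzero multiple of \<open>(zw)^13\<close>; by \<open>focal_values_first\<close> this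
  decides the matter for every admissible sequence \<open>s\<close>.\<close>

theorem focal_values_sys:
  fixes X :: "nat \<Rightarrow> complex"
  assumes z: "\<And>m. 1 \<le> m \<Longrightarrow> m \<le> 11 \<Longrightarrow> focS X m = 0" and nz: "focS X 12 \<noteq> 0"
    and s: "focal_values (sysP X) (sysQ X) s"
  shows "(\<forall>m\<in>{1..11}. s m = 0) \<and> s 12 \<noteq> 0"
proof -
  interpret complex_coords "sysP X" "sysQ X" "zw_series (termsA X)" "zw_series (termsB X)"
    by (rule complex_coords_sys)
  define F0 where "F0 = zw_poly (focA X 24)"
  have single: "zw_poly (\<lambda>p q. if p = a \<and> q = b then c else 0) = cst c * mono_zw a b" if "(a, b) \<in> idx" for a b c
  proof -
    have "zw_poly (\<lambda>p q. if p = a \<and> q = b then c else 0) = (\<Sum>x\<in>idx. if x = (a, b) then cst c * mono_zw a b else 0)"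
      unfolding zw_poly_def by (rule sum.cong) (auto simp: cst_simps split: if_split_asm)
    then show ?thesis using that finite_idx by simp
  qed
  have "vf F0 - cst (- \<i>) * zw_poly (\<lambda>p q. of_int (p - q) * focA X 24 p q + of_int NN * focT X (focA X 24) p q) \<in> ord_ge 27"
    unfolding F0_def focT_terms[symmetric]
    by (rule vf_zw_poly[OF complex_coords_sys]) (use terms_degree in \<open>fastforce simp: focA_outside\<close>)+
  also have "zw_poly (\<lambda>p q. of_int (p - q) * focA X 24 p q + of_int NN * focT X (focA X 24) p q)
    = zw_poly (\<lambda>p q. if p = 13 \<and> q = 13 then of_int NN * focS X 12 else 0)"
    by (rule zw_poly_cong) (rule focal_coefficient[OF z])
  also have "\<dots> = cst (of_int NN * focS X 12) * (zz * ww) ^ 13"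
    by (subst single) (simp_all add: idx_def mono_zw_def power_mult_distrib)
  finally have v: "vf F0 - cst (- \<i> * (of_int NN * focS X 12)) * (zz * ww) ^ (12 + 1) \<in> ord_ge (2 * 12 + 3)"
    by (simp add: cst_mult_left)
  have "F0 - zz * ww = zw_poly (\<lambda>j k. focA X 24 j k - (if j = 1 \<and> k = 1 then 1 else 0))"
    unfolding F0_def zw_poly_diff by (subst single) (simp_all add: idx_def mono_zw_def cst_simps)
  also have "\<dots> \<in> ord_ge 3"
    unfolding zw_poly_def
  proof (rule ord_ge_sum)
    fix x assume "x \<in> idx"
    then obtain j k where x: "x = (j, k)" "0 \<le> j" "0 \<le> k" by (cases x) (auto simp: idx_def)
    show "(case x of (j, k) \<Rightarrow> cst (focA X 24 j k - (if j = 1 \<and> k = 1 then 1 else 0)) * mono_zw j k) \<in> ord_ge 3"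
    proof (cases "j + k \<le> 2")
      case True
      then show ?thesis using focA_small[OF True, of X 24] by (auto simp: x cst_simps ord_ge_zero)
    next
      case False
      then have "mono_zw j k \<in> ord_ge 3" using x by (intro mono_zw_ord) auto
      then show ?thesis by (simp add: x ord_ge_mult_left)
    qed
  qed
  finally have f: "F0 - zz * ww \<in> ord_ge 3" .
  have "(\<forall>m\<in>{1..<12}. s m = 0) \<and> s 12 \<noteq> 0"
    by (rule focal_values_first[OF f v _ _ s]) (use nz in \<open>auto simp: NN_def\<close>)
  moreover have "{1..11} = {1..<12::nat}" by auto
  ultimately show ?thesis by simp
qed

lemma focal_values_sys_exist: "\<exists>s. focal_values (sysP X) (sysQ X) s"
  by (rule complex_coords.focal_values_exist[OF complex_coords_sys])

section \<open>The space of cubic systems\<close>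

definition sysPQ :: "(nat \<Rightarrow> complex) \<Rightarrow> system" where
  "sysPQ X = (sysP X, sysQ X)"

definition cubic_pol :: "(nat \<Rightarrow> nat \<Rightarrow> complex) \<Rightarrow> complex poly poly" where
  "cubic_pol f = [:[:0, 0, f 2 0, f 3 0:], [:0, f 1 1, f 2 1:], [:f 0 2, f 1 2:], [:f 0 3:]:]"

lemma cubic_pol_linear:
  "cubic_pol f + cubic_pol g = cubic_pol (\<lambda>i j. f i j + g i j)"
  "cubic_pol f - cubic_pol g = cubic_pol (\<lambda>i j. f i j - g i j)"
  "pcst c * cubic_pol f = cubic_pol (\<lambda>i j. c * f i j)"
  by (simp_all add: cubic_pol_def pcst_def)

lemma bcoeff_cubic_pol: "bcoeff (cubic_pol f) i j = (if i + j \<in> {2, 3} then f i j else 0)"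
  unfolding bcoeff_def cubic_pol_def
  by (auto simp: coeff_pCons numeral_2_eq_2 numeral_3_eq_3 split: nat.split)

lemma cubic_pol_bcoeff:
  assumes "\<forall>i j. i + j \<notin> {2, 3} \<longrightarrow> bcoeff p i j = 0"
  shows "p = cubic_pol (bcoeff p)"
proof (rule poly_eqI, rule poly_eqI)
  fix j i
  show "coeff (coeff p j) i = coeff (coeff (cubic_pol (bcoeff p)) j) i"
    using bcoeff_cubic_pol[of "bcoeff p" i j] assms by (auto simp: bcoeff_def)
qed

text \<open>The argument \<open>cab\<close> is the coefficient of \<open>z^a w^b\<close>; the values
  are the coefficients after substituting \<open>z = x + i y\<close>,
  \<open>w = x - i y\<close>.\<close>

definition xy_coeffs :: "complex \<Rightarrow> complex \<Rightarrow> complex \<Rightarrow> complex \<Rightarrow> complex \<Rightarrow> complex \<Rightarrow> complex \<Rightarrow> nat \<Rightarrow> nat \<Rightarrow> complex" where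
  "xy_coeffs c20 c11 c02 c30 c21 c12 c03 i j = (
     if (i, j) = (2, 0) then c20 + c11 + c02 else if (i, j) = (1, 1) then 2 * \<i> * (c20 - c02)
     else if (i, j) = (0, 2) then - c20 + c11 - c02 else if (i, j) = (3, 0) then c30 + c21 + c12 + c03
     else if (i, j) = (2, 1) then \<i> * (3 * c30 + c21 - c12 - 3 * c03)
     else if (i, j) = (1, 2) then - 3 * c30 + c21 + c12 - 3 * c03
     else if (i, j) = (0, 3) then \<i> * (- c30 + c21 - c12 + c03) else 0)"

lemma pzz_pww_powers:
  "pzz ^ 2 = [:[:0, 0, 1:], [:0, 2 * \<i>:], [:- 1:]:]" "pww ^ 2 = [:[:0, 0, 1:], [:0, - 2 * \<i>:], [:- 1:]:]"
  "pzz * pww = [:[:0, 0, 1:], 0, [:1:]:]"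
  by (simp_all add: pzz_def pww_def power2_eq_square)

lemma zw_monomials_cubic_pol:
  "pcst c20 * pzz ^ 2 + pcst c11 * (pzz * pww) + pcst c02 * pww ^ 2
   + pcst c30 * pzz ^ 3 + pcst c21 * (pzz ^ 2 * pww) + pcst c12 * (pzz * pww ^ 2) + pcst c03 * pww ^ 3
   = cubic_pol (xy_coeffs c20 c11 c02 c30 c21 c12 c03)"
proof -
  have z3: "pzz ^ 3 = pzz * pzz ^ 2" "pww ^ 3 = pww * pww ^ 2" by (simp_all add: power3_eq_cube power2_eq_square)
  have c: "pzz * pzz ^ 2 = [:[:0, 0, 0, 1:], [:0, 0, 3 * \<i>:], [:0, - 3:], [:- \<i>:]:]"
    "pzz ^ 2 * pww = [:[:0, 0, 0, 1:], [:0, 0, \<i>:], [:0, 1:], [:\<i>:]:]"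
    "pzz * pww ^ 2 = [:[:0, 0, 0, 1:], [:0, 0, - \<i>:], [:0, 1:], [:- \<i>:]:]"
    "pww * pww ^ 2 = [:[:0, 0, 0, 1:], [:0, 0, - 3 * \<i>:], [:0, - 3:], [:\<i>:]:]"
    unfolding pzz_pww_powers by (simp_all add: pzz_def pww_def algebra_simps)
  show ?thesis
    unfolding z3 c unfolding pzz_pww_powers
    by (simp add: pcst_def cubic_pol_def xy_coeffs_def algebra_simps)
qed

lemma zw_pol_termsA: "zw_pol (termsA X) = cubic_pol (xy_coeffs (of_int NN * X 0) (of_int NN * X 1) (of_int NN * X 2)
    (of_int NN ^ 2 * X 3) (of_int NN ^ 2 * X 4) (of_int NN ^ 2 * X 5) (of_int NN ^ 2 * X 6))"
  unfolding zw_monomials_cubic_pol[symmetric] zw_pol_def termsA_def by (simp add: add.assoc)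

lemma zw_pol_termsB: "zw_pol (termsB X) = cubic_pol (xy_coeffs (of_int NN * X 9) (of_int NN * X 8) (of_int NN * X 7)
    (of_int NN ^ 2 * X 13) (of_int NN ^ 2 * X 12) (of_int NN ^ 2 * X 11) (of_int NN ^ 2 * X 10))"
  unfolding zw_monomials_cubic_pol[symmetric] zw_pol_def termsB_def by (simp add: add_ac)

text \<open>The inverse substitution \<open>x = (z + w) / 2\<close>,
  \<open>y = (z - w) / (2 i)\<close>, with the monomials numbered as in the arguments of
  \<open>xy_coeffs\<close>.\<close>

definition zw_coeff :: "(nat \<Rightarrow> nat \<Rightarrow> complex) \<Rightarrow> nat \<Rightarrow> complex" where
  "zw_coeff f = (\<lambda>m. [(f 2 0 - \<i> * f 1 1 - f 0 2) / 4, (f 2 0 + f 0 2) / 2, (f 2 0 + \<i> * f 1 1 - f 0 2) / 4,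
     (f 3 0 - \<i> * f 2 1 - f 1 2 + \<i> * f 0 3) / 8, (3 * f 3 0 - \<i> * f 2 1 + f 1 2 - 3 * \<i> * f 0 3) / 8,
     (3 * f 3 0 + \<i> * f 2 1 + f 1 2 + 3 * \<i> * f 0 3) / 8, (f 3 0 + \<i> * f 2 1 - f 1 2 - \<i> * f 0 3) / 8] ! m)"

lemma xy_zw_coeff:
  assumes "i + j \<in> {2, 3}"
  shows "xy_coeffs (zw_coeff f 0) (zw_coeff f 1) (zw_coeff f 2) (zw_coeff f 3) (zw_coeff f 4) (zw_coeff f 5) (zw_coeff f 6) i j = f i j"
proof -
  have "i = 2 \<and> j = 0 \<or> i = 1 \<and> j = 1 \<or> i = 0 \<and> j = 2 \<or> i = 3 \<and> j = 0 \<or> i = 2 \<and> j = 1 \<or> i = 1 \<and> j = 2 \<or> i = 0 \<and> j = 3"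
    using assms unfolding insert_iff empty_iff by presburger
  then show ?thesis
    by (elim disjE conjE) (simp_all add: xy_coeffs_def zw_coeff_def field_simps)
qed

lemma zw_xy_coeff:
  assumes "m < 7"
  shows "zw_coeff (xy_coeffs c0 c1 c2 c3 c4 c5 c6) m = [c0, c1, c2, c3, c4, c5, c6] ! m"
proof -
  have "m \<in> {0, 1, 2, 3, 4, 5, 6}" using assms unfolding insert_iff empty_iff by presburger
  then show ?thesis
    by (elim insertE emptyE) (simp_all add: xy_coeffs_def zw_coeff_def field_simps)
qed

text \<open>Inverse to \<open>sysPQ\<close> on the first 14 coordinates: for the nonlinear parts
  \<open>p\<close> and \<open>q\<close>, \<open>p + i q\<close> is \<open>A\<close> and
  \<open>p - i q\<close> is \<open>B\<close>, from which the powers of \<open>NN\<close> are divided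
  out again.\<close>

definition crd :: "system \<Rightarrow> nat \<Rightarrow> complex" where
  "crd S = (let a = zw_coeff (\<lambda>i j. bcoeff (fst S) i j + \<i> * bcoeff (snd S) i j);
     b = zw_coeff (\<lambda>i j. bcoeff (fst S) i j - \<i> * bcoeff (snd S) i j); N = of_int NN
   in (\<lambda>i. [a 0 / N, a 1 / N, a 2 / N, a 3 / N\<^sup>2, a 4 / N\<^sup>2, a 5 / N\<^sup>2, a 6 / N\<^sup>2,
     b 2 / N, b 1 / N, b 0 / N, b 6 / N\<^sup>2, b 5 / N\<^sup>2, b 4 / N\<^sup>2, b 3 / N\<^sup>2] ! i))"

lemma NN_nonzero: "(of_int NN :: complex) \<noteq> 0" by (simp add: NN_def)

lemma cubic_systemsE:
  assumes "S \<in> cubic_systems"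
  obtains f g where "S = ([:[:0, 1:]:] + cubic_pol f, [:0, 1:] + cubic_pol g)"
proof -
  obtain p q where S: "S = ([:[:0, 1:]:] + p, [:0, 1:] + q)"
    and "\<forall>i j. i + j \<notin> {2, 3} \<longrightarrow> bcoeff p i j = 0" "\<forall>i j. i + j \<notin> {2, 3} \<longrightarrow> bcoeff q i j = 0"
    using assms by (auto simp: cubic_systems_def)
  then show ?thesis using that cubic_pol_bcoeff by metis
qed

lemma cubic_systemsI: "([:[:0, 1:]:] + cubic_pol f, [:0, 1:] + cubic_pol g) \<in> cubic_systems"
  unfolding cubic_systems_def by (intro CollectI exI conjI refl) (auto simp: bcoeff_cubic_pol)

lemma cubic_pol_cong: "(\<And>i j. i + j \<in> {2, 3} \<Longrightarrow> f i j = g i j) \<Longrightarrow> cubic_pol f = cubic_pol g"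
  by (simp add: cubic_pol_def)

lemma sysPQ_cubic: "sysPQ X \<in> cubic_systems"
  unfolding sysPQ_def sysP_def sysQ_def zw_pol_termsA zw_pol_termsB cubic_pol_linear by (rule cubic_systemsI)

lemma bcoeff_linear: "bcoeff (P + Q) i j = bcoeff P i j + bcoeff Q i j"
  by (simp add: bcoeff_def)

lemma bcoeff_xy: "i + j \<in> {2, 3} \<Longrightarrow> bcoeff [:[:0, 1:]:] i j = (0 :: complex)" "i + j \<in> {2, 3} \<Longrightarrow> bcoeff [:0, 1:] i j = (0 :: complex)"
  by (auto simp: bcoeff_def coeff_pCons split: nat.split)

lemma zw_coeff_cong: "(\<And>i j. i + j \<in> {2, 3} \<Longrightarrow> f i j = g i j) \<Longrightarrow> zw_coeff f = zw_coeff g"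
  by (simp add: zw_coeff_def)

lemma crd_cubic:
  "crd ([:[:0, 1:]:] + cubic_pol f, [:0, 1:] + cubic_pol g) =
   (let a = zw_coeff (\<lambda>i j. f i j + \<i> * g i j); b = zw_coeff (\<lambda>i j. f i j - \<i> * g i j); N = of_int NN
    in (\<lambda>i. [a 0 / N, a 1 / N, a 2 / N, a 3 / N\<^sup>2, a 4 / N\<^sup>2, a 5 / N\<^sup>2, a 6 / N\<^sup>2,
     b 2 / N, b 1 / N, b 0 / N, b 6 / N\<^sup>2, b 5 / N\<^sup>2, b 4 / N\<^sup>2, b 3 / N\<^sup>2] ! i))"
proof -
  have "zw_coeff (\<lambda>i j. bcoeff ([:[:0, 1:]:] + cubic_pol f) i j + \<i> * bcoeff ([:0, 1:] + cubic_pol g) i j)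
    = zw_coeff (\<lambda>i j. f i j + \<i> * g i j)"
    "zw_coeff (\<lambda>i j. bcoeff ([:[:0, 1:]:] + cubic_pol f) i j - \<i> * bcoeff ([:0, 1:] + cubic_pol g) i j)
    = zw_coeff (\<lambda>i j. f i j - \<i> * g i j)"
    by (rule zw_coeff_cong; simp add: bcoeff_linear bcoeff_xy bcoeff_cubic_pol)+
  then show ?thesis unfolding crd_def fst_conv snd_conv by simp
qed

lemma sysPQ_crd:
  assumes "S \<in> cubic_systems" shows "sysPQ (crd S) = S"
proof -
  obtain f g where S: "S = ([:[:0, 1:]:] + cubic_pol f, [:0, 1:] + cubic_pol g)"
    using cubic_systemsE[OF assms] .
  have A: "zw_pol (termsA (crd S)) = cubic_pol (\<lambda>i j. f i j + \<i> * g i j)"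
    unfolding zw_pol_termsA S crd_cubic Let_def using NN_nonzero
    by (intro cubic_pol_cong) (simp add: xy_zw_coeff[unfolded One_nat_def])
  have B: "zw_pol (termsB (crd S)) = cubic_pol (\<lambda>i j. f i j - \<i> * g i j)"
    unfolding zw_pol_termsB S crd_cubic Let_def using NN_nonzero
    by (intro cubic_pol_cong) (simp add: xy_zw_coeff[unfolded One_nat_def])
  have "sysP (crd S) = [:[:0, 1:]:] + cubic_pol f"
    unfolding sysP_def A B cubic_pol_linear by (intro arg_cong2[where f = "(+)"] refl cubic_pol_cong) simp
  moreover have "sysQ (crd S) = [:0, 1:] + cubic_pol g"
    unfolding sysQ_def A B cubic_pol_linear by (intro arg_cong2[where f = "(+)"] refl cubic_pol_cong) simp
  ultimately show ?thesis by (simp add: sysPQ_def S)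
qed

lemma crd_sysPQ:
  assumes "i < 14" shows "crd (sysPQ X) i = X i"
proof -
  let ?N = "of_int NN :: complex"
  let ?a = "xy_coeffs (?N * X 0) (?N * X 1) (?N * X 2) (?N ^ 2 * X 3) (?N ^ 2 * X 4) (?N ^ 2 * X 5) (?N ^ 2 * X 6)"
  let ?b = "xy_coeffs (?N * X 9) (?N * X 8) (?N * X 7) (?N ^ 2 * X 13) (?N ^ 2 * X 12) (?N ^ 2 * X 11) (?N ^ 2 * X 10)"
  have S: "sysPQ X = ([:[:0, 1:]:] + cubic_pol (\<lambda>i j. 1/2 * (?a i j + ?b i j)), [:0, 1:] + cubic_pol (\<lambda>i j. \<i>/2 * (?b i j - ?a i j)))"
    by (simp only: sysPQ_def sysP_def sysQ_def zw_pol_termsA zw_pol_termsB cubic_pol_linear)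
  have ab: "(\<lambda>i j. 1/2 * (?a i j + ?b i j) + \<i> * (\<i>/2 * (?b i j - ?a i j))) = ?a"
    "(\<lambda>i j. 1/2 * (?a i j + ?b i j) - \<i> * (\<i>/2 * (?b i j - ?a i j))) = ?b"
    by (intro ext; simp add: field_simps)+
  have "i \<in> {0, 1, 2, 3, 4, 5, 6, 7, 8, 9, 10, 11, 12, 13}" using assms unfolding insert_iff empty_iff by presburger
  then show ?thesis
    unfolding S crd_cubic ab Let_def using NN_nonzero
    by (elim insertE emptyE) (simp_all add: zw_xy_coeff zw_xy_coeff[unfolded One_nat_def])
qed

section \<open>Polynomial functions under the change of coordinates\<close>

lemma pf_if: "(b \<Longrightarrow> f \<in> pf V) \<Longrightarrow> (\<not> b \<Longrightarrow> g \<in> pf V) \<Longrightarrow> (\<lambda>z. if b then f z else g z) \<in> pf V"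
  by (cases b) simp_all

lemma pf_xy_coeffs:
  assumes "c0 \<in> pf V" "c1 \<in> pf V" "c2 \<in> pf V" "c3 \<in> pf V" "c4 \<in> pf V" "c5 \<in> pf V" "c6 \<in> pf V"
  shows "(\<lambda>X. xy_coeffs (c0 X) (c1 X) (c2 X) (c3 X) (c4 X) (c5 X) (c6 X) i j) \<in> pf V"
  unfolding xy_coeffs_def by (intro pf_if pf_add pf_diff pf_mult pf_uminus pf_const assms)

lemma pf_sysPQ:
  "(\<lambda>X. bcoeff (sysP X) i j) \<in> pf {..<14}" "(\<lambda>X. bcoeff (sysQ X) i j) \<in> pf {..<14}"
  unfolding sysP_def sysQ_def zw_pol_termsA zw_pol_termsB cubic_pol_linear bcoeff_linear bcoeff_cubic_pol
  by (intro pf_if pf_add pf_diff pf_mult pf_const pf_xy_coeffs pf_var; simp)+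

lemma coeff_polynomials_sysPQ: "f \<in> coeff_polynomials \<Longrightarrow> (\<lambda>X. f (sysPQ X)) \<in> pf {..<14}"
proof (induction rule: coeff_polynomials.induct)
  case (coeff_P i j) then show ?case using pf_sysPQ(1) by (simp add: sysPQ_def)
next
  case (coeff_Q i j) then show ?case using pf_sysPQ(2) by (simp add: sysPQ_def)
qed (auto intro: pf.intros)

lemma cp_diff:
  assumes "f \<in> coeff_polynomials" "g \<in> coeff_polynomials" shows "(\<lambda>S. f S - g S) \<in> coeff_polynomials"
  using coeff_polynomials.add[OF assms(1) coeff_polynomials.mult[OF coeff_polynomials.const[of "-1"] assms(2)]] by simp

lemma cp_divide: "f \<in> coeff_polynomials \<Longrightarrow> (\<lambda>S. f S / c) \<in> coeff_polynomials"
  using coeff_polynomials.mult[OF _ coeff_polynomials.const[of "1 / c"], of f] by simp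

lemma cp_bcoeff: "(\<lambda>S. bcoeff (fst S) i j) \<in> coeff_polynomials" "(\<lambda>S. bcoeff (snd S) i j) \<in> coeff_polynomials"
  using coeff_polynomials.coeff_P[of i j] coeff_polynomials.coeff_Q[of i j] by (simp_all add: case_prod_unfold)

lemma cp_zw_coeff:
  assumes f: "\<And>i j. (\<lambda>S. f S i j) \<in> coeff_polynomials" and m: "m < 7"
  shows "(\<lambda>S. zw_coeff (f S) m) \<in> coeff_polynomials"
proof -
  have "m \<in> {0, 1, 2, 3, 4, 5, 6}" using m unfolding insert_iff empty_iff by presburger
  then show ?thesis
    by (elim insertE emptyE; simp add: zw_coeff_def;
      intro cp_divide cp_diff coeff_polynomials.add coeff_polynomials.mult coeff_polynomials.const
        f[of 0 2] f[of 0 3] f[of "Suc 0" "Suc 0"] f[of "Suc 0" 2] f[of 2 0] f[of 2 "Suc 0"] f[of 3 0])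
qed

lemma cp_crd: "i < 14 \<Longrightarrow> (\<lambda>S. crd S i) \<in> coeff_polynomials"
proof -
  assume "i < 14"
  then have "i \<in> {0, 1, 2, 3, 4, 5, 6, 7, 8, 9, 10, 11, 12, 13}" unfolding insert_iff empty_iff by presburger
  moreover have "(\<lambda>S. zw_coeff (\<lambda>i j. bcoeff (fst S) i j + \<i> * bcoeff (snd S) i j) m) \<in> coeff_polynomials"
    if "m < 7" for m
    by (rule cp_zw_coeff[OF _ that])
      (intro coeff_polynomials.add coeff_polynomials.mult coeff_polynomials.const cp_bcoeff)
  moreover have "(\<lambda>S. zw_coeff (\<lambda>i j. bcoeff (fst S) i j - \<i> * bcoeff (snd S) i j) m) \<in> coeff_polynomials"
    if "m < 7" for m
    by (rule cp_zw_coeff[OF _ that])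
      (intro cp_diff coeff_polynomials.mult coeff_polynomials.const cp_bcoeff)
  ultimately show ?thesis
    by (elim insertE emptyE) (simp_all add: crd_def Let_def cp_divide)
qed

lemma pf_crd: "\<phi> \<in> pf {..<14} \<Longrightarrow> (\<lambda>S. \<phi> (crd S)) \<in> coeff_polynomials"
  by (induction rule: pf.induct) (auto intro: coeff_polynomials.const coeff_polynomials.add coeff_polynomials.mult cp_crd)

lemma pf_crd_sysPQ: "\<phi> \<in> pf {..<14} \<Longrightarrow> \<phi> (crd (sysPQ X)) = \<phi> X"
  by (rule pf_depends) (auto simp: crd_sysPQ)

text \<open>The full preimage: \<open>sysPQ\<close> reads 14 coordinates only, so
  \<open>chart Z\<close> is a cylinder in the remaining ones.\<close>

definition chart :: "system set \<Rightarrow> (nat \<Rightarrow> complex) set" where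
  "chart Z = {X. sysPQ X \<in> Z}"

lemma image_chart:
  assumes "Z \<subseteq> cubic_systems" shows "sysPQ ` chart Z = Z"
proof
  show "sysPQ ` chart Z \<subseteq> Z" by (auto simp: chart_def)
  show "Z \<subseteq> sysPQ ` chart Z"
  proof
    fix S assume S: "S \<in> Z"
    then have e: "sysPQ (crd S) = S" using assms sysPQ_crd by blast
    then have "crd S \<in> chart Z" using S by (simp add: chart_def)
    then show "S \<in> sysPQ ` chart Z" using e by (intro image_eqI[of _ _ "crd S"]) simp_all
  qed
qed

section \<open>Transport of closed and irreducible sets\<close>

lemma zariski_closed_subset: "zariski_closed Z \<Longrightarrow> Z \<subseteq> cubic_systems"
  by (auto simp: zariski_closed_def)

lemma alg_closed_chart:
  assumes "zariski_closed Z" shows "alg_closed {..<14} (chart Z)"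
proof -
  obtain A where A: "A \<subseteq> coeff_polynomials" "Z = {S \<in> cubic_systems. \<forall>f\<in>A. f S = 0}"
    using assms by (auto simp: zariski_closed_def)
  have "chart Z = zeros ((\<lambda>f X. f (sysPQ X)) ` A)"
    by (auto simp: chart_def A(2) zeros_def sysPQ_cubic)
  moreover have "(\<lambda>f X. f (sysPQ X)) ` A \<subseteq> pf {..<14}" using A(1) coeff_polynomials_sysPQ by blast
  ultimately show ?thesis by (auto simp: alg_closed_def)
qed

text \<open>A set cut out by functions of the first 14 coordinates is a union of fibres of
  \<open>sysPQ\<close>, so passing to the image loses nothing.\<close>

lemma zariski_closed_image:
  assumes "alg_closed {..<14} Y"
  shows "zariski_closed (sysPQ ` Y)" "chart (sysPQ ` Y) = Y"
proof -
  obtain F where F: "F \<subseteq> pf {..<14}" "Y = zeros F" using assms by (auto simp: alg_closed_def)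
  have eq: "sysPQ ` Y = {S \<in> cubic_systems. \<forall>f\<in>(\<lambda>\<phi> S. \<phi> (crd S)) ` F. f S = 0}"
  proof (intro set_eqI iffI)
    fix S assume "S \<in> sysPQ ` Y"
    then obtain X where "X \<in> Y" "S = sysPQ X" by blast
    have "\<phi> (crd S) = 0" if "\<phi> \<in> F" for \<phi>
    proof -
      have "\<phi> (crd S) = \<phi> X" unfolding \<open>S = sysPQ X\<close> by (rule pf_crd_sysPQ) (use F(1) that in blast)
      then show ?thesis using \<open>X \<in> Y\<close> F(2) that by (simp add: zeros_def)
    qed
    then show "S \<in> {S \<in> cubic_systems. \<forall>f\<in>(\<lambda>\<phi> S. \<phi> (crd S)) ` F. f S = 0}"
      using \<open>S = sysPQ X\<close> by (simp add: sysPQ_cubic)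
  next
    fix S assume "S \<in> {S \<in> cubic_systems. \<forall>f\<in>(\<lambda>\<phi> S. \<phi> (crd S)) ` F. f S = 0}"
    then have "S \<in> cubic_systems" "crd S \<in> Y" by (auto simp: F zeros_def)
    then show "S \<in> sysPQ ` Y" using sysPQ_crd by (metis imageI)
  qed
  have "(\<lambda>\<phi> S. \<phi> (crd S)) ` F \<subseteq> coeff_polynomials" using F(1) pf_crd by blast
  then show "zariski_closed (sysPQ ` Y)" unfolding zariski_closed_def using eq by blast
  show "chart (sysPQ ` Y) = Y"
  proof (intro set_eqI iffI)
    fix X assume "X \<in> chart (sysPQ ` Y)"
    then have "sysPQ X \<in> {S \<in> cubic_systems. \<forall>f\<in>(\<lambda>\<phi> S. \<phi> (crd S)) ` F. f S = 0}"
      unfolding chart_def eq by simp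
    then have 0: "\<phi> (crd (sysPQ X)) = 0" if "\<phi> \<in> F" for \<phi> using that by simp
    have "\<phi> X = 0" if "\<phi> \<in> F" for \<phi>
      unfolding 0[OF that, symmetric] by (rule pf_crd_sysPQ[symmetric]) (use F(1) that in blast)
    then show "X \<in> Y" using F(2) by (simp add: zeros_def)
  qed (auto simp: chart_def)
qed

lemma zariski_irreducible_image:
  assumes "alg_irreducible {..<14} Y" shows "zariski_irreducible (sysPQ ` Y)"
  unfolding zariski_irreducible_def
proof (intro conjI allI impI)
  show "sysPQ ` Y \<noteq> {}" using assms by (auto simp: alg_irreducible_def)
  fix A B assume AB: "zariski_closed A" "zariski_closed B" "sysPQ ` Y \<subseteq> A \<union> B"
  then have "Y \<subseteq> chart A \<union> chart B" by (auto simp: chart_def)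
  then have "Y \<subseteq> chart A \<or> Y \<subseteq> chart B"
    using assms AB(1,2)[THEN alg_closed_chart] unfolding alg_irreducible_def by blast
  then show "sysPQ ` Y \<subseteq> A \<or> sysPQ ` Y \<subseteq> B" by (auto simp: chart_def)
qed

lemma alg_irreducible_chart:
  assumes Z: "zariski_irreducible Z" "Z \<subseteq> cubic_systems" shows "alg_irreducible {..<14} (chart Z)"
  unfolding alg_irreducible_def
proof (intro conjI allI impI)
  show "chart Z \<noteq> {}" using Z image_chart[OF Z(2)] by (auto simp: zariski_irreducible_def)
  fix A B assume AB: "alg_closed {..<14} A" "alg_closed {..<14} B" "chart Z \<subseteq> A \<union> B"
  have "Z \<subseteq> sysPQ ` A \<union> sysPQ ` B" using AB(3) image_chart[OF Z(2)] by blast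
  then have "Z \<subseteq> sysPQ ` A \<or> Z \<subseteq> sysPQ ` B"
    using Z(1) AB(1,2)[THEN zariski_closed_image(1)] unfolding zariski_irreducible_def by blast
  then have "chart Z \<subseteq> chart (sysPQ ` A) \<or> chart Z \<subseteq> chart (sysPQ ` B)" by (auto simp: chart_def)
  then show "chart Z \<subseteq> A \<or> chart Z \<subseteq> B" using AB(1,2)[THEN zariski_closed_image(2)] by simp
qed

section \<open>The family, its closure and its codimension\<close>

theorem mainTheorem3:
  "\<exists>W \<subseteq> cubic_systems.
     zariski_locally_closed W \<and> zariski_irreducible W \<and> zariski_codim W = 11 \<and>
     (\<forall>(P, Q) \<in> W. has_focus P Q \<and>
        (\<forall>s. focal_values P Q s \<longrightarrow> (\<forall>k\<in>{1..11}. s k = 0) \<and> s 12 \<noteq> 0))"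
proof -
  let ?V = "{..<14} :: nat set" and ?g = "\<lambda>z::nat \<Rightarrow> complex. focS z 12"
  obtain P where P: "pf_prime ?V P" "\<And>m. m < 11 \<Longrightarrow> (\<lambda>z. focS z (Suc m)) \<in> P"
    "?g \<notin> P" "pf_indep P free_coords"
    "\<And>j. j \<in> ?V - free_coords \<Longrightarrow> \<not> pf_indep P (insert j free_coords)"
    by (rule focal_prime_exists) (rule that)
  have g: "?g \<in> pf ?V" by (rule pf_focS)
  have PV: "P \<subseteq> pf ?V" using pf_idealD(1)[OF pf_primeD(1)[OF P(1)]] by blast
  have cl: "alg_closed ?V (zeros P)" "alg_closed ?V (zeros {?g})" using PV g by (auto intro!: alg_closed_zeros)
  define W where "W = sysPQ ` (zeros P - zeros {?g})"
  \<comment> \<open>The zero set of the twelfth polynomial is a union of fibres, which lets the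
    image commute with the set difference although \<open>sysPQ\<close> is not injective.\<close>
  have inj: "X \<in> zeros {?g}" if "sysPQ X \<in> sysPQ ` zeros {?g}" for X
  proof -
    have "X \<in> chart (sysPQ ` zeros {?g})" using that by (simp add: chart_def)
    then show ?thesis by (simp only: zariski_closed_image(2)[OF cl(2)])
  qed
  have "W = sysPQ ` zeros P - sysPQ ` zeros {?g}"
  proof (intro set_eqI iffI)
    fix S assume "S \<in> W"
    then obtain X where X: "X \<in> zeros P" "X \<notin> zeros {?g}" "S = sysPQ X" by (auto simp: W_def)
    have "S \<notin> sysPQ ` zeros {?g}"
    proof
      assume "S \<in> sysPQ ` zeros {?g}"
      then have "sysPQ X \<in> sysPQ ` zeros {?g}" unfolding X(3) .
      then have "X \<in> zeros {?g}" by (rule inj)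
      then show False using X(2) by contradiction
    qed
    moreover have "S \<in> sysPQ ` zeros P" unfolding X(3) using X(1) by (rule imageI)
    ultimately show "S \<in> sysPQ ` zeros P - sysPQ ` zeros {?g}" by (rule DiffI[rotated])
  next
    fix S assume S: "S \<in> sysPQ ` zeros P - sysPQ ` zeros {?g}"
    then obtain X where "X \<in> zeros P" "S = sysPQ X" by auto
    then show "S \<in> W" using S by (auto simp: W_def)
  qed
  then have lc: "zariski_locally_closed W"
    unfolding zariski_locally_closed_def using cl[THEN zariski_closed_image(1)] by blast
  have irr: "zariski_irreducible W"
    unfolding W_def by (rule zariski_irreducible_image[OF alg_irreducible_prime_open[OF P(1) g P(3)]])
  have closure: "zariski_closure W = sysPQ ` zeros P"
  proof
    show "zariski_closure W \<subseteq> sysPQ ` zeros P"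
      unfolding zariski_closure_def using zariski_closed_image(1)[OF cl(1)] by (auto simp: W_def)
    show "sysPQ ` zeros P \<subseteq> zariski_closure W"
      unfolding zariski_closure_def
    proof (intro Inter_greatest)
      fix Z assume "Z \<in> {Z. zariski_closed Z \<and> W \<subseteq> Z}"
      then have Z: "zariski_closed Z" "W \<subseteq> Z" by auto
      obtain F where F: "F \<subseteq> pf ?V" "chart Z = zeros F"
        using alg_closed_chart[OF Z(1)] by (auto simp: alg_closed_def)
      have "zeros P - zeros {?g} \<subseteq> zeros F" using Z(2) F(2) by (auto simp: W_def chart_def)
      then have "F \<subseteq> vanishing ?V (zeros P - zeros {?g})" using F(1) by (auto simp: vanishing_def zeros_def)
      \<comment> \<open>Equations that hold on the open part belong to \<open>P\<close>, so they
        hold on all of \<open>zeros P\<close>.\<close>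
      then have "F \<subseteq> P" unfolding vanishing_prime_open[OF P(1) g P(3)] .
      then have "zeros P \<subseteq> chart Z" unfolding F(2) by (auto simp: zeros_def)
      then show "sysPQ ` zeros P \<subseteq> Z" by (auto simp: chart_def)
    qed
  qed
  have free: "finite ?V" "free_coords \<subseteq> ?V" "card free_coords = 3" "card (?V - free_coords) = 11"
    by (auto simp: free_coords_def card_Diff_subset)
  have codim: "zariski_codim W = 11"
  proof (rule antisym)
    show "zariski_codim W \<le> 11"
      unfolding zariski_codim_def
    proof (rule Sup_least)
      fix x assume "x \<in> {enat n | n. \<exists>Z :: nat \<Rightarrow> system set. Z 0 = zariski_closure W \<and>
        (\<forall>i\<le>n. zariski_closed (Z i) \<and> zariski_irreducible (Z i)) \<and> (\<forall>i<n. Z i \<subset> Z (Suc i))}"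
      then obtain n and Z :: "nat \<Rightarrow> system set" where x: "x = enat n" and Z0: "Z 0 = sysPQ ` zeros P"
        and Z: "\<And>i. i \<le> n \<Longrightarrow> zariski_closed (Z i) \<and> zariski_irreducible (Z i)" "\<And>i. i < n \<Longrightarrow> Z i \<subset> Z (Suc i)"
        unfolding closure by blast
      have "chart (Z 0) = zeros P" unfolding Z0 by (rule zariski_closed_image(2)[OF cl(1)])
      then have ind: "pf_indep (vanishing ?V (chart (Z 0))) free_coords"
        using P(4) vanishing_zeros_prime[OF P(1)] by simp
      \<comment> \<open>Here \<open>3 + n \<le> 14\<close> bounds the length of every chain above
        the closure.\<close>
      have "card free_coords + n \<le> card ?V"
      proof (rule alg_chain_length[where Z = "\<lambda>i. chart (Z i)", OF free(1,2) ind])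
        show "alg_closed ?V (chart (Z i)) \<and> alg_irreducible ?V (chart (Z i))" if "i \<le> n" for i
          using Z(1)[OF that] alg_closed_chart alg_irreducible_chart zariski_closed_subset by blast
        show "chart (Z i) \<subset> chart (Z (Suc i))" if "i < n" for i
        proof -
          have "chart (Z i) \<subseteq> chart (Z (Suc i))" using Z(2)[OF that] by (auto simp: chart_def)
          moreover have "chart (Z i) \<noteq> chart (Z (Suc i))"
          proof
            assume eq: "chart (Z i) = chart (Z (Suc i))"
            have "Z i \<subseteq> cubic_systems" "Z (Suc i) \<subseteq> cubic_systems"
              using Z(1)[of i] Z(1)[of "Suc i"] that zariski_closed_subset by auto
            then have "Z i = Z (Suc i)" using image_chart eq by metis
            then show False using Z(2)[OF that] by simp
          qed
          ultimately show ?thesis by blast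
        qed
      qed
      then have "n \<le> 11" using free by simp
      then have "enat n \<le> enat 11" by (simp only: enat_ord_simps)
      then show "x \<le> 11" unfolding x numeral_eq_enat .
    qed
    show "11 \<le> zariski_codim W"
      unfolding zariski_codim_def
    proof (rule Sup_upper)
      \<comment> \<open>The chain of cylinders releases the eleven dependent coordinates one by one,
        so it has length exactly 11.\<close>
      obtain Z where Z: "Z 0 = zeros P" "\<And>i. i \<le> 11 \<Longrightarrow> alg_closed ?V (Z i) \<and> alg_irreducible ?V (Z i)"
        "\<And>i. i < 11 \<Longrightarrow> Z i \<subset> Z (Suc i)"
        using alg_chain_exists[OF free(1,2) P(1,4,5)] unfolding free(4) by blast
      have "sysPQ ` Z i \<subset> sysPQ ` Z (Suc i)" if "i < 11" for i
      proof -
        have i: "i \<le> 11" "Suc i \<le> 11" using that by simp_all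
        have c: "chart (sysPQ ` Z i) = Z i" "chart (sysPQ ` Z (Suc i)) = Z (Suc i)"
          by (rule zariski_closed_image(2)[OF conjunct1[OF Z(2)[OF i(1)]]]
              zariski_closed_image(2)[OF conjunct1[OF Z(2)[OF i(2)]]])+
        have "sysPQ ` Z i \<noteq> sysPQ ` Z (Suc i)"
        proof
          assume "sysPQ ` Z i = sysPQ ` Z (Suc i)"
          then have "chart (sysPQ ` Z i) = chart (sysPQ ` Z (Suc i))" by (rule arg_cong)
          then have "Z i = Z (Suc i)" unfolding c .
          then show False using less_imp_neq[OF Z(3)[OF that]] by contradiction
        qed
        moreover have "sysPQ ` Z i \<subseteq> sysPQ ` Z (Suc i)"
          by (rule image_mono[OF psubset_imp_subset[OF Z(3)[OF that]]])
        ultimately show ?thesis by (rule psubsetI[rotated])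
      qed
      moreover have "zariski_closed (sysPQ ` Z i) \<and> zariski_irreducible (sysPQ ` Z i)" if "i \<le> 11" for i
        by (intro conjI zariski_closed_image(1)[OF conjunct1[OF Z(2)[OF that]]]
            zariski_irreducible_image[OF conjunct2[OF Z(2)[OF that]]])
      ultimately have "\<exists>Y :: nat \<Rightarrow> system set. Y 0 = sysPQ ` zeros P \<and>
        (\<forall>i\<le>11. zariski_closed (Y i) \<and> zariski_irreducible (Y i)) \<and> (\<forall>i<11. Y i \<subset> Y (Suc i))"
        by (intro exI[of _ "\<lambda>i. sysPQ ` Z i"] conjI allI impI) (simp_all only: Z(1))
      then show "11 \<in> {enat n | n. \<exists>Z :: nat \<Rightarrow> system set. Z 0 = zariski_closure W \<and>
        (\<forall>i\<le>n. zariski_closed (Z i) \<and> zariski_irreducible (Z i)) \<and> (\<forall>i<n. Z i \<subset> Z (Suc i))}"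
        unfolding closure numeral_eq_enat by (intro CollectI exI[of _ 11] conjI refl)
    qed
  qed
  have foc: "has_focus P' Q' \<and> (\<forall>s. focal_values P' Q' s \<longrightarrow> (\<forall>k\<in>{1..11}. s k = 0) \<and> s 12 \<noteq> 0)"
    if PQ: "(P', Q') \<in> W" for P' Q'
  proof -
    obtain X where X: "X \<in> zeros P" "focS X 12 \<noteq> 0" "P' = sysP X" "Q' = sysQ X"
      using PQ by (auto simp: W_def sysPQ_def zeros_def)
    have z: "focS X m = 0" if "1 \<le> m" "m \<le> 11" for m
    proof -
      have mem: "(\<lambda>z. focS z m) \<in> P" using P(2)[of "m - 1"] that by simp
      have "\<forall>f\<in>P. f X = 0" using X(1) by (simp add: zeros_def)
      from bspec[OF this mem] show ?thesis .
    qed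
    have foc: "(\<forall>k\<in>{1..11}. s k = 0) \<and> s 12 \<noteq> 0" if "focal_values P' Q' s" for s
      by (rule focal_values_sys[OF z X(2) that[unfolded X(3,4)]])
    obtain s where s: "focal_values P' Q' s" using focal_values_sys_exist[of X] unfolding X(3,4) by (elim exE)
    have "has_focus P' Q'" unfolding has_focus_def
    proof (intro exI conjI)
      show "focal_values P' Q' s" by (rule s)
      show "(1::nat) \<le> 12" by simp
      show "s 12 \<noteq> 0" by (rule conjunct2[OF foc[OF s]])
    qed
    then show ?thesis by (rule conjI) (intro allI impI foc)
  qed
  have "\<forall>(P, Q)\<in>W. has_focus P Q \<and>
      (\<forall>s. focal_values P Q s \<longrightarrow> (\<forall>k\<in>{1..11}. s k = 0) \<and> s 12 \<noteq> 0)"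
  proof (intro ballI case_prodI2)
    fix S P' Q' assume "S \<in> W" "S = (P', Q')"
    then have "(P', Q') \<in> W" by (simp only:)
    then show "has_focus P' Q' \<and> (\<forall>s. focal_values P' Q' s \<longrightarrow> (\<forall>k\<in>{1..11}. s k = 0) \<and> s 12 \<noteq> 0)"
      by (rule foc)
  qed
  moreover have "W \<subseteq> cubic_systems" by (auto simp: W_def sysPQ_cubic)
  moreover note lc irr codim
  ultimately show ?thesis by (intro exI[of _ W] conjI)
qed

end
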